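(* Let $\alpha,\beta>-1/2$, $a\ge1$, $b=0$ or $b\ge1$, and $j\in\mathbb{N}_0=\{0,1,2,\dots\}$. Let $u_j(\theta)=(\sin\frac\theta2)^{aj}(\cos\frac\theta2)^{bj}$, $\theta\in(0,\pi)$. Then, for $\theta,\varphi\in(0,\pi)$, $$|u_j(\theta)u_j(\varphi)\mathcal{K}^{\alpha+aj,\beta+bj}(\theta,\varphi)|\le\frac{C_1}{\mu_{\alpha,\beta}(B(\theta,|\theta-\varphi|))},\qquad\theta\ne\varphi,$$ and $$\big|\nabla_{\theta,\varphi}\big(u_j(\theta)u_j(\varphi)\mathcal{K}^{\alpha+aj,\beta+bj}(\theta,\varphi)\big)\big|\le\frac{C_2}{|\theta-\varphi|\,\mu_{\alpha,\beta}(B(\theta,|\theta-\varphi|))},\qquad\theta\ne\varphi,$$ with constants $C_1$ and $C_2$ independent of $j$ (and of $\theta,\varphi$).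
   Context: $d\mu_{\alpha,\beta}(\theta)=(\sin\frac\theta2)^{2\alpha+1}(\cos\frac\theta2)^{2\beta+1}d\theta$ on $(0,\pi)$, and $\mu_{\alpha,\beta}(B(\theta,|\theta-\varphi|))$ is the $\mu_{\alpha,\beta}$-measure of the interval with center $\theta$ and radius $|\theta-\varphi|$ (intersected with $(0,\pi)$). $\nabla_{\theta,\varphi}$ is the gradient in the two variables $(\theta,\varphi)$. $\mathcal{P}_n^{(\alpha,\beta)}(\theta)=d_n^{\alpha,\beta}P_n^{(\alpha,\beta)}(\cos\theta)$, $n\ge0$, where $P_n^{(\alpha,\beta)}$ are the classical Jacobi polynomials (Szegő normalization) and $d_n^{\alpha,\beta}=\Big(\frac{(2n+\alpha+\beta+1)\Gamma(n+1)\Gamma(n+\alpha+\beta+1)}{\Gamma(n+\alpha+1)\Gamma(n+\beta+1)}\Big)^{1/2}$; these form an orthonormal basis of $L^2(d\mu_{\alpha,\beta})$. The Jacobi--Poisson kernel is $\mathcal{P}_t^{\alpha,\beta}(\theta,\varphi)=\sum_{n=0}^\infty e^{-t|n+\frac{\alpha+\beta+1}{2}|}\mathcal{P}_n^{(\alpha,\beta)}(\theta)\mathcal{P}_n^{(\alpha,\beta)}(\varphi)$, $t>0$, and the Jacobi--Riesz kernel is $$\mathcal{K}^{\alpha,\beta}(\theta,\varphi)=\int_0^\infty\partial_\theta\mathcal{P}_t^{\alpha,\beta}(\theta,\varphi)\,dt,\qquad\theta\neq\varphi.$$ For $\alpha,\beta>-1/2$ it equals $$\frac{\Gamma(\alpha+\beta+2)}{\pi2^{\alpha+\beta+1}\Gamma(\alpha+\frac12)\Gamma(\beta+\frac12)}$$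 times, up to sign convention, $\int_{-1}^1\int_{-1}^1(1-u^2)^{\alpha-1/2}(1-v^2)^{\beta-1/2}(1-z)^{-\alpha-\beta-2}\,\partial_\theta(1-z)\,du\,dv$ and a fixed absolute constant, where $z=u\sin\frac\theta2\sin\frac\varphi2+v\cos\frac\theta2\cos\frac\varphi2$; the defining formula is the integral of $\partial_\theta\mathcal{P}_t^{\alpha,\beta}$ above. *)

theory Defs
  imports "HOL-Analysis.Analysis"
begin

text \<open>
  Classical Jacobi polynomial as a function of a real variable, in Szego's normalization
  \<open>P\<^sub>n(1) = (n + \<alpha>) gchoose n\<close>; this is Szego's explicit formula, which is polynomial
  in the parameters.
\<close>
definition jacobi_P :: "real \<Rightarrow> real \<Rightarrow> nat \<Rightarrow> real \<Rightarrow> real" where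
  "jacobi_P \<alpha> \<beta> n x =
     (\<Sum>s\<le>n. ((real n + \<alpha>) gchoose (n - s)) * ((real n + \<beta>) gchoose s)
              * ((x - 1) / 2) ^ s * ((x + 1) / 2) ^ (n - s))"

definition jacobi_d :: "real \<Rightarrow> real \<Rightarrow> nat \<Rightarrow> real" where
  "jacobi_d \<alpha> \<beta> n =
     sqrt ((2 * real n + \<alpha> + \<beta> + 1) * Gamma (real n + 1) * Gamma (real n + \<alpha> + \<beta> + 1)
           / (Gamma (real n + \<alpha> + 1) * Gamma (real n + \<beta> + 1)))"

definition jacobi_trig :: "real \<Rightarrow> real \<Rightarrow> nat \<Rightarrow> real \<Rightarrow> real" where
  "jacobi_trig \<alpha> \<beta> n \<theta> = jacobi_d \<alpha> \<beta> n * jacobi_P \<alpha> \<beta> n (cos \<theta>)"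

definition jacobi_poisson :: "real \<Rightarrow> real \<Rightarrow> real \<Rightarrow> real \<Rightarrow> real \<Rightarrow> real" where
  "jacobi_poisson \<alpha> \<beta> t \<theta> \<phi> =
     (\<Sum>n. exp (- t * \<bar>real n + (\<alpha> + \<beta> + 1) / 2\<bar>) * jacobi_trig \<alpha> \<beta> n \<theta> * jacobi_trig \<alpha> \<beta> n \<phi>)"

definition jacobi_riesz :: "real \<Rightarrow> real \<Rightarrow> real \<Rightarrow> real \<Rightarrow> real" where
  "jacobi_riesz \<alpha> \<beta> \<theta> \<phi> =
     (LBINT t:{0<..}. deriv (\<lambda>x. jacobi_poisson \<alpha> \<beta> t x \<phi>) \<theta>)"

text \<open>The space of this measure is the open interval \<open>(0, \<pi>)\<close>, not the whole line.\<close>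
definition jacobi_measure :: "real \<Rightarrow> real \<Rightarrow> real measure" where
  "jacobi_measure \<alpha> \<beta> =
     density (restrict_space lborel {0<..<pi})
       (\<lambda>\<theta>. ennreal (sin (\<theta> / 2) powr (2 * \<alpha> + 1) * cos (\<theta> / 2) powr (2 * \<beta> + 1)))"

definition jacobi_ball_measure :: "real \<Rightarrow> real \<Rightarrow> real \<Rightarrow> real \<Rightarrow> real" where
  "jacobi_ball_measure \<alpha> \<beta> \<theta> r = measure (jacobi_measure \<alpha> \<beta>) (ball \<theta> r \<inter> {0<..<pi})"

definition jacobi_u :: "real \<Rightarrow> real \<Rightarrow> nat \<Rightarrow> real \<Rightarrow> real" where
  "jacobi_u a b j \<theta> = sin (\<theta> / 2) powr (a * real j) * cos (\<theta> / 2) powr (b * real j)"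

definition weighted_riesz ::
  "real \<Rightarrow> real \<Rightarrow> real \<Rightarrow> real \<Rightarrow> nat \<Rightarrow> real \<Rightarrow> real \<Rightarrow> real" where
  "weighted_riesz \<alpha> \<beta> a b j \<theta> \<phi> =
     jacobi_u a b j \<theta> * jacobi_u a b j \<phi> * jacobi_riesz (\<alpha> + a * real j) (\<beta> + b * real j) \<theta> \<phi>"

end

theory Submission
  imports Defs "HOL-Computational_Algebra.Polynomial"
begin

text \<open>
  Expanding the Gegenbauer generating function under the product formula for Jacobi polynomials gives
  \<open>P\<^sub>t(\<theta>, \<phi>) = c \<integral>\<integral> sinh (t / 2) (cosh (t / 2) - z) powr (- N)\<close> with \<open>N = \<alpha> + \<beta> + 2\<close>, and integrating the
  \<open>\<theta>\<close>-derivative in \<open>t\<close> gives \<open>K(\<theta>, \<phi>) = c' \<integral>\<integral> (1 - z) powr (- N) \<partial>z/\<partial>\<theta>\<close>. The product formula itself follows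
  from Bailey's bilinear expansion of \<open>P\<^sub>n(x) P\<^sub>n(y)\<close>, both sides of which are polynomial solutions of
  the Jacobi equation in \<open>x\<close>.

  With \<open>x = 1 - u\<close>, \<open>y = 1 - v\<close> one has \<open>1 - z = D + A x + B y\<close>, where \<open>A = sin (\<theta>/2) sin (\<phi>/2)\<close>,
  \<open>B = cos (\<theta>/2) cos (\<phi>/2)\<close> and \<open>D = 1 - A - B\<close> is comparable to \<open>(\<theta> - \<phi>)\<^sup>2\<close>. For the parameters
  \<open>\<alpha> + p\<close>, \<open>\<beta> + q\<close> with \<open>p = a j\<close>, \<open>q = b j\<close>, the integral is dominated by a Dirichlet integral whose Gamma
  quotient cancels the normalising constant up to a factor independent of \<open>j\<close>, and which produces exactly
  the factor \<open>A powr (- p) * B powr (- q)\<close> that \<open>u\<^sub>j(\<theta>) u\<^sub>j(\<phi>)\<close> absorbs. A factor \<open>x\<close> or \<open>y\<close> in the integrand costs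
  a factor \<open>(1 + p) D / A\<close> or \<open>(1 + q) D / B\<close>; in the derivatives these gains and losses balance
  the factors \<open>p\<close>, \<open>q\<close>, \<open>N\<close> coming from differentiation.
\<close>

section \<open>Gegenbauer polynomials\<close>

unbundle no vec_syntax
unbundle fps_syntax

text \<open>Constants must survive j tending to infinity, whereas p, q and N grow with j. The
  hypotheses on a and b make each of p and q either 0 or at least 1. Differentiating
  \<open>jacobi_u\<close> produces a term with the factor p whose estimate shifts p by -1; this is
  possible for p \<ge> 1, and for p = 0 the term is absent. The same holds for q. Moreover a \<ge> 1
  gives q \<le> b (1 + p); comparing two Beta functions costs a power of M / (1 + p) with M about q,
  and this inequality keeps it bounded.

  The bounded range 0 < x < 2 has to be exploited: integration up to infinity would produce
  \<open>A powr (- w1)\<close>, but the ball measure demands \<open>(D + A) powr (- w1)\<close>, and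
  A may be far smaller than D.

  Only even Gegenbauer degrees contribute. With \<open>r = exp (- t / 2)\<close> the n-th Poisson
  factor is r to the power 2n + \<alpha> + \<beta> + 1, which points to degree 2n, and the odd
  degrees average to zero by symmetry.\<close>

definition gegenbauer :: "real \<Rightarrow> nat \<Rightarrow> real \<Rightarrow> real" where
  "gegenbauer l m z = (\<Sum>n\<le>m. pochhammer l n / fact n * of_nat (n choose (m - n))
     * (- 1) ^ (m - n) * (2 * z) ^ (n - (m - n)))"

text \<open>The value at z = 1, that is, the coefficient of r^m in (1 - r)^(-2l), in the shape in
  which a Cauchy product delivers it.\<close>

definition gegenbauer_bound :: "real \<Rightarrow> nat \<Rightarrow> real" where
  "gegenbauer_bound l m = (\<Sum>k\<le>m. (pochhammer l k / fact k) * (pochhammer l (m - k) / fact (m - k)))"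

text \<open>The series of (1 - w X)^(-l). As l is an arbitrary real number, the series is handled
  through its first order differential equation rather than as a power. The coefficients are complex
  because 1 - 2zX + X^2 splits only over the complex numbers when |z| < 1.\<close>

abbreviation rising_fps :: "real \<Rightarrow> complex \<Rightarrow> complex fps" where
  "rising_fps l w \<equiv> Abs_fps (\<lambda>k. of_real (pochhammer l k / fact k) * w ^ k)"

text \<open>The quotient of two solutions has derivative zero, hence equals its constant coefficient
  1.\<close>

lemma fps_first_order_ode_unique:
  fixes F S Q L :: "complex fps"
  assumes F: "Q * fps_deriv F = L * F" and S: "Q * fps_deriv S = L * S"
    and Q: "Q \<noteq> 0" and F0: "F $ 0 = 1" and S0: "S $ 0 = 1"
  shows "F = S"
proof -
  have "Q * (fps_deriv F * S - F * fps_deriv S) = 0"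
  proof -
    have "Q * (fps_deriv F * S - F * fps_deriv S) = (Q * fps_deriv F) * S - F * (Q * fps_deriv S)"
      by (simp add: algebra_simps)
    then show ?thesis unfolding F S by (simp add: algebra_simps)
  qed
  with Q have eq: "fps_deriv F * S = F * fps_deriv S" by simp
  have S1: "S * inverse S = 1" using S0 by (simp add: inverse_mult_eq_1')
  have "fps_deriv (F * inverse S) = (fps_deriv F * S - F * fps_deriv S) * (inverse S)\<^sup>2"
  proof -
    \<comment> \<open>The explicit factor \<open>1\<close> marks the place where
      \<open>S * inverse S\<close> is inserted, so that both terms carry the square of
      \<open>inverse S\<close>.\<close>
    have "fps_deriv (F * inverse S) = fps_deriv F * inverse S * 1 - F * fps_deriv S * (inverse S)\<^sup>2"
      using S0 by (simp add: fps_inverse_deriv algebra_simps)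
    then show ?thesis unfolding S1[symmetric] by (simp only: power2_eq_square algebra_simps)
  qed
  then have "fps_deriv (F * inverse S) = 0" using eq by simp
  then have "F * inverse S = fps_const ((F * inverse S) $ 0)"
    using fps_deriv_eq_0_iff by blast
  also have "(F * inverse S) $ 0 = 1" using F0 S0 by simp
  finally have "F * inverse S = 1" by simp
  moreover have "F = F * (S * inverse S)" unfolding S1 by simp
  moreover have "F * (S * inverse S) = S * (F * inverse S)" by (simp only: mult_ac)
  ultimately show ?thesis by simp
qed

lemma rising_fps_deriv:
  "(1 - fps_const w * fps_X) * fps_deriv (rising_fps l w) = fps_const (of_real l * w) * rising_fps l w"
proof (rule fps_ext)
  fix n
  let ?a = "\<lambda>k. complex_of_real (pochhammer l k / fact k)"
  have rec: "of_nat (Suc n) * ?a (Suc n) = (of_real l + of_nat n) * ?a n"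
  proof -
    have "of_nat (Suc n) * (pochhammer l (Suc n) / fact (Suc n)) = (l + of_nat n) * (pochhammer l n / fact n)"
      by (simp add: pochhammer_Suc divide_simps del: of_nat_Suc)
    from arg_cong[OF this, of complex_of_real] show ?thesis
      by (simp del: of_nat_Suc fact_Suc)
  qed
  have "(1 - fps_const w * fps_X) * fps_deriv (rising_fps l w) =
     fps_deriv (rising_fps l w) - fps_const w * (fps_X * fps_deriv (rising_fps l w))"
    by (simp add: algebra_simps)
  then have "((1 - fps_const w * fps_X) * fps_deriv (rising_fps l w)) $ n =
     fps_deriv (rising_fps l w) $ n - w * (if n = 0 then 0 else fps_deriv (rising_fps l w) $ (n - 1))"
    by simp
  also have "\<dots> = of_nat (Suc n) * ?a (Suc n) * w ^ Suc n - of_nat n * ?a n * w ^ Suc n"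
    by (cases n) (simp_all add: mult_ac del: of_nat_Suc fact_Suc)
  also have "\<dots> = of_real l * w * (?a n * w ^ n)"
    unfolding rec by (simp only: power_Suc algebra_simps)
  finally show "((1 - fps_const w * fps_X) * fps_deriv (rising_fps l w)) $ n = (fps_const (of_real l * w) * rising_fps l w) $ n"
    by simp
qed

text \<open>Expanding (1 - X (2z - X))^(-l) in powers of X (2z - X) gives the defining sum. The
  truncated subtraction in its exponents is harmless: if n < m - n, the binomial coefficient is
  zero.\<close>

lemma gegenbauer_fps:
  "Abs_fps (\<lambda>m. complex_of_real (gegenbauer l m z)) = rising_fps l 1 oo (fps_X * (fps_const (of_real (2 * z)) - fps_X))"
proof (rule fps_ext)
  fix m
  let ?c = "fps_const (of_real (2 * z)) :: complex fps"
  have nth: "((?c - fps_X) ^ n) $ k = of_nat (n choose k) * (-1) ^ k * of_real ((2 * z) ^ (n - k))" for n k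
  proof -
    have "(?c - fps_X) ^ n = (-fps_X + ?c) ^ n" by simp
    also have "\<dots> = (\<Sum>i\<le>n. of_nat (n choose i) * (- fps_X) ^ i * ?c ^ (n - i))"
      by (rule binomial_ring)
    also have "\<dots> = (\<Sum>i\<le>n. fps_const (of_nat (n choose i) * (-1)^i * of_real ((2*z) ^ (n - i))) * fps_X ^ i)"
    proof (rule sum.cong[OF refl])
      fix i
      have a: "(- fps_X :: complex fps) ^ i = fps_const ((-1)^i) * fps_X ^ i"
        by (subst power_minus) (simp flip: fps_const_power fps_const_neg)
      have b: "?c ^ (n - i) = fps_const (of_real ((2*z) ^ (n - i)))" by (simp add: fps_const_power)
      show "of_nat (n choose i) * (- fps_X) ^ i * ?c ^ (n - i) =
         fps_const (of_nat (n choose i) * (-1)^i * of_real ((2*z) ^ (n - i))) * fps_X ^ i"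
        unfolding a b fps_of_nat[symmetric] fps_const_mult[symmetric] by (simp only: mult_ac)
    qed
    finally have "((?c - fps_X) ^ n) $ k =
       (\<Sum>i\<le>n. of_nat (n choose i) * (-1)^i * of_real ((2*z) ^ (n - i)) * (if k = i then 1 else 0))"
      by (simp add: fps_sum_nth fps_X_power_nth mult.assoc)
    also have "\<dots> = of_nat (n choose k) * (-1) ^ k * of_real ((2 * z) ^ (n - k))"
      by (auto simp: sum.delta' if_distrib binomial_eq_0 cong: if_cong)
    finally show ?thesis .
  qed
  have "(rising_fps l 1 oo (fps_X * (?c - fps_X))) $ m
      = (\<Sum>n=0..m. of_real (pochhammer l n / fact n) * ((fps_X ^ n * (?c - fps_X) ^ n) $ m))"
    by (simp add: fps_compose_nth power_mult_distrib)
  also have "\<dots> = (\<Sum>n\<le>m. of_real (pochhammer l n / fact n * of_nat (n choose (m - n)) * (- 1) ^ (m - n) * (2 * z) ^ (n - (m - n))))"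
    unfolding atMost_atLeast0 by (intro sum.cong refl, subst fps_X_power_mult_nth) (simp only: nth, simp)
  finally show "Abs_fps (\<lambda>m. complex_of_real (gegenbauer l m z)) $ m = (rising_fps l 1 oo (fps_X * (?c - fps_X))) $ m"
    by (simp add: gegenbauer_def)
qed

text \<open>Because 1 - 2zX + X^2 = (1 - wX)(1 - cnj w X), the generating series and the product of
  the two binomial series solve the same equation Q F' = L F with L = l (2z - 2X), and both have
  constant term 1.\<close>

lemma gegenbauer_eq_product:
  fixes w :: complex
  assumes w: "w * cnj w = 1" and z: "w + cnj w = of_real (2 * z)"
  shows "complex_of_real (gegenbauer l m z) =
    (\<Sum>i\<le>m. (of_real (pochhammer l i / fact i) * w ^ i) * (of_real (pochhammer l (m - i) / fact (m - i)) * cnj w ^ (m - i)))"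
proof -
  let ?T = "fps_X * (fps_const (of_real (2 * z)) - fps_X) :: complex fps"
  let ?F = "rising_fps l 1 oo ?T"
  let ?S = "rising_fps l w * rising_fps l (cnj w)"
  let ?Q = "1 - ?T"
  let ?L = "fps_const (of_real l) * (fps_const (of_real (2 * z)) - 2 * fps_X)"
  have T0: "?T $ 0 = 0" by simp
  have Qf: "?Q = (1 - fps_const w * fps_X) * (1 - fps_const (cnj w) * fps_X)"
  proof -
    have a: "fps_const w * fps_const (cnj w) = 1" using w by simp
    have b: "fps_const (of_real (2 * z)) = fps_const w + fps_const (cnj w)" using z by simp
    have "(1 - fps_const w * fps_X) * (1 - fps_const (cnj w) * fps_X) =
       1 - (fps_const w + fps_const (cnj w)) * fps_X + (fps_const w * fps_const (cnj w)) * fps_X * fps_X"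
      by (simp add: algebra_simps del: fps_const_add fps_const_mult)
    also have "\<dots> = ?Q" unfolding a b[symmetric] by (simp add: algebra_simps del: fps_const_add fps_const_mult)
    finally show ?thesis by simp
  qed
  have dF: "?Q * fps_deriv ?F = ?L * ?F"
  proof -
    have d: "fps_deriv ?F = (fps_deriv (rising_fps l 1) oo ?T) * fps_deriv ?T"
      by (rule fps_compose_deriv) (rule T0)
    have "(fps_deriv (rising_fps l 1) - fps_X * fps_deriv (rising_fps l 1)) oo ?T = (fps_const (of_real l) * rising_fps l 1) oo ?T"
      using rising_fps_deriv[of 1 l]
      by (simp only: fps_const_1_eq_1 mult_1_left mult_1_right left_diff_distrib)
    then have "(fps_deriv (rising_fps l 1) oo ?T) - ?T * (fps_deriv (rising_fps l 1) oo ?T) = fps_const (of_real l) * ?F"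
      using T0 by (simp only: fps_compose_mult_distrib fps_compose_sub_distrib fps_const_mult_apply_left fps_X_fps_compose_startby0)
    then have e: "?Q * (fps_deriv (rising_fps l 1) oo ?T) = fps_const (of_real l) * ?F"
      by (simp only: left_diff_distrib mult_1_left)
    have dT: "fps_deriv ?T = fps_const (of_real (2 * z)) - 2 * fps_X"
      by (simp add: algebra_simps)
    have "?Q * fps_deriv ?F = (?Q * (fps_deriv (rising_fps l 1) oo ?T)) * fps_deriv ?T"
      unfolding d by (simp only: mult.assoc)
    also have "\<dots> = ?L * ?F" unfolding e dT by (simp only: mult_ac)
    finally show ?thesis .
  qed
  have dS: "?Q * fps_deriv ?S = ?L * ?S"
  proof -
    let ?a = "rising_fps l w" let ?b = "rising_fps l (cnj w)"
    have "?Q * fps_deriv ?S = ((1 - fps_const w * fps_X) * fps_deriv ?a) * ?b * (1 - fps_const (cnj w) * fps_X)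
       + ((1 - fps_const (cnj w) * fps_X) * fps_deriv ?b) * ?a * (1 - fps_const w * fps_X)"
      unfolding Qf fps_deriv_mult by (simp only: algebra_simps)
    also have "\<dots> = (fps_const (of_real l) * (fps_const w * (1 - fps_const (cnj w) * fps_X) + fps_const (cnj w) * (1 - fps_const w * fps_X))) * ?S"
      unfolding rising_fps_deriv fps_const_mult[symmetric] by (simp only: algebra_simps)
    also have "fps_const w * (1 - fps_const (cnj w) * fps_X) + fps_const (cnj w) * (1 - fps_const w * fps_X)
       = fps_const (w + cnj w) - 2 * (fps_const (w * cnj w) * fps_X)"
      unfolding fps_const_mult[symmetric] fps_const_add[symmetric] by (simp add: algebra_simps del: fps_const_add fps_const_mult)
    also have "\<dots> = fps_const (of_real (2 * z)) - 2 * fps_X" unfolding w z by (simp only: fps_const_1_eq_1 mult_1_left)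
    finally show ?thesis .
  qed
  have "?Q $ 0 = 1" by simp
  then have "?Q \<noteq> 0" by (metis fps_zero_nth zero_neq_one)
  then have "?F = ?S"
    by (intro fps_first_order_ode_unique[OF dF dS]) auto
  then have "complex_of_real (gegenbauer l m z) = ?S $ m"
    by (metis (no_types, lifting) gegenbauer_fps fps_nth_Abs_fps)
  then show ?thesis by (simp add: fps_mult_nth atMost_atLeast0)
qed

section \<open>Convergence of the generating function\<close>

lemma rising_sums:
  fixes z :: complex
  assumes "norm z < 1"
  shows "(\<lambda>k. of_real (pochhammer l k / fact k) * z ^ k) sums (1 - z) powr (- of_real l)"
    and "summable (\<lambda>k. norm (of_real (pochhammer l k / fact k) * z ^ k))"
proof -
  have eq: "(- complex_of_real l gchoose k) * (- y) ^ k = of_real (pochhammer l k / fact k) * y ^ k" for k and y :: complex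
  proof -
    have "((- 1) ^ k * (- 1) ^ k :: complex) = 1" by (simp flip: power_mult_distrib)
    moreover have "(- complex_of_real l gchoose k) * (- y) ^ k
        = ((- 1) ^ k * (- 1) ^ k) * (of_real (pochhammer l k / fact k) * y ^ k)"
      unfolding gbinomial_pochhammer power_minus[of y] by (simp add: pochhammer_of_real[symmetric])
    ultimately show ?thesis by simp
  qed
  have s: "(\<lambda>k. of_real (pochhammer l k / fact k) * y ^ k) sums (1 - y) powr (- of_real l)" if "norm y < 1" for y :: complex
    using gen_binomial_complex[of "-y" "- of_real l"] that unfolding eq by simp
  show "(\<lambda>k. of_real (pochhammer l k / fact k) * z ^ k) sums (1 - z) powr (- of_real l)"
    using s assms .
  \<comment> \<open>Absolute convergence at z follows from plain convergence at a real point of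
    larger modulus.\<close>
  obtain r where r: "norm z < r" "r < 1" using assms dense by blast
  then have "norm (of_real r :: complex) < 1" using norm_ge_zero[of z] by (simp del: norm_ge_zero)
  from s[OF this] have "summable (\<lambda>k. of_real (pochhammer l k / fact k) * (of_real r :: complex) ^ k)"
    by (rule sums_summable)
  then show "summable (\<lambda>k. norm (of_real (pochhammer l k / fact k) * z ^ k))"
    by (rule powser_insidea) (use r norm_ge_zero[of z] in \<open>simp del: norm_ge_zero\<close>)
qed

lemma cis_representation:
  assumes "\<bar>z\<bar> \<le> 1"
  obtains w :: complex where "w * cnj w = 1" "w + cnj w = of_real (2 * z)" "norm w = 1"
proof -
  let ?w = "cis (arccos z)"
  show ?thesis
    by (rule that[of ?w]) (use assms in \<open>auto simp: complex_eq_iff cos_arccos_abs power2_eq_square[symmetric] sin_arccos_abs abs_square_le_1\<close>)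
qed

text \<open>As |w| = 1, each term of the product formula has the modulus of its coefficient, and
  these coefficients are nonnegative for l > 0. The bound does not involve z and therefore dominates
  the series under the integral.\<close>

lemma abs_gegenbauer_le:
  assumes "l > 0" "\<bar>z\<bar> \<le> 1"
  shows "\<bar>gegenbauer l m z\<bar> \<le> gegenbauer_bound l m"
proof -
  obtain w :: complex where w: "w * cnj w = 1" "w + cnj w = of_real (2 * z)" "norm w = 1"
    using cis_representation[OF assms(2)] .
  have "\<bar>gegenbauer l m z\<bar> = norm (complex_of_real (gegenbauer l m z))" by simp
  also have "\<dots> \<le> (\<Sum>i\<le>m. norm ((of_real (pochhammer l i / fact i) * w ^ i) * (of_real (pochhammer l (m - i) / fact (m - i)) * cnj w ^ (m - i))))"
    unfolding gegenbauer_eq_product[OF w(1,2)] by (rule norm_sum)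
  also have "\<dots> = gegenbauer_bound l m"
    unfolding gegenbauer_bound_def using assms(1) w(3)
    by (intro sum.cong) (auto simp: norm_mult norm_power norm_divide pochhammer_nonneg)
  finally show ?thesis .
qed

text \<open>The Cauchy product of two conjugate binomial series sums to the squared modulus of (1 -
  w r)^(-l), and the squared modulus of 1 - w r is 1 - 2rz + r^2.\<close>

lemma gegenbauer_sums:
  assumes z: "\<bar>z\<bar> \<le> 1" and r: "\<bar>r\<bar> < 1"
  shows "(\<lambda>m. gegenbauer l m z * r ^ m) sums ((1 - 2 * r * z + r\<^sup>2) powr (- l))"
proof -
  obtain w :: complex where w: "w * cnj w = 1" "w + cnj w = of_real (2 * z)" "norm w = 1"
    using cis_representation[OF z] .
  let ?r = "of_real r :: complex"
  have n: "norm (w * ?r) < 1" "norm (cnj w * ?r) < 1" using r w(3) by (auto simp: norm_mult)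
  let ?a = "\<lambda>k. of_real (pochhammer l k / fact k) * (w * ?r) ^ k"
  let ?b = "\<lambda>k. of_real (pochhammer l k / fact k) * (cnj w * ?r) ^ k"
  have "(\<lambda>k. \<Sum>i\<le>k. ?a i * ?b (k - i)) sums ((\<Sum>k. ?a k) * (\<Sum>k. ?b k))"
    by (intro Cauchy_product_sums rising_sums n)
  also have "(\<Sum>k. ?a k) * (\<Sum>k. ?b k) = (1 - w * ?r) powr (- of_real l) * (1 - cnj w * ?r) powr (- of_real l)"
    using rising_sums(1)[OF n(1)] rising_sums(1)[OF n(2)] by (simp add: sums_iff)
  also have "(\<lambda>k. \<Sum>i\<le>k. ?a i * ?b (k - i)) = (\<lambda>m. complex_of_real (gegenbauer l m z * r ^ m))"
  proof
    fix k
    have "(\<Sum>i\<le>k. ?a i * ?b (k - i)) = (\<Sum>i\<le>k. (of_real (pochhammer l i / fact i) * w ^ i) * (of_real (pochhammer l (k - i) / fact (k - i)) * cnj w ^ (k - i)) * ?r ^ k)"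
      by (intro sum.cong refl) (auto simp: power_mult_distrib power_add[symmetric] mult_ac)
    also have "\<dots> = complex_of_real (gegenbauer l k z * r ^ k)"
      by (simp add: gegenbauer_eq_product[OF w(1,2)] sum_distrib_right)
    finally show "(\<Sum>i\<le>k. ?a i * ?b (k - i)) = complex_of_real (gegenbauer l k z * r ^ k)" .
  qed
  also have "(1 - w * ?r) powr (- of_real l) * (1 - cnj w * ?r) powr (- of_real l) = complex_of_real ((1 - 2 * r * z + r\<^sup>2) powr (- l))"
  proof -
    let ?q = "1 - w * ?r"
    have "Re (w * ?r) < 1" using n(1) complex_Re_le_cmod[of "w * ?r"] by linarith
    then have pos: "Re ?q > 0" by simp
    \<comment> \<open>The positive real part keeps \<open>?q\<close> away from the branch cut, on
      which conjugation and complex powers do not commute.\<close>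
    then have "?q \<notin> \<real>\<^sub>\<le>\<^sub>0" by (auto simp: complex_nonpos_Reals_iff)
    then have "cnj ?q powr (- of_real l) = cnj (?q powr (- of_real l))"
      using cnj_powr[of ?q "- of_real l"] pos by (auto simp: complex_is_Real_iff complex_nonpos_Reals_iff)
    then have "?q powr (- of_real l) * (1 - cnj w * ?r) powr (- of_real l) = of_real ((norm (?q powr (of_real (- l))))\<^sup>2)"
      by (simp only: complex_norm_square) simp
    also have "norm (?q powr (of_real (- l))) = norm ?q powr (- l)"
      by (simp add: norm_powr_real_powr')
    also have "(norm ?q powr (- l))\<^sup>2 = ((norm ?q)\<^sup>2) powr (- l)"
      using pos by (simp add: power2_eq_square powr_mult)
    also have "(norm ?q)\<^sup>2 = 1 - 2 * r * z + r\<^sup>2"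
    proof -
      have "complex_of_real ((norm ?q)\<^sup>2) = ?q * cnj ?q" by (simp only: complex_norm_square)
      also have "\<dots> = 1 - (w + cnj w) * ?r + (w * cnj w) * ?r\<^sup>2" by (simp add: algebra_simps power2_eq_square)
      also have "\<dots> = of_real (1 - 2 * r * z + r\<^sup>2)" unfolding w(1,2) by simp
      finally show ?thesis using of_real_eq_iff by blast
    qed
    finally show ?thesis .
  qed
  finally show ?thesis by (simp only: sums_of_real_iff)
qed

lemma summable_gegenbauer_bound:
  assumes "l > 0" "\<bar>r\<bar> < 1"
  shows "summable (\<lambda>m. gegenbauer_bound l m * r ^ m)"
proof -
  let ?a = "\<lambda>k. of_real (pochhammer l k / fact k) * (of_real r :: complex) ^ k"
  have n: "norm (of_real r :: complex) < 1" using assms by simp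
  have "summable (\<lambda>k. \<Sum>i\<le>k. ?a i * ?a (k - i))"
    by (rule sums_summable[OF Cauchy_product_sums]) (intro rising_sums n)+
  also have "(\<lambda>k. \<Sum>i\<le>k. ?a i * ?a (k - i)) = (\<lambda>m. complex_of_real (gegenbauer_bound l m * r ^ m))"
    unfolding gegenbauer_bound_def of_real_mult of_real_sum sum_distrib_right
    by (intro ext sum.cong refl) (auto simp: power_add[symmetric] mult_ac)
  finally show ?thesis by (simp only: summable_of_real_iff)
qed

lemma summable_weighted_gegenbauer_bound:
  assumes "l > 0" "\<bar>r\<bar> < 1"
  shows "summable (\<lambda>m. (real m + l) * (gegenbauer_bound l m * r ^ m))"
proof -
  let ?b = "gegenbauer_bound l"
  have "summable (\<lambda>n. diffs ?b n * r ^ n)"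
    by (rule termdiff_converges[where K=1]) (use assms summable_gegenbauer_bound in auto)
  \<comment> \<open>The derived series has lost a factor r and is shifted by one index; both are
    restored here, the missing term of index 0 being zero.\<close>
  then have "summable (\<lambda>n. (real (Suc n) * ?b (Suc n) * r ^ n) * r)"
    unfolding diffs_def by (intro summable_mult2)
  moreover define g where "g = (\<lambda>n. real n * ?b n * r ^ n)"
  have "(\<lambda>n. (real (Suc n) * ?b (Suc n) * r ^ n) * r) = (\<lambda>n. g (Suc n))"
    unfolding g_def by (intro ext) (simp only: power_Suc mult_ac)
  ultimately have "summable g" using summable_Suc_iff[of g] by simp
  then have "summable (\<lambda>n. real n * ?b n * r ^ n)" unfolding g_def .
  then have "summable (\<lambda>n. real n * ?b n * r ^ n + l * (?b n * r ^ n))"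
    by (intro summable_add summable_mult summable_gegenbauer_bound assms)
  then show ?thesis by (simp add: algebra_simps)
qed

text \<open>The operator r d/dr + l is applied to the generating function. For m = 2n and l =
  \<alpha> + \<beta> + 1 the weight m + l is the factor that survives in the squared normalisation
  of the Jacobi functions, and the new factor 1 - r^2 becomes \<open>sinh (t / 2)\<close> in the
  Poisson kernel.\<close>

lemma weighted_gegenbauer_sums:
  assumes z: "\<bar>z\<bar> \<le> 1" and r: "\<bar>r\<bar> < 1" and "l > 0"
  shows "(\<lambda>m. (real m + l) * (gegenbauer l m z * r ^ m)) sums (l * (1 - r\<^sup>2) * (1 - 2 * r * z + r\<^sup>2) powr (- l - 1))"
proof -
  let ?c = "\<lambda>m. gegenbauer l m z"
  let ?f = "\<lambda>r. (1 - 2 * r * z + r\<^sup>2) powr (- l)"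
  have pos: "1 - 2 * r * z + r\<^sup>2 > 0"
  proof -
    have "\<bar>r * z\<bar> \<le> \<bar>r\<bar>" unfolding abs_mult using z by (intro mult_left_le) auto
    then have "1 - 2 * r * z + r\<^sup>2 \<ge> 1 - 2 * \<bar>r\<bar> + r\<^sup>2" by linarith
    moreover have "1 - 2 * \<bar>r\<bar> + r\<^sup>2 = (1 - \<bar>r\<bar>)\<^sup>2" by (simp add: power2_diff)
    moreover have "(1 - \<bar>r\<bar>)\<^sup>2 > 0" using r by simp
    ultimately show ?thesis by linarith
  qed
  have "DERIV (\<lambda>x. \<Sum>n. ?c n * x ^ n) r :> (\<Sum>n. diffs ?c n * r ^ n)"
    by (rule termdiffs_strong'[where K=1]) (use gegenbauer_sums[OF z] r in \<open>auto simp: sums_iff\<close>)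
  moreover have "eventually (\<lambda>x. (\<Sum>n. ?c n * x ^ n) = ?f x) (nhds r)"
  proof -
    have "eventually (\<lambda>x. x \<in> {-1<..<1}) (nhds r)" by (rule eventually_nhds_in_open) (use r in auto)
    then show ?thesis by eventually_elim (use gegenbauer_sums[OF z] in \<open>auto simp: sums_iff\<close>)
  qed
  ultimately have "DERIV ?f r :> (\<Sum>n. diffs ?c n * r ^ n)"
    by (subst (asm) DERIV_cong_ev) auto
  moreover have "DERIV ?f r :> (- l) * (1 - 2 * r * z + r\<^sup>2) powr (- l - 1) * (2 * r - 2 * z)"
    by (rule derivative_eq_intros refl | use pos in simp)+
  ultimately have D: "(\<Sum>n. diffs ?c n * r ^ n) = (- l) * (1 - 2 * r * z + r\<^sup>2) powr (- l - 1) * (2 * r - 2 * z)"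
    by (rule DERIV_unique)
  have "summable (\<lambda>n. diffs ?c n * r ^ n)"
    by (rule termdiff_converges[where K=1]) (use gegenbauer_sums[OF z] r in \<open>auto simp: sums_iff\<close>)
  then have "(\<lambda>n. diffs ?c n * r ^ n) sums ((- l) * (1 - 2 * r * z + r\<^sup>2) powr (- l - 1) * (2 * r - 2 * z))"
    using D by (simp add: sums_iff)
  from sums_mult2[OF this, of r]
  have "(\<lambda>n. real (Suc n) * ?c (Suc n) * r ^ Suc n) sums ((- l) * (1 - 2 * r * z + r\<^sup>2) powr (- l - 1) * (2 * r - 2 * z) * r)"
    by (simp add: diffs_def mult_ac)
  then have "(\<lambda>n. real n * ?c n * r ^ n) sums ((- l) * (1 - 2 * r * z + r\<^sup>2) powr (- l - 1) * (2 * r - 2 * z) * r)"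
    by (subst (asm) sums_Suc_iff) simp
  from sums_add[OF this sums_mult[OF gegenbauer_sums[OF z r, of l], of l]]
  have "(\<lambda>m. (real m + l) * (?c m * r ^ m)) sums ((- l) * (1 - 2 * r * z + r\<^sup>2) powr (- l - 1) * (2 * r - 2 * z) * r
     + l * (1 - 2 * r * z + r\<^sup>2) powr (- l))"
    by (simp add: algebra_simps)
  also have "(1 - 2 * r * z + r\<^sup>2) powr (- l) = (1 - 2 * r * z + r\<^sup>2) powr (- l - 1) * (1 - 2 * r * z + r\<^sup>2)"
    using pos by (metis add.commute diff_add_cancel less_eq_real_def powr_add powr_one mult.commute)
  also have "(- l) * (1 - 2 * r * z + r\<^sup>2) powr (- l - 1) * (2 * r - 2 * z) * r
     + l * ((1 - 2 * r * z + r\<^sup>2) powr (- l - 1) * (1 - 2 * r * z + r\<^sup>2)) = l * (1 - r\<^sup>2) * (1 - 2 * r * z + r\<^sup>2) powr (- l - 1)"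
    by (simp add: algebra_simps power2_eq_square)
  finally show ?thesis .
qed

section \<open>Bailey's expansion of a product of Jacobi polynomials\<close>

definition bernstein :: "nat \<Rightarrow> nat \<Rightarrow> real poly" where
  "bernstein i l = [:0, 1:] ^ i * [:1, - 1:] ^ l"

lemma poly_bernstein [simp]: "poly (bernstein i l) x = x ^ i * (1 - x) ^ l"
  by (simp add: bernstein_def poly_power)

text \<open>The Jacobi operator in the variable \<open>\<xi> = (1 - x) / 2\<close>, which is \<open>sin\<^sup>2 (\<theta> / 2)\<close> for \<open>x = cos \<theta>\<close>.\<close>
definition jacobi_op :: "real \<Rightarrow> real \<Rightarrow> real poly \<Rightarrow> real poly" where
  "jacobi_op \<alpha> \<beta> p = [:0, 1, - 1:] * pderiv (pderiv p) + [:\<alpha> + 1, - (\<alpha> + \<beta> + 2):] * pderiv p"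

lemma jacobi_op_add: "jacobi_op \<alpha> \<beta> (p + q) = jacobi_op \<alpha> \<beta> p + jacobi_op \<alpha> \<beta> q"
  by (simp add: jacobi_op_def pderiv_add distrib_left)

lemma jacobi_op_smult: "jacobi_op \<alpha> \<beta> (smult c p) = smult c (jacobi_op \<alpha> \<beta> p)"
  by (simp add: jacobi_op_def pderiv_smult smult_add_right)

lemma jacobi_op_sum: "jacobi_op \<alpha> \<beta> (\<Sum>i\<in>I. f i) = (\<Sum>i\<in>I. jacobi_op \<alpha> \<beta> (f i))"
  by (induction I rule: infinite_finite_induct)
    (simp_all add: jacobi_op_add, simp_all add: jacobi_op_def)

lemma poly_pderiv_bernstein:
  "poly (pderiv (bernstein i l)) x = of_nat i * x ^ (i - 1) * (1 - x) ^ l - of_nat l * x ^ i * (1 - x) ^ (l - 1)"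
proof -
  have "((\<lambda>x. x ^ i * (1 - x) ^ l) has_real_derivative
      (of_nat i * x ^ (i - 1) * (1 - x) ^ l - of_nat l * x ^ i * (1 - x) ^ (l - 1))) (at x)"
    by (rule derivative_eq_intros refl | simp)+
  moreover have "((\<lambda>x. x ^ i * (1 - x) ^ l) has_real_derivative poly (pderiv (bernstein i l)) x) (at x)"
    using poly_DERIV[of "bernstein i l" x] by simp
  ultimately show ?thesis by (rule DERIV_unique[symmetric])
qed

text \<open>The operator sends a Bernstein monomial to a combination of itself and the two monomials
  with one exponent lowered, so the differential equations below become recurrences for
  coefficients. The truncated exponents \<open>i - 1\<close> and \<open>l - 1\<close> come with the
  factors i and l, which vanish where truncation occurs.\<close>

lemma poly_jacobi_op_bernstein:
  "poly (jacobi_op \<alpha> \<beta> (bernstein i l)) x =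
     of_nat i * (of_nat i + \<alpha>) * (x ^ (i - 1) * (1 - x) ^ l)
   + of_nat l * (of_nat l + \<beta>) * (x ^ i * (1 - x) ^ (l - 1))
   - of_nat (i + l) * (of_nat (i + l) + \<alpha> + \<beta> + 1) * (x ^ i * (1 - x) ^ l)"
proof -
  let ?u = "bernstein i l"
  let ?E = "[:0, 1, - 1:] :: real poly"
  define u1 where "u1 = x ^ (i - 1) * (1 - x) ^ l"
  define u2 where "u2 = x ^ i * (1 - x) ^ (l - 1)"
  define u where "u = x ^ i * (1 - x) ^ l"
  have 1: "of_nat i * (x * u1) = of_nat i * u" unfolding u1_def u_def by (cases i) auto
  have 2: "of_nat l * ((1 - x) * u2) = of_nat l * u" unfolding u2_def u_def by (cases l) auto
  \<comment> \<open>Differentiating this first order identity produces the second order term of the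
    operator, so the second derivative never has to be computed directly.\<close>
  have e: "?E * pderiv ?u = [:of_nat i, - of_nat (i + l):] * ?u"
  proof (rule poly_ext)
    fix y :: real
    have "y * (1 - y) * (of_nat i * y ^ (i - 1) * (1 - y) ^ l - of_nat l * y ^ i * (1 - y) ^ (l - 1))
        = (of_nat i - of_nat (i + l) * y) * (y ^ i * (1 - y) ^ l)"
      by (cases i; cases l) (simp_all add: algebra_simps)
    then show "poly (?E * pderiv ?u) y = poly ([:of_nat i, - of_nat (i + l):] * ?u) y"
      by (simp add: poly_pderiv_bernstein algebra_simps)
  qed
  have "pderiv (?E * pderiv ?u) = pderiv ([:of_nat i, - of_nat (i + l):] * ?u)"
    unfolding e ..
  then have "poly (pderiv (?E * pderiv ?u)) x = poly (pderiv ([:of_nat i, - of_nat (i + l):] * ?u)) x"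
    by simp
  then have d2: "x * (1 - x) * poly (pderiv (pderiv ?u)) x
      = (of_nat i - of_nat (i + l) * x) * poly (pderiv ?u) x - of_nat (i + l) * u - (1 - 2 * x) * poly (pderiv ?u) x"
    unfolding pderiv_mult poly_add poly_mult by (simp add: pderiv_pCons u_def algebra_simps)
  have d1: "poly (pderiv ?u) x = of_nat i * u1 - of_nat l * u2"
    unfolding poly_pderiv_bernstein u1_def u2_def by simp
  have "poly (jacobi_op \<alpha> \<beta> ?u) x = x * (1 - x) * poly (pderiv (pderiv ?u)) x + (\<alpha> + 1 - (\<alpha> + \<beta> + 2) * x) * poly (pderiv ?u) x"
    unfolding jacobi_op_def by (simp add: algebra_simps)
  also have "\<dots> = (of_nat i + \<alpha>) * (of_nat i * u1) - (of_nat (i + l) + \<alpha> + \<beta>) * (of_nat i * (x * u1))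
      + (of_nat l + \<beta>) * (of_nat l * u2) - (of_nat (i + l) + \<alpha> + \<beta>) * (of_nat l * ((1 - x) * u2)) - of_nat (i + l) * u"
    unfolding d2 d1 by (simp add: algebra_simps)
  also have "\<dots> = of_nat i * (of_nat i + \<alpha>) * u1 + of_nat l * (of_nat l + \<beta>) * u2
       - of_nat (i + l) * (of_nat (i + l) + \<alpha> + \<beta> + 1) * u"
    unfolding 1 2 by (simp add: algebra_simps)
  finally show ?thesis unfolding u1_def u2_def u_def by (simp add: mult.assoc)
qed

lemma jacobi_ode_coeff:
  assumes "jacobi_op \<alpha> \<beta> p = smult c p"
  shows "of_nat (Suc k) * (of_nat k + \<alpha> + 1) * coeff p (Suc k) = (of_nat k * (of_nat k + \<alpha> + \<beta> + 1) + c) * coeff p k"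
proof -
  have "coeff (jacobi_op \<alpha> \<beta> p) k = c * coeff p k" using assms by simp
  moreover have "jacobi_op \<alpha> \<beta> p = pCons 0 (pderiv (pderiv p) - pCons 0 (pderiv (pderiv p)))
      + smult (\<alpha> + 1) (pderiv p) - pCons 0 (smult (\<alpha> + \<beta> + 2) (pderiv p))"
    by (rule poly_ext) (simp add: jacobi_op_def algebra_simps)
  moreover have "coeff (pCons 0 (pderiv (pderiv p) - pCons 0 (pderiv (pderiv p)))
      + smult (\<alpha> + 1) (pderiv p) - pCons 0 (smult (\<alpha> + \<beta> + 2) (pderiv p))) k =
      of_nat (Suc k) * (of_nat k + \<alpha> + 1) * coeff p (Suc k) - of_nat k * (of_nat k + \<alpha> + \<beta> + 1) * coeff p k"
  proof (cases k)
    case 0 then show ?thesis by (simp add: coeff_pderiv)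
  next
    case (Suc m)
    then show ?thesis by (cases m) (simp_all add: coeff_pderiv algebra_simps)
  qed
  ultimately show ?thesis by (simp add: algebra_simps)
qed

text \<open>As \<open>\<alpha> + 1 > 0\<close>, the recurrence of the coefficients never degenerates, so the value at \<open>0\<close> determines the polynomial.\<close>
lemma jacobi_ode_proportional:
  assumes "\<alpha> > -1" and p: "jacobi_op \<alpha> \<beta> p = smult c p" and q: "jacobi_op \<alpha> \<beta> q = smult c q"
  shows "poly q 0 * poly p x = poly p 0 * poly q x"
proof -
  have "coeff q 0 * coeff p k = coeff p 0 * coeff q k" for k
  proof (induction k)
    case (Suc k)
    let ?a = "of_nat (Suc k) * (of_nat k + \<alpha> + 1)"
    have nz: "?a \<noteq> 0" using assms(1) by (auto simp del: of_nat_Suc)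
    have "?a * (coeff q 0 * coeff p (Suc k)) = coeff q 0 * (?a * coeff p (Suc k))" by (simp only: mult_ac)
    also have "\<dots> = (of_nat k * (of_nat k + \<alpha> + \<beta> + 1) + c) * (coeff q 0 * coeff p k)"
      unfolding jacobi_ode_coeff[OF p] by (simp only: mult_ac)
    also have "\<dots> = coeff p 0 * (?a * coeff q (Suc k))"
      unfolding Suc.IH jacobi_ode_coeff[OF q] by (simp only: mult_ac)
    also have "\<dots> = ?a * (coeff p 0 * coeff q (Suc k))" by (simp only: mult_ac)
    finally show ?case using nz by simp
  qed simp
  then have "smult (coeff q 0) p = smult (coeff p 0) q" by (intro poly_eqI) simp
  from arg_cong[OF this, of "\<lambda>r. poly r x"] show ?thesis by (simp add: poly_0_coeff_0)
qed

section \<open>Jacobi polynomials as eigenfunctions\<close>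

text \<open>With x = 1 - 2\<xi> one has (x - 1) / 2 = -\<xi> and (x + 1) / 2 = 1 - \<xi>; this is
  the origin of the alternating sign and of the Bernstein monomials.\<close>

definition jacobi_poly :: "real \<Rightarrow> real \<Rightarrow> nat \<Rightarrow> real poly" where
  "jacobi_poly \<alpha> \<beta> n = (\<Sum>s\<le>n. smult (((real n + \<alpha>) gchoose (n - s)) * ((real n + \<beta>) gchoose s) * (- 1) ^ s) (bernstein s (n - s)))"

lemma poly_jacobi_poly: "poly (jacobi_poly \<alpha> \<beta> n) \<xi> = jacobi_P \<alpha> \<beta> n (1 - 2 * \<xi>)"
proof -
  have e: "(1 - 2 * \<xi> - 1) / 2 = - \<xi>" "(1 - 2 * \<xi> + 1) / 2 = 1 - \<xi>" by simp_all
  show ?thesis unfolding jacobi_poly_def jacobi_P_def e by (simp add: poly_sum power_minus[of \<xi>] mult_ac)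
qed

lemma sum_shift_nat_factor:
  fixes f :: "nat \<Rightarrow> real"
  shows "(\<Sum>s\<le>n. of_nat s * f s) = (\<Sum>s<n. of_nat (Suc s) * f (Suc s))"
  using sum.atMost_shift[of "\<lambda>s. of_nat s * f s" n] by simp

text \<open>After an index shift the terms with lowered s cancel those with lowered n - s, by the
  ratio of consecutive coefficients. The diagonal terms remain, and their eigenvalue depends only on
  the total degree s + (n - s) = n.\<close>

lemma jacobi_poly_ode:
  "jacobi_op \<alpha> \<beta> (jacobi_poly \<alpha> \<beta> n) = smult (- (of_nat n * (of_nat n + \<alpha> + \<beta> + 1))) (jacobi_poly \<alpha> \<beta> n)"
proof (rule poly_ext)
  fix x :: real
  define h where "h s = ((real n + \<alpha>) gchoose (n - s)) * ((real n + \<beta>) gchoose s) * (- 1) ^ s" for s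
  define b where "b i l = x ^ i * (1 - x) ^ l" for i l
  let ?N = "of_nat n * (of_nat n + \<alpha> + \<beta> + 1)"
  have rec: "of_nat (Suc s) * (of_nat (Suc s) + \<alpha>) * h (Suc s) = - (of_nat (n - s) * (of_nat (n - s) + \<beta>) * h s)" if "s < n" for s
  proof -
    define m where "m = n - Suc s"
    have m: "n - s = Suc m" using that unfolding m_def by simp
    then have m': "n - Suc s = m" by simp
    have rn: "real n = real s + real m + 1" using m that by linarith
    have a: "of_nat (Suc m) * ((real n + \<alpha>) gchoose Suc m) = ((real n + \<alpha>) gchoose m) * (real n + \<alpha> - of_nat m)"
      using gbinomial_mult_1[of "real n + \<alpha>" m] by (simp only: algebra_simps)
    have b: "of_nat (Suc s) * ((real n + \<beta>) gchoose Suc s) = ((real n + \<beta>) gchoose s) * (real n + \<beta> - of_nat s)"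
      using gbinomial_mult_1[of "real n + \<beta>" s] by (simp only: algebra_simps)
    have "of_nat (Suc s) * (of_nat (Suc s) + \<alpha>) * h (Suc s)
      = - ((((real n + \<alpha>) gchoose m) * (real n + \<alpha> - of_nat m)) * (of_nat (Suc s) * ((real n + \<beta>) gchoose Suc s)) * (- 1) ^ s)"
      unfolding h_def m' using rn by (simp add: algebra_simps)
    also have "\<dots> = - (of_nat (Suc m) * (real n + \<beta> - of_nat s) * h s)"
      unfolding a[symmetric] b h_def m by (simp only: mult_ac)
    finally show ?thesis unfolding m using rn by (simp add: algebra_simps)
  qed
  have p: "poly (jacobi_poly \<alpha> \<beta> n) x = (\<Sum>s\<le>n. h s * b s (n - s))"
    unfolding jacobi_poly_def h_def b_def by (simp add: poly_sum)
  have "poly (jacobi_op \<alpha> \<beta> (jacobi_poly \<alpha> \<beta> n)) x =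
     (\<Sum>s\<le>n. h s * (of_nat s * (of_nat s + \<alpha>) * b (s - 1) (n - s) + of_nat (n - s) * (of_nat (n - s) + \<beta>) * b s (n - s - 1)
        - of_nat (s + (n - s)) * (of_nat (s + (n - s)) + \<alpha> + \<beta> + 1) * b s (n - s)))"
    unfolding jacobi_poly_def jacobi_op_sum jacobi_op_smult poly_sum poly_smult poly_jacobi_op_bernstein h_def b_def ..
  also have "\<dots> = (\<Sum>s\<le>n. of_nat s * ((of_nat s + \<alpha>) * h s * b (s - 1) (n - s)) + of_nat (n - s) * (of_nat (n - s) + \<beta>) * h s * b s (n - s - 1)
        - ?N * (h s * b s (n - s)))"
    by (intro sum.cong refl) (simp add: algebra_simps)
  also have "\<dots> = (\<Sum>s\<le>n. of_nat s * ((of_nat s + \<alpha>) * h s * b (s - 1) (n - s)))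
      + (\<Sum>s\<le>n. of_nat (n - s) * (of_nat (n - s) + \<beta>) * h s * b s (n - s - 1)) - ?N * (\<Sum>s\<le>n. h s * b s (n - s))"
    by (simp add: sum.distrib sum_subtractf sum_distrib_left)
  also have "(\<Sum>s\<le>n. of_nat s * ((of_nat s + \<alpha>) * h s * b (s - 1) (n - s)))
      = (\<Sum>s<n. (of_nat (Suc s) * (of_nat (Suc s) + \<alpha>) * h (Suc s)) * b s (n - s - 1))"
    unfolding sum_shift_nat_factor by (intro sum.cong refl) (simp add: mult_ac)
  also have "\<dots> = - (\<Sum>s<n. of_nat (n - s) * (of_nat (n - s) + \<beta>) * h s * b s (n - s - 1))"
    unfolding sum_negf[symmetric] by (intro sum.cong refl, subst rec) simp_all
  also have "(\<Sum>s\<le>n. of_nat (n - s) * (of_nat (n - s) + \<beta>) * h s * b s (n - s - 1))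
     = (\<Sum>s<n. of_nat (n - s) * (of_nat (n - s) + \<beta>) * h s * b s (n - s - 1))"
    by (simp add: lessThan_Suc_atMost[symmetric])
  finally show "poly (jacobi_op \<alpha> \<beta> (jacobi_poly \<alpha> \<beta> n)) x = poly (smult (- ?N) (jacobi_poly \<alpha> \<beta> n)) x"
    unfolding poly_smult p by simp
qed

section \<open>Bailey's bilinear sum\<close>

text \<open>Up to the factor
  \<open>(- 1) ^ n * pochhammer (\<alpha> + \<beta> + 1) n / fact n\<close>, these are the
  coefficients of the terminating Appell series F4 with upper parameters -n and n + \<alpha> +
  \<beta> + 1 and lower parameters \<alpha> + 1 and \<beta> + 1.\<close>

definition bailey_coeff :: "real \<Rightarrow> real \<Rightarrow> nat \<Rightarrow> nat \<Rightarrow> nat \<Rightarrow> real" where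
  "bailey_coeff \<alpha> \<beta> n i l = (if i + l \<le> n then (- 1) ^ (n - (i + l)) * pochhammer (\<alpha> + \<beta> + 1) (n + (i + l))
     / (fact (n - (i + l)) * fact i * fact l * pochhammer (\<alpha> + 1) i * pochhammer (\<beta> + 1) l) else 0)"

definition bailey_sum :: "real \<Rightarrow> real \<Rightarrow> nat \<Rightarrow> real \<Rightarrow> real \<Rightarrow> real" where
  "bailey_sum \<alpha> \<beta> n X Y = (\<Sum>i\<le>n. \<Sum>l\<le>n. bailey_coeff \<alpha> \<beta> n i l * X ^ i * Y ^ l)"

text \<open>Raising i and raising l lead to the same difference of eigenvalues, which is what lets
  the two recurrences combine. On the edge i + l = n the left side lies outside the triangle of
  coefficients and the difference of eigenvalues is zero, so no boundary term appears.\<close>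

lemma bailey_coeff_rec:
  assumes "\<alpha> > -1" "\<beta> > -1"
  shows "of_nat (Suc i) * (of_nat (Suc i) + \<alpha>) * bailey_coeff \<alpha> \<beta> n (Suc i) l =
      (of_nat (i + l) * (of_nat (i + l) + \<alpha> + \<beta> + 1) - of_nat n * (of_nat n + \<alpha> + \<beta> + 1)) * bailey_coeff \<alpha> \<beta> n i l"
    and "of_nat (Suc l) * (of_nat (Suc l) + \<beta>) * bailey_coeff \<alpha> \<beta> n i (Suc l) =
      (of_nat (i + l) * (of_nat (i + l) + \<alpha> + \<beta> + 1) - of_nat n * (of_nat n + \<alpha> + \<beta> + 1)) * bailey_coeff \<alpha> \<beta> n i l"
proof -
  have pa: "pochhammer (\<alpha> + 1) k > 0" "pochhammer (\<beta> + 1) k > 0" for k using assms by (auto intro!: pochhammer_pos)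
  have nz: "real (Suc i) + \<alpha> \<noteq> 0" "real (Suc l) + \<beta> \<noteq> 0" using assms by auto
  have key: "(of_nat (i + l) * (of_nat (i + l) + \<alpha> + \<beta> + 1) - of_nat n * (of_nat n + \<alpha> + \<beta> + 1))
     * ((- 1) ^ (n - (i + l)) * pochhammer (\<alpha> + \<beta> + 1) (n + (i + l)) / fact (n - (i + l)))
     = (- 1) ^ (n - Suc (i + l)) * pochhammer (\<alpha> + \<beta> + 1) (n + Suc (i + l)) / fact (n - Suc (i + l))" if "i + l < n"
  proof -
    define k where "k = n - Suc (i + l)"
    have n: "n - (i + l) = Suc k" "real n = real (i + l) + real k + 1" using that by (auto simp: k_def)
    \<comment> \<open>The difference of eigenvalues factors; one factor adjusts the factorial of n -
      i - l, the other extends the Pochhammer symbol by one step.\<close>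
    have f: "of_nat (i + l) * (of_nat (i + l) + \<alpha> + \<beta> + 1) - of_nat n * (of_nat n + \<alpha> + \<beta> + 1)
       = - (of_nat (Suc k) * (\<alpha> + \<beta> + 1 + of_nat (n + (i + l))))"
      using n(2) by (simp add: algebra_simps)
    show ?thesis unfolding n(1) k_def[symmetric] f add_Suc_right pochhammer_Suc fact_Suc power_Suc
      by (simp add: divide_simps del: of_nat_Suc) 
  qed
  show "of_nat (Suc i) * (of_nat (Suc i) + \<alpha>) * bailey_coeff \<alpha> \<beta> n (Suc i) l =
      (of_nat (i + l) * (of_nat (i + l) + \<alpha> + \<beta> + 1) - of_nat n * (of_nat n + \<alpha> + \<beta> + 1)) * bailey_coeff \<alpha> \<beta> n i l"
  proof (cases "i + l < n")
    case True
    have "of_nat (Suc i) * (of_nat (Suc i) + \<alpha>) * bailey_coeff \<alpha> \<beta> n (Suc i) l =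
      ((- 1) ^ (n - Suc (i + l)) * pochhammer (\<alpha> + \<beta> + 1) (n + Suc (i + l)) / fact (n - Suc (i + l)))
        / (fact i * fact l * pochhammer (\<alpha> + 1) i * pochhammer (\<beta> + 1) l)"
    proof -
      define Z where "Z = (- 1) ^ (n - Suc (i + l)) * pochhammer (\<alpha> + \<beta> + 1) (n + Suc (i + l)) / fact (n - Suc (i + l))"
      define u where "u = real (Suc i) + \<alpha>"
      have u: "\<alpha> + 1 + of_nat i = u" "u \<noteq> 0" using nz unfolding u_def by simp_all
      have "bailey_coeff \<alpha> \<beta> n (Suc i) l = Z / (fact (Suc i) * fact l * pochhammer (\<alpha> + 1) (Suc i) * pochhammer (\<beta> + 1) l)"
        using True unfolding bailey_coeff_def add_Suc Z_def by simp
      also have "\<dots> = Z / (of_nat (Suc i) * u * (fact i * fact l * pochhammer (\<alpha> + 1) i * pochhammer (\<beta> + 1) l))"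
        unfolding pochhammer_Suc fact_Suc u(1) by (simp only: mult_ac)
      finally show ?thesis unfolding Z_def[symmetric] u_def[symmetric] using u(2)
        by (simp del: of_nat_Suc)
    qed
    also have "\<dots> = (of_nat (i + l) * (of_nat (i + l) + \<alpha> + \<beta> + 1) - of_nat n * (of_nat n + \<alpha> + \<beta> + 1)) * bailey_coeff \<alpha> \<beta> n i l"
      unfolding key[OF True, symmetric] using True by (simp add: bailey_coeff_def mult.assoc)
    finally show ?thesis .
  qed (auto simp: bailey_coeff_def)
  show "of_nat (Suc l) * (of_nat (Suc l) + \<beta>) * bailey_coeff \<alpha> \<beta> n i (Suc l) =
      (of_nat (i + l) * (of_nat (i + l) + \<alpha> + \<beta> + 1) - of_nat n * (of_nat n + \<alpha> + \<beta> + 1)) * bailey_coeff \<alpha> \<beta> n i l"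
  proof (cases "i + l < n")
    case True
    have "of_nat (Suc l) * (of_nat (Suc l) + \<beta>) * bailey_coeff \<alpha> \<beta> n i (Suc l) =
      ((- 1) ^ (n - Suc (i + l)) * pochhammer (\<alpha> + \<beta> + 1) (n + Suc (i + l)) / fact (n - Suc (i + l)))
        / (fact i * fact l * pochhammer (\<alpha> + 1) i * pochhammer (\<beta> + 1) l)"
    proof -
      define Z where "Z = (- 1) ^ (n - Suc (i + l)) * pochhammer (\<alpha> + \<beta> + 1) (n + Suc (i + l)) / fact (n - Suc (i + l))"
      define u where "u = real (Suc l) + \<beta>"
      have u: "\<beta> + 1 + of_nat l = u" "u \<noteq> 0" using nz unfolding u_def by simp_all
      have "bailey_coeff \<alpha> \<beta> n i (Suc l) = Z / (fact i * fact (Suc l) * pochhammer (\<alpha> + 1) i * pochhammer (\<beta> + 1) (Suc l))"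
        using True unfolding bailey_coeff_def add_Suc_right Z_def by simp
      also have "\<dots> = Z / (of_nat (Suc l) * u * (fact i * fact l * pochhammer (\<alpha> + 1) i * pochhammer (\<beta> + 1) l))"
        unfolding pochhammer_Suc fact_Suc u(1) by (simp only: mult_ac)
      finally show ?thesis unfolding Z_def[symmetric] u_def[symmetric] using u(2)
        by (simp del: of_nat_Suc)
    qed
    also have "\<dots> = (of_nat (i + l) * (of_nat (i + l) + \<alpha> + \<beta> + 1) - of_nat n * (of_nat n + \<alpha> + \<beta> + 1)) * bailey_coeff \<alpha> \<beta> n i l"
      unfolding key[OF True, symmetric] using True by (simp add: bailey_coeff_def mult.assoc)
    finally show ?thesis .
  qed (auto simp: bailey_coeff_def)
qed

definition bailey_poly :: "real \<Rightarrow> real \<Rightarrow> nat \<Rightarrow> real \<Rightarrow> real poly" where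
  "bailey_poly \<alpha> \<beta> n \<eta> = (\<Sum>i\<le>n. \<Sum>l\<le>n. smult (bailey_coeff \<alpha> \<beta> n i l * (\<eta> ^ i * (1 - \<eta>) ^ l)) (bernstein i l))"

lemma poly_bailey_poly: "poly (bailey_poly \<alpha> \<beta> n \<eta>) \<xi> = bailey_sum \<alpha> \<beta> n (\<xi> * \<eta>) ((1 - \<xi>) * (1 - \<eta>))"
  unfolding bailey_poly_def bailey_sum_def by (simp add: poly_sum power_mult_distrib mult_ac)

text \<open>Lowering i releases a factor \<eta>, lowering l a factor 1 - \<eta>, and both come with
  the same difference of eigenvalues. As these factors add up to 1, the two sums merge into
  \<open>ev (i + l) - ev n\<close>; its first part cancels the diagonal term and the eigenvalue of
  degree n is left.\<close>

lemma bailey_poly_ode: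
  assumes "\<alpha> > -1" "\<beta> > -1"
  shows "jacobi_op \<alpha> \<beta> (bailey_poly \<alpha> \<beta> n \<eta>) = smult (- (of_nat n * (of_nat n + \<alpha> + \<beta> + 1))) (bailey_poly \<alpha> \<beta> n \<eta>)"
proof (rule poly_ext)
  fix x
  define g where "g = bailey_coeff \<alpha> \<beta> n"
  define T where "T i l = x ^ i * (1 - x) ^ l * (\<eta> ^ i * (1 - \<eta>) ^ l)" for i l :: nat
  define ev where "ev k = of_nat k * (of_nat k + \<alpha> + \<beta> + 1)" for k :: nat
  have g0: "g i l = 0" if "n < i + l" for i l using that by (simp add: g_def bailey_coeff_def)
  note rec = bailey_coeff_rec[OF assms, of _ n, folded g_def ev_def]
  have "poly (jacobi_op \<alpha> \<beta> (bailey_poly \<alpha> \<beta> n \<eta>)) x =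
     (\<Sum>i\<le>n. \<Sum>l\<le>n. g i l * (\<eta> ^ i * (1 - \<eta>) ^ l) *
       (of_nat i * (of_nat i + \<alpha>) * (x ^ (i - 1) * (1 - x) ^ l)
      + of_nat l * (of_nat l + \<beta>) * (x ^ i * (1 - x) ^ (l - 1))
      - ev (i + l) * (x ^ i * (1 - x) ^ l)))"
    unfolding bailey_poly_def jacobi_op_sum jacobi_op_smult poly_sum poly_smult poly_jacobi_op_bernstein g_def ev_def ..
  also have "\<dots> = (\<Sum>i\<le>n. \<Sum>l\<le>n. of_nat i * ((of_nat i + \<alpha>) * g i l * (\<eta> * T (i - 1) l))
      + of_nat l * ((of_nat l + \<beta>) * g i l * ((1 - \<eta>) * T i (l - 1))) - ev (i + l) * (g i l * T i l))"
  proof (intro sum.cong refl)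
    fix i l
    have a: "of_nat i * (\<eta> ^ i * x ^ (i - 1)) = of_nat i * (\<eta> * (\<eta> ^ (i - 1) * x ^ (i - 1)))" for i and \<eta> x :: real by (cases i) auto
    have a1: "of_nat i * ((\<eta> ^ i * (1 - \<eta>) ^ l) * (x ^ (i - 1) * (1 - x) ^ l)) = of_nat i * (\<eta> * T (i - 1) l)"
      using a[of i \<eta> x] unfolding T_def by (cases i) auto
    have a2: "of_nat l * ((\<eta> ^ i * (1 - \<eta>) ^ l) * (x ^ i * (1 - x) ^ (l - 1))) = of_nat l * ((1 - \<eta>) * T i (l - 1))"
      unfolding T_def by (cases l) auto
    have "g i l * (\<eta> ^ i * (1 - \<eta>) ^ l) *
       (of_nat i * (of_nat i + \<alpha>) * (x ^ (i - 1) * (1 - x) ^ l)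
      + of_nat l * (of_nat l + \<beta>) * (x ^ i * (1 - x) ^ (l - 1)) - ev (i + l) * (x ^ i * (1 - x) ^ l))
      = (of_nat i + \<alpha>) * g i l * (of_nat i * ((\<eta> ^ i * (1 - \<eta>) ^ l) * (x ^ (i - 1) * (1 - x) ^ l)))
      + (of_nat l + \<beta>) * g i l * (of_nat l * ((\<eta> ^ i * (1 - \<eta>) ^ l) * (x ^ i * (1 - x) ^ (l - 1))))
      - ev (i + l) * (g i l * T i l)"
      unfolding T_def by (simp add: algebra_simps)
    then show "g i l * (\<eta> ^ i * (1 - \<eta>) ^ l) *
       (of_nat i * (of_nat i + \<alpha>) * (x ^ (i - 1) * (1 - x) ^ l)
      + of_nat l * (of_nat l + \<beta>) * (x ^ i * (1 - x) ^ (l - 1)) - ev (i + l) * (x ^ i * (1 - x) ^ l))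
      = of_nat i * ((of_nat i + \<alpha>) * g i l * (\<eta> * T (i - 1) l))
      + of_nat l * ((of_nat l + \<beta>) * g i l * ((1 - \<eta>) * T i (l - 1))) - ev (i + l) * (g i l * T i l)"
      unfolding a1 a2 by (simp only: mult_ac)
  qed
  also have "\<dots> = (\<Sum>l\<le>n. \<Sum>i\<le>n. of_nat i * ((of_nat i + \<alpha>) * g i l * (\<eta> * T (i - 1) l)))
      + (\<Sum>i\<le>n. \<Sum>l\<le>n. of_nat l * ((of_nat l + \<beta>) * g i l * ((1 - \<eta>) * T i (l - 1))))
      - (\<Sum>i\<le>n. \<Sum>l\<le>n. ev (i + l) * (g i l * T i l))"
    by (simp only: sum.distrib sum_subtractf) (subst sum.swap, rule refl)
  also have "(\<Sum>l\<le>n. \<Sum>i\<le>n. of_nat i * ((of_nat i + \<alpha>) * g i l * (\<eta> * T (i - 1) l)))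
      = (\<Sum>l\<le>n. \<Sum>i\<le>n. \<eta> * ((ev (i + l) - ev n) * (g i l * T i l)))"
  proof (rule sum.cong[OF refl])
    fix l
    have "(\<Sum>i\<le>n. of_nat i * ((of_nat i + \<alpha>) * g i l * (\<eta> * T (i - 1) l)))
        = (\<Sum>i<n. \<eta> * ((of_nat (Suc i) * (of_nat (Suc i) + \<alpha>) * g (Suc i) l) * T i l))"
      unfolding sum_shift_nat_factor by (intro sum.cong refl) (simp add: mult_ac)
    also have "\<dots> = (\<Sum>i\<le>n. \<eta> * ((of_nat (Suc i) * (of_nat (Suc i) + \<alpha>) * g (Suc i) l) * T i l))"
      by (simp add: lessThan_Suc_atMost[symmetric] g0)
    finally show "(\<Sum>i\<le>n. of_nat i * ((of_nat i + \<alpha>) * g i l * (\<eta> * T (i - 1) l))) = (\<Sum>i\<le>n. \<eta> * ((ev (i + l) - ev n) * (g i l * T i l)))"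
      unfolding rec by (simp only: mult.assoc)
  qed
  also have "(\<Sum>i\<le>n. \<Sum>l\<le>n. of_nat l * ((of_nat l + \<beta>) * g i l * ((1 - \<eta>) * T i (l - 1))))
      = (\<Sum>i\<le>n. \<Sum>l\<le>n. (1 - \<eta>) * ((ev (i + l) - ev n) * (g i l * T i l)))"
  proof (rule sum.cong[OF refl])
    fix i
    have "(\<Sum>l\<le>n. of_nat l * ((of_nat l + \<beta>) * g i l * ((1 - \<eta>) * T i (l - 1))))
        = (\<Sum>l<n. (1 - \<eta>) * ((of_nat (Suc l) * (of_nat (Suc l) + \<beta>) * g i (Suc l)) * T i l))"
      unfolding sum_shift_nat_factor by (intro sum.cong refl) (simp add: mult_ac)
    also have "\<dots> = (\<Sum>l\<le>n. (1 - \<eta>) * ((of_nat (Suc l) * (of_nat (Suc l) + \<beta>) * g i (Suc l)) * T i l))"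
      by (simp add: lessThan_Suc_atMost[symmetric] g0)
    finally show "(\<Sum>l\<le>n. of_nat l * ((of_nat l + \<beta>) * g i l * ((1 - \<eta>) * T i (l - 1)))) = (\<Sum>l\<le>n. (1 - \<eta>) * ((ev (i + l) - ev n) * (g i l * T i l)))"
      unfolding rec by (simp only: mult.assoc)
  qed
  also have "(\<Sum>l\<le>n. \<Sum>i\<le>n. \<eta> * ((ev (i + l) - ev n) * (g i l * T i l)))
      = (\<Sum>i\<le>n. \<Sum>l\<le>n. \<eta> * ((ev (i + l) - ev n) * (g i l * T i l)))" by (rule sum.swap)
  also have "\<dots> + (\<Sum>i\<le>n. \<Sum>l\<le>n. (1 - \<eta>) * ((ev (i + l) - ev n) * (g i l * T i l)))
       - (\<Sum>i\<le>n. \<Sum>l\<le>n. ev (i + l) * (g i l * T i l)) = (\<Sum>i\<le>n. \<Sum>l\<le>n. - ev n * (g i l * T i l))"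
    unfolding sum.distrib[symmetric] sum_subtractf[symmetric] by (intro sum.cong refl) (simp add: algebra_simps)
  also have "\<dots> = - ev n * poly (bailey_poly \<alpha> \<beta> n \<eta>) x"
    unfolding bailey_poly_def by (simp add: poly_sum sum_distrib_left g_def T_def mult_ac)
  finally show "poly (jacobi_op \<alpha> \<beta> (bailey_poly \<alpha> \<beta> n \<eta>)) x = poly (smult (- (of_nat n * (of_nat n + \<alpha> + \<beta> + 1))) (bailey_poly \<alpha> \<beta> n \<eta>)) x"
    by (simp add: ev_def)
qed

text \<open>In its first variable the Bailey sum solves the Jacobi equation, hence is a multiple of
  P_n. It is symmetric in both variables, so it is a constant times the product of the two values of
  P_n, and evaluations at 0 and 1 determine this constant.\<close>

lemma jacobi_P_product:
  assumes a: "\<alpha> > -1" and b: "\<beta> > -1" and l: "\<alpha> + \<beta> + 1 > 0"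
  shows "jacobi_P \<alpha> \<beta> n (1 - 2 * \<xi>) * jacobi_P \<alpha> \<beta> n (1 - 2 * \<eta>) =
     pochhammer (\<alpha> + 1) n * pochhammer (\<beta> + 1) n / (fact n * pochhammer (\<alpha> + \<beta> + 1) n)
       * bailey_sum \<alpha> \<beta> n (\<xi> * \<eta>) ((1 - \<xi>) * (1 - \<eta>))"
proof -
  let ?P = "\<lambda>x. jacobi_P \<alpha> \<beta> n (1 - 2 * x)"
  define G where "G x y = bailey_sum \<alpha> \<beta> n (x * y) ((1 - x) * (1 - y))" for x y
  have pr: "?P 0 * G x y = G 0 y * ?P x" for x y
    using jacobi_ode_proportional[OF a bailey_poly_ode[OF a b] jacobi_poly_ode, of n y x]
    by (simp add: poly_bailey_poly poly_jacobi_poly G_def)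
  have sym: "G x y = G y x" for x y unfolding G_def by (simp add: mult.commute)
  have P0: "?P 0 = pochhammer (\<alpha> + 1) n / fact n"
  proof -
    have "?P 0 = (\<Sum>s\<le>n. if s = 0 then ((real n + \<alpha>) gchoose n) else 0)"
      unfolding jacobi_P_def by (intro sum.cong refl) auto
    then show ?thesis by (simp add: gbinomial_pochhammer' algebra_simps)
  qed
  have P1: "?P 1 = (- 1) ^ n * pochhammer (\<beta> + 1) n / fact n"
  proof -
    have "?P 1 = (\<Sum>s\<le>n. if s = n then ((real n + \<beta>) gchoose n) * (- 1) ^ n else 0)"
      unfolding jacobi_P_def by (intro sum.cong refl) auto
    then show ?thesis by (simp add: gbinomial_pochhammer' algebra_simps)
  qed
  \<comment> \<open>At (1, 0) both arguments of the Bailey sum vanish and a single coefficient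
    survives, whereas \<open>G 0 0\<close> is a whole sum over l. The constant is therefore
    expressed through \<open>G 1 0\<close>, and \<open>G 0 0\<close> is eliminated.\<close>
  have G10: "G 1 0 = (- 1) ^ n * pochhammer (\<alpha> + \<beta> + 1) n / fact n"
  proof -
    have "G 1 0 = (\<Sum>i\<le>n. \<Sum>l\<le>n. if l = 0 then if i = 0 then bailey_coeff \<alpha> \<beta> n 0 0 else 0 else 0)"
      unfolding G_def bailey_sum_def by (intro sum.cong refl) auto
    then show ?thesis by (simp add: bailey_coeff_def)
  qed
  have pos: "pochhammer (\<alpha> + 1) n > 0" "pochhammer (\<beta> + 1) n > 0" "pochhammer (\<alpha> + \<beta> + 1) n > 0"
    using a b l by (auto intro!: pochhammer_pos)
  have P0nz: "?P 0 \<noteq> 0" unfolding P0 using pos by simp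
  have e1: "?P 0 * (?P 0 * G x y) = G 0 0 * (?P x * ?P y)" for x y
    using pr[of x y] pr[of y 0] sym[of 0 y] by (simp add: mult_ac)
  have e2: "?P 0 * G 1 0 = G 0 0 * ?P 1" using pr[of 1 0] .
  have "?P 1 * (?P 0 * (?P 0 * G \<xi> \<eta>)) = (?P 0 * G 1 0) * (?P \<xi> * ?P \<eta>)"
    unfolding e1 e2 by (simp only: mult_ac)
  then have "?P 0 * (?P 1 * ?P 0 * G \<xi> \<eta>) = ?P 0 * (G 1 0 * (?P \<xi> * ?P \<eta>))"
    by (simp only: mult_ac)
  with P0nz have "?P 1 * ?P 0 * G \<xi> \<eta> = G 1 0 * (?P \<xi> * ?P \<eta>)" by (metis mult_left_cancel)
  then show ?thesis unfolding P0 P1 G10 G_def[symmetric] using pos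
    by (simp add: field_simps)
qed

section \<open>Beta integrals with uniform constants\<close>

lemma Gamma_real_plus1: "x > 0 \<Longrightarrow> Gamma (x + 1) = x * Gamma (x :: real)"
  by (rule Gamma_plus1) (auto elim!: nonpos_Ints_cases')

lemma Gamma_pos_nz: "x > 0 \<Longrightarrow> Gamma (x :: real) \<noteq> 0"
  using Gamma_real_pos by (metis less_irrefl)

text \<open>Log-convexity: x + g lies between x and x + g + 1, with weight g / (1 + g) at the upper
  end, and the value there is (x + g) Gamma(x + g).\<close>

lemma Gamma_plus_le:
  fixes x g :: real
  assumes "x > 0" "g \<ge> 0"
  shows "Gamma (x + g) \<le> (x + g) powr g * Gamma x"
proof -
  let ?f = "ln \<circ> Gamma :: real \<Rightarrow> real"
  let ?y = "x + g"
  let ?t = "g / (1 + g)"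
  have y: "?y > 0" using assms by simp
  have "?f ((1 - ?t) * x + ?t * (?y + 1)) \<le> (1 - ?t) * ?f x + ?t * ?f (?y + 1)"
    using convex_onD[OF log_convex_Gamma_real, of ?t x "?y + 1"] assms by simp
  also have "(1 - ?t) * x + ?t * (?y + 1) = x + ?t * (1 + g)" by (simp only: algebra_simps)
  also have "?t * (1 + g) = g" using assms(2) by simp
  finally have "(1 + g) * ?f ?y \<le> (1 + g) * ((1 - ?t) * ?f x + ?t * ?f (?y + 1))"
    using assms(2) by (intro mult_left_mono) auto
  also have "\<dots> = (1 + g) * ?f x + (?t * (1 + g)) * (?f (?y + 1) - ?f x)" by (simp only: algebra_simps)
  also have "?t * (1 + g) = g" using assms(2) by simp
  also have "(1 + g) * ?f x + g * (?f (?y + 1) - ?f x) = ?f x + g * ?f (?y + 1)" by (simp add: algebra_simps)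
  also have "?f (?y + 1) = ln ?y + ?f ?y"
    using y Gamma_pos_nz[OF y] by (simp add: Gamma_real_plus1 ln_mult)
  finally have "ln (Gamma ?y) \<le> ln (Gamma x) + g * ln ?y" by (simp add: algebra_simps)
  also have "\<dots> = ln (?y powr g * Gamma x)"
    using y assms by (simp add: ln_mult Gamma_real_pos Gamma_pos_nz ln_powr)
  finally show ?thesis using y assms by (subst (asm) ln_le_cancel_iff) (auto simp: Gamma_real_pos)
qed

text \<open>Log-convexity at x + 1, which lies between x and x + 1 + g; the right side is Gamma(x +
  g + 1).\<close>

lemma Gamma_plus_ge:
  fixes x g :: real
  assumes "x > 0" "g \<ge> 0"
  shows "x powr (g + 1) * Gamma x \<le> (x + g) * Gamma (x + g)"
proof -
  let ?f = "ln \<circ> Gamma :: real \<Rightarrow> real"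
  let ?t = "1 / (1 + g)"
  have "?f ((1 - ?t) * x + ?t * (x + 1 + g)) \<le> (1 - ?t) * ?f x + ?t * ?f (x + 1 + g)"
    using convex_onD[OF log_convex_Gamma_real, of ?t x "x + 1 + g"] assms by simp
  also have "(1 - ?t) * x + ?t * (x + 1 + g) = x + ?t * (1 + g)" by (simp only: algebra_simps)
  also have "?t * (1 + g) = 1" using assms(2) by simp
  finally have "(1 + g) * ?f (x + 1) \<le> (1 + g) * ((1 - ?t) * ?f x + ?t * ?f (x + 1 + g))"
    using assms(2) by (intro mult_left_mono) auto
  also have "\<dots> = (1 + g) * ?f x + (?t * (1 + g)) * (?f (x + 1 + g) - ?f x)" by (simp only: algebra_simps)
  also have "?t * (1 + g) = 1" using assms(2) by simp
  also have "(1 + g) * ?f x + 1 * (?f (x + 1 + g) - ?f x) = g * ?f x + ?f (x + 1 + g)" by (simp add: algebra_simps)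
  also have "?f (x + 1) = ln x + ?f x" using assms(1) Gamma_pos_nz[OF assms(1)] by (simp add: Gamma_real_plus1 ln_mult)
  also have "?f (x + 1 + g) = ln ((x + g) * Gamma (x + g))"
    using assms Gamma_real_plus1[of "x + g"] by (simp add: add_ac)
  finally have "(g + 1) * ln x + ln (Gamma x) \<le> ln ((x + g) * Gamma (x + g))" by (simp add: algebra_simps)
  also have "(g + 1) * ln x + ln (Gamma x) = ln (x powr (g + 1) * Gamma x)"
    using assms by (simp add: ln_mult Gamma_pos_nz ln_powr)
  finally show ?thesis using assms by (subst (asm) ln_le_cancel_iff) (auto simp: Gamma_real_pos)
qed

lemma Gamma_shift_bound:
  fixes w e :: real
  assumes w: "w > 0" and e: "\<bar>e\<bar> \<le> 1"
  shows "\<exists>C>0. \<forall>p. (p = 0 \<and> e \<ge> 0 \<or> p \<ge> 1) \<longrightarrow> Gamma (p + e + w) \<le> C * (1 + p) powr e * Gamma (p + w)"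
proof (cases "e \<ge> 0")
  case True
  have "Gamma (p + e + w) \<le> (w + 2) powr e * (1 + p) powr e * Gamma (p + w)" if p: "p = 0 \<or> p \<ge> 1" for p
  proof -
    have "Gamma (p + w + e) \<le> (p + w + e) powr e * Gamma (p + w)"
      using p w True by (intro Gamma_plus_le) auto
    also have "(p + w + e) powr e \<le> ((w + 2) * (1 + p)) powr e"
      using p w True e by (intro powr_mono2) (auto simp: algebra_simps add_increasing)
    also have "\<dots> = (w + 2) powr e * (1 + p) powr e"
      using p w by (intro powr_mult) 
    finally show ?thesis using p w by (auto simp: add_ac mult_right_mono Gamma_real_pos less_imp_le)
  qed
  then show ?thesis using w by (intro exI[of _ "(w + 2) powr e"]) force
next
  case False
  \<comment> \<open>Capping w at 1 gives p - 1 + w \<ge> w' p \<ge> w' (1 + p) / 2, a lower bound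
    for the shifted argument proportional to 1 + p.\<close>
  define w' where "w' = min w 1"
  have w': "0 < w'" "w' \<le> 1" "w' \<le> w" using w by (auto simp: w'_def)
  let ?C = "(1 + 1 / w) * (w' / 2) powr e"
  have "Gamma (p + e + w) \<le> ?C * (1 + p) powr e * Gamma (p + w)" if p: "p \<ge> 1" for p
  proof -
    let ?x = "p + e + w"
    have xw: "?x \<ge> w" "?x > 0" using p e w by auto
    have "w' * (p - 1) \<le> p - 1" using w' p by (simp add: mult_left_le_one_le)
    then have "w' * p \<le> p - 1 + w" using w' by (simp add: algebra_simps)
    moreover have "w' / 2 * (1 + p) \<le> w' * p" using w' p by (simp add: field_simps)
    ultimately have x: "w' / 2 * (1 + p) \<le> ?x" using e by linarith
    have "?x powr (- e + 1) * Gamma ?x \<le> (?x + - e) * Gamma (?x + - e)"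
      by (rule Gamma_plus_ge) (use xw False in auto)
    moreover have "?x powr (- e + 1) = ?x powr (- e) * ?x" using xw by (subst powr_add) simp
    ultimately have "?x powr (- e) * (?x * Gamma ?x) \<le> (?x - e) * Gamma (p + w)"
      by (simp add: mult_ac)
    then have "?x powr e * (?x powr (- e) * (?x * Gamma ?x)) \<le> ?x powr e * ((?x - e) * Gamma (p + w))"
      by (intro mult_left_mono) auto
    moreover have "?x powr e * (?x powr (- e) * (?x * Gamma ?x)) = ?x * Gamma ?x"
      using xw by (simp add: mult.assoc[symmetric] flip: powr_add)
    ultimately have "?x * Gamma ?x \<le> ?x powr e * ((?x - e) * Gamma (p + w))" by simp
    then have "Gamma ?x \<le> ?x powr e * (((?x - e) / ?x) * Gamma (p + w))"
      using xw by (simp add: field_simps)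
    also have "\<dots> \<le> ?x powr e * ((1 + 1 / w) * Gamma (p + w))"
    proof (intro mult_left_mono mult_right_mono)
      have "- e / ?x \<le> 1 / w" using xw w e False by (intro frac_le) auto
      moreover have "(?x - e) / ?x = 1 + - e / ?x" using xw by (simp add: field_simps)
      ultimately show "(?x - e) / ?x \<le> 1 + 1 / w" by linarith
    qed (use p w in \<open>auto simp: Gamma_real_pos less_imp_le\<close>)
    also have "\<dots> \<le> (w' / 2 * (1 + p)) powr e * ((1 + 1 / w) * Gamma (p + w))"
      using x False w' p w by (intro mult_right_mono powr_mono2') (auto simp: Gamma_real_pos less_imp_le)
    also have "(w' / 2 * (1 + p)) powr e = (w' / 2) powr e * (1 + p) powr e"
      using w' p by (intro powr_mult)
    also have "\<dots> * ((1 + 1 / w) * Gamma (p + w)) = ?C * (1 + p) powr e * Gamma (p + w)"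
      by (simp only: mult_ac)
    finally show ?thesis .
  qed
  then show ?thesis using False w w' by (intro exI[of _ ?C] conjI mult_pos_pos add_pos_pos) auto
qed

section \<open>Beta and Dirichlet integrals\<close>

lemma Beta_pos_real: "a > 0 \<Longrightarrow> b > 0 \<Longrightarrow> Beta a b > (0::real)"
  by (simp add: Beta_def Gamma_real_pos)

text \<open>The substitution t = A x / (E + A x) maps the range into (0, 1) and yields a part of a
  Beta integral.\<close>

lemma nn_integral_beta_scaled:
  fixes a M E A :: real
  assumes "a > 0" "M > 0" "E > 0" "A > 0"
  shows "(\<integral>\<^sup>+x\<in>{0<..<2}. ennreal (x powr (a - 1) * (E + A * x) powr (- (M + a))) \<partial>lborel)
     \<le> ennreal (Beta a M * A powr (- a) * E powr (- M))"
proof -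
  let ?f = "\<lambda>t::real. t powr (a - 1) * (1 - t) powr (M - 1)"
  let ?g = "\<lambda>x::real. A * x / (E + A * x)"
  let ?g' = "\<lambda>x::real. A * E / (E + A * x)\<^sup>2"
  let ?c = "A powr (- a) * E powr (- M)"
  have pos: "E + A * x > 0" if "x \<ge> 0" for x using that assms by (simp add: add_pos_nonneg)
  have eq: "x powr (a - 1) * (E + A * x) powr (- (M + a)) = ?c * (?f (?g x) * ?g' x)" if x: "x > 0" for x
  proof -
    define s where "s = E + A * x"
    have s: "s > 0" using pos x by (simp add: s_def)
    have 1: "1 - A * x / s = E / s" using s unfolding s_def by (simp add: field_simps)
    have "s\<^sup>2 = s powr 2" using s by (simp add: powr_numeral)
    then have 2: "A * E / s\<^sup>2 = A powr 1 * E powr 1 * s powr (- 2)"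
      using assms s by (simp add: powr_minus divide_simps)
    have "?c * (?f (A * x / s) * (A * E / s\<^sup>2))
       = ?c * (((A powr (a-1) * x powr (a - 1) * s powr (- (a - 1))) * (E powr (M - 1) * s powr (-(M - 1)))) * (A powr 1 * E powr 1 * s powr (- 2)))"
      unfolding 1 2 using assms x s powr_minus[of s "a - 1"] powr_minus[of s "M - 1"]
      by (simp add: powr_divide powr_mult divide_inverse inverse_powr)
    also have "\<dots> = x powr (a - 1) * (A powr (-a) * A powr (a - 1) * A powr 1) * (E powr (-M) * E powr (M - 1) * E powr 1)
       * (s powr (- (a - 1)) * s powr (- (M - 1)) * s powr (- 2))"
      by (simp only: mult_ac)
    also have "\<dots> = x powr (a - 1) * s powr (- (M + a))"
      using assms s by (simp flip: powr_add add: algebra_simps)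
    finally show ?thesis unfolding s_def by simp
  qed
  have "(\<integral>\<^sup>+x. ennreal (?f (?g x) * ?g' x * indicator {0..2} x) \<partial>lborel)
     = (\<integral>\<^sup>+x. ennreal (?f x * indicator {?g 0..?g 2} x) \<partial>lborel)"
  proof (rule nn_integral_substitution[symmetric])
    show "set_borel_measurable borel {?g 0..?g 2} ?f" unfolding set_borel_measurable_def by measurable
    fix x :: real assume "x \<in> {0..2}"
    then have p: "E + A * x > 0" using pos by auto
    then show "(?g has_real_derivative ?g' x) (at x)"
      by (auto intro!: derivative_eq_intros simp: power2_eq_square field_simps)
    show "?g' x \<ge> 0" using assms by simp
  next
    show "continuous_on {0..2} ?g'" using pos by (intro continuous_intros) force
  qed simp
  also have "\<dots> \<le> (\<integral>\<^sup>+x. ennreal (?f x) * indicator {0..1} x \<partial>lborel)"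
  proof (intro nn_integral_mono)
    fix x :: real
    have "?g 2 \<le> 1" using assms by (simp add: field_simps)
    then show "ennreal (?f x * indicator {?g 0..?g 2} x) \<le> ennreal (?f x) * indicator {0..1} x"
      by (auto split: split_indicator)
  qed
  also have "\<dots> = ennreal (Beta a M)"
    by (rule nn_integral_has_integral_lebesgue') (use has_integral_Beta_real[OF assms(1,2)] in auto)
  finally have I: "(\<integral>\<^sup>+x. ennreal (?f (?g x) * ?g' x * indicator {0..2} x) \<partial>lborel) \<le> ennreal (Beta a M)" .
  have "(\<integral>\<^sup>+x\<in>{0<..<2}. ennreal (x powr (a - 1) * (E + A * x) powr (- (M + a))) \<partial>lborel)
     \<le> (\<integral>\<^sup>+x. ennreal ?c * ennreal (?f (?g x) * ?g' x * indicator {0..2} x) \<partial>lborel)"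
  proof (intro nn_integral_mono)
    fix x :: real
    show "ennreal (x powr (a - 1) * (E + A * x) powr (- (M + a))) * indicator {0<..<2} x
      \<le> ennreal ?c * ennreal (?f (?g x) * ?g' x * indicator {0..2} x)"
    proof (cases "0 < x \<and> x < 2")
      case True
      then have "ennreal (x powr (a - 1) * (E + A * x) powr (- (M + a))) = ennreal (?c * (?f (?g x) * ?g' x))"
        using eq[of x] by (simp only:)
      also have "\<dots> = ennreal ?c * ennreal (?f (?g x) * ?g' x)" by (rule ennreal_mult') simp
      finally show ?thesis using True by simp
    qed simp
  qed
  also have "\<dots> = ennreal ?c * (\<integral>\<^sup>+x. ennreal (?f (?g x) * ?g' x * indicator {0..2} x) \<partial>lborel)"
    by (intro nn_integral_cmult) measurable
  also have "\<dots> \<le> ennreal ?c * ennreal (Beta a M)"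
    by (intro mult_left_mono I) simp
  also have "\<dots> = ennreal (?c * Beta a M)" by (rule ennreal_mult'[symmetric]) simp
  finally show ?thesis by (simp only: mult_ac)
qed

lemma nn_integral_powr_interval:
  fixes a :: real
  assumes "a > 0" "c \<ge> 0"
  shows "(\<integral>\<^sup>+x\<in>{0<..<c}. ennreal (x powr (a - 1)) \<partial>lborel) = ennreal (c powr a / a)"
proof -
  have "((\<lambda>x. x powr (a - 1)) has_integral (c powr a / a)) {0..c}"
    using has_integral_powr_from_0[of "a - 1" c] assms by simp
  then have "((\<lambda>x. x powr (a - 1)) has_integral (c powr a / a)) {0<..<c}"
    by (simp add: has_integral_Icc_iff_Ioo)
  then show ?thesis by (intro nn_integral_has_integral_lebesgue') auto
qed

text \<open>The full Beta integral yields \<open>A powr (- \<gamma>)\<close>, which is sharp for E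
  \<le> A but too large when A is small against E. In that regime \<open>x powr \<gamma>\<close> is
  bounded by \<open>2 powr \<gamma>\<close>, which moves \<gamma> from the power of A to the power
  of E. The Beta function then changes by about (M / p)^\<gamma>, whence the condition on M. This
  fails for small p, where Beta p blows up; for p < 1 the bound (E + A x)^(-p) \<le> (A x)^(-p) is
  used instead.\<close>

lemma beta_integral_two_regimes:
  fixes \<gamma> \<kappa> K :: real
  assumes g: "\<gamma> > 0" and k: "\<kappa> > 0"
  shows "\<exists>C>0. \<forall>p M A E. p \<ge> 0 \<longrightarrow> \<kappa> \<le> M \<longrightarrow> M \<le> K * (1 + p) \<longrightarrow> A > 0 \<longrightarrow> E > 0 \<longrightarrow>
    (\<integral>\<^sup>+x\<in>{0<..<2}. ennreal (x powr (p + \<gamma> - 1) * (E + A * x) powr (- (M + p + \<gamma>))) \<partial>lborel)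
     \<le> ennreal (C * Beta (p + \<gamma>) M * A powr (- p) * (E + A) powr (- \<gamma>) * E powr (- M))"
proof -
  define K' where "K' = max K 1"
  have K': "K' \<ge> K" "K' > 0" by (auto simp: K'_def)
  \<comment> \<open>One constant per regime: E \<le> A; A < E with p \<ge> 1; A < E with p <
    1.\<close>
  define C1 where "C1 = 2 powr \<gamma>"
  define C2 where "C2 = 4 powr \<gamma> * ((2 * K' + \<gamma>) powr \<gamma> * (1 + \<gamma>))"
  define C3 where "C3 = 4 powr (1 + \<gamma>) / (\<gamma> * Beta (1 + \<gamma>) (2 * K'))"
  have Cpos: "C1 > 0" "C2 > 0" "C3 > 0"
    using K' g Beta_pos_real[of "1+\<gamma>" "2*K'"] by (auto simp: C1_def C2_def C3_def)
  have EA: "E powr (- \<gamma>) \<le> 2 powr \<gamma> * (E + A) powr (- \<gamma>)" if "A \<le> E" "A > 0" for A E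
  proof -
    have "((E + A) / 2) powr (\<gamma>) \<le> E powr \<gamma>" using that g by (intro powr_mono2) auto
    then show ?thesis using that by (simp add: powr_minus powr_divide field_simps)
  qed
  show ?thesis
  proof (intro exI[of _ "C1 + C2 + C3"] conjI allI impI)
    show "C1 + C2 + C3 > 0" using Cpos by simp
    fix p M A E :: real
    assume p: "p \<ge> 0" and kM: "\<kappa> \<le> M" and MK: "M \<le> K * (1 + p)" and A: "A > 0" and E: "E > 0"
    have M: "M > 0" using kM k by simp
    have MK': "M \<le> K' * (1 + p)" using MK K' p by (smt (verit) mult_right_mono)
    let ?I = "\<integral>\<^sup>+x\<in>{0<..<2}. ennreal (x powr (p + \<gamma> - 1) * (E + A * x) powr (- (M + p + \<gamma>))) \<partial>lborel"
    let ?B = "Beta (p + \<gamma>) M" let ?R = "?B * A powr (- p) * (E + A) powr (- \<gamma>) * E powr (- M)"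
    have Bp: "?B > 0" using p g M by (intro Beta_pos_real) auto
    have Rp: "?R \<ge> 0" using Bp by simp
    have "\<exists>C\<in>{C1, C2, C3}. ?I \<le> ennreal (C * ?R)"
    proof (cases "E \<le> A")
      case True
      have "?I \<le> ennreal (?B * A powr (- (p + \<gamma>)) * E powr (- M))"
        using nn_integral_beta_scaled[of "p + \<gamma>" M E A] p g M E A by (simp add: add.assoc)
      also have "?B * A powr (- (p + \<gamma>)) * E powr (- M) = ?B * A powr (-p) * A powr (- \<gamma>) * E powr (- M)"
        using A by (simp flip: powr_add)
      also have "\<dots> \<le> ?B * A powr (-p) * (C1 * (E + A) powr (- \<gamma>)) * E powr (- M)"
        using EA[OF True E] Bp unfolding C1_def by (intro mult_left_mono mult_right_mono) (auto simp: add_ac)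
      also have "\<dots> = C1 * ?R" by (simp add: mult_ac)
      finally show ?thesis by (auto simp: ennreal_leI)
    next
      case False
      then have AE: "A \<le> E" by simp
      show ?thesis
      proof (cases "p \<ge> 1")
        case True
        have "?I \<le> (\<integral>\<^sup>+x. ennreal (2 powr \<gamma>) * (ennreal (x powr (p - 1) * (E + A * x) powr (- ((M + \<gamma>) + p))) * indicator {0<..<2} x) \<partial>lborel)"
        proof (intro nn_integral_mono)
          fix x :: real
          have "x powr (p + \<gamma> - 1) \<le> 2 powr \<gamma> * x powr (p - 1)" if "0 < x" "x < 2"
          proof -
            have "x powr (p + \<gamma> - 1) = x powr \<gamma> * x powr (p - 1)" using that by (simp flip: powr_add add: algebra_simps)
            also have "\<dots> \<le> 2 powr \<gamma> * x powr (p - 1)" using that g by (intro mult_right_mono powr_mono2) auto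
            finally show ?thesis .
          qed
          then have "x powr (p + \<gamma> - 1) * (E + A * x) powr (- (M + p + \<gamma>)) \<le> 2 powr \<gamma> * (x powr (p - 1) * (E + A * x) powr (- ((M + \<gamma>) + p)))" if "0 < x" "x < 2"
            using that mult_right_mono[of "x powr (p + \<gamma> - 1)" "2 powr \<gamma> * x powr (p - 1)" "(E + A * x) powr (- (M + p + \<gamma>))"]
            by (simp add: algebra_simps)
          then show "ennreal (x powr (p + \<gamma> - 1) * (E + A * x) powr (- (M + p + \<gamma>))) * indicator {0<..<2} x
            \<le> ennreal (2 powr \<gamma>) * (ennreal (x powr (p - 1) * (E + A * x) powr (- ((M + \<gamma>) + p))) * indicator {0<..<2} x)"
            by (auto split: split_indicator simp: ennreal_mult'[symmetric] intro!: ennreal_leI)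
        qed
        also have "\<dots> = ennreal (2 powr \<gamma>) * (\<integral>\<^sup>+x\<in>{0<..<2}. ennreal (x powr (p - 1) * (E + A * x) powr (- ((M + \<gamma>) + p))) \<partial>lborel)"
          by (intro nn_integral_cmult) measurable
        also have "\<dots> \<le> ennreal (2 powr \<gamma>) * ennreal (Beta p (M + \<gamma>) * A powr (- p) * E powr (- (M + \<gamma>)))"
          by (intro mult_left_mono nn_integral_beta_scaled) (use True M g E A in auto)
        also have "\<dots> = ennreal (2 powr \<gamma> * (Beta p (M + \<gamma>) * A powr (- p) * E powr (- (M + \<gamma>))))"
          by (simp add: ennreal_mult')
        also have "2 powr \<gamma> * (Beta p (M + \<gamma>) * A powr (- p) * E powr (- (M + \<gamma>)))
           \<le> 2 powr \<gamma> * (((2 * K' + \<gamma>) powr \<gamma> * (1 + \<gamma>) * ?B) * A powr (- p) * (2 powr \<gamma> * (E + A) powr (- \<gamma>) * E powr (- M)))"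
        proof (intro mult_left_mono mult_mono)
          \<comment> \<open>By the two Gamma bounds, Gamma(M + \<gamma>) / Gamma(M) is at most (M +
            \<gamma>)^\<gamma>, and Gamma(p) / Gamma(p + \<gamma>) is at most (p + \<gamma>) /
            p^(\<gamma> + 1). With p \<ge> 1 and M at most a multiple of 1 + p, the powers of p
            cancel.\<close>
          have "Gamma p * Gamma (M + \<gamma>) \<le> ((2 * K' + \<gamma>) powr \<gamma> * (1 + \<gamma>)) * (Gamma (p + \<gamma>) * Gamma M)"
          proof -
            have 1: "Gamma (M + \<gamma>) \<le> (M + \<gamma>) powr \<gamma> * Gamma M" using M g by (intro Gamma_plus_le) auto
            have 2: "p powr (\<gamma> + 1) * Gamma p \<le> (p + \<gamma>) * Gamma (p + \<gamma>)" using True g by (intro Gamma_plus_ge) auto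
            have 3: "(M + \<gamma>) powr \<gamma> \<le> ((2 * K' + \<gamma>) * p) powr \<gamma>"
            proof (intro powr_mono2)
              have "K' * (1 + p) \<le> 2 * K' * p" using True K' by (simp add: algebra_simps)
              moreover have "\<gamma> \<le> \<gamma> * p" using True g by (simp add: algebra_simps)
              ultimately show "M + \<gamma> \<le> (2 * K' + \<gamma>) * p" using MK' by (simp add: algebra_simps)
            qed (use M g in auto)
            have 4: "p + \<gamma> \<le> (1 + \<gamma>) * p" using True g by (simp add: algebra_simps)
            have "p powr (\<gamma> + 1) * (Gamma p * Gamma (M + \<gamma>)) \<le> ((p + \<gamma>) * Gamma (p + \<gamma>)) * ((M + \<gamma>) powr \<gamma> * Gamma M)"
              using mult_mono[OF 2 1] True g M by (simp add: mult_ac Gamma_real_pos less_imp_le)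
            also have "\<dots> \<le> (((1 + \<gamma>) * p) * Gamma (p + \<gamma>)) * (((2 * K' + \<gamma>) * p) powr \<gamma> * Gamma M)"
              using 3 4 True g M by (intro mult_mono mult_right_mono) (auto simp: Gamma_real_pos less_imp_le)
            also have "\<dots> = p powr (\<gamma> + 1) * (((2 * K' + \<gamma>) powr \<gamma> * (1 + \<gamma>)) * (Gamma (p + \<gamma>) * Gamma M))"
              using True g K' by (simp add: powr_mult powr_add mult_ac)
            finally show ?thesis using True by (simp add: mult_le_cancel_left_pos)
          qed
          then have "Gamma p * Gamma (M + \<gamma>) / Gamma (p + \<gamma> + M) \<le> ((2 * K' + \<gamma>) powr \<gamma> * (1 + \<gamma>)) * (Gamma (p + \<gamma>) * Gamma M) / Gamma (p + \<gamma> + M)"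
            using p g M by (intro divide_right_mono) (auto simp: Gamma_real_pos less_imp_le)
          then show "Beta p (M + \<gamma>) \<le> (2 * K' + \<gamma>) powr \<gamma> * (1 + \<gamma>) * ?B"
            unfolding Beta_def by (simp add: add_ac)
          show "E powr (- (M + \<gamma>)) \<le> 2 powr \<gamma> * (E + A) powr (- \<gamma>) * E powr (- M)"
          proof -
            have "E powr (- (M + \<gamma>)) = E powr (- \<gamma>) * E powr (- M)" using E by (simp flip: powr_add add: algebra_simps)
            also have "\<dots> \<le> (2 powr \<gamma> * (E + A) powr (- \<gamma>)) * E powr (- M)" using EA[OF AE A] by (intro mult_right_mono) auto
            finally show ?thesis .
          qed
        qed (use K' g Bp in auto)
        also have "\<dots> = (2 powr \<gamma> * 2 powr \<gamma>) * ((2 * K' + \<gamma>) powr \<gamma> * (1 + \<gamma>)) * ?R" by (simp add: mult_ac)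
        also have "2 powr \<gamma> * 2 powr \<gamma> = 4 powr \<gamma>" by (simp flip: powr_mult)
        finally show ?thesis by (auto simp: ennreal_leI C2_def)
      next
        case False
        have "?I \<le> (\<integral>\<^sup>+x. ennreal (A powr (- p) * E powr (- (M + \<gamma>))) * (ennreal (x powr (p + \<gamma> - 1) * x powr (-p)) * indicator {0<..<2} x) \<partial>lborel)"
        proof (intro nn_integral_mono)
          fix x :: real
          have "(E + A * x) powr (- (M + p + \<gamma>)) \<le> A powr (- p) * E powr (- (M + \<gamma>)) * x powr (- p)" if "0 < x"
          proof -
            have "(E + A * x) powr (- (M + p + \<gamma>)) = (E + A * x) powr (- p) * (E + A * x) powr (- (M + \<gamma>))"
              using that A E by (simp flip: powr_add add: algebra_simps)
            also have "\<dots> \<le> (A * x) powr (- p) * E powr (- (M + \<gamma>))"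
              using that A E p M g by (intro mult_mono powr_mono2') auto
            finally show ?thesis by (simp add: powr_mult mult_ac)
          qed
          then have "x powr (p + \<gamma> - 1) * (E + A * x) powr (- (M + p + \<gamma>)) \<le> (A powr (- p) * E powr (- (M + \<gamma>))) * (x powr (p + \<gamma> - 1) * x powr (- p))" if "0 < x"
            using that mult_left_mono[of "(E + A * x) powr (- (M + p + \<gamma>))" "A powr (- p) * E powr (- (M + \<gamma>)) * x powr (- p)" "x powr (p + \<gamma> - 1)"]
            by (simp add: mult_ac)
          then show "ennreal (x powr (p + \<gamma> - 1) * (E + A * x) powr (- (M + p + \<gamma>))) * indicator {0<..<2} x
            \<le> ennreal (A powr (- p) * E powr (- (M + \<gamma>))) * (ennreal (x powr (p + \<gamma> - 1) * x powr (-p)) * indicator {0<..<2} x)"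
            by (auto split: split_indicator simp: ennreal_mult'[symmetric] intro!: ennreal_leI)
        qed
        also have "\<dots> = ennreal (A powr (- p) * E powr (- (M + \<gamma>))) * (\<integral>\<^sup>+x\<in>{0<..<2}. ennreal (x powr (p + \<gamma> - 1) * x powr (-p)) \<partial>lborel)"
          by (intro nn_integral_cmult) measurable
        also have "(\<integral>\<^sup>+x\<in>{0<..<2}. ennreal (x powr (p + \<gamma> - 1) * x powr (-p)) \<partial>lborel)
            = (\<integral>\<^sup>+x\<in>{0<..<2}. ennreal (x powr (\<gamma> - 1)) \<partial>lborel)"
          by (intro nn_integral_cong) (auto split: split_indicator simp flip: powr_add)
        also have "\<dots> = ennreal (2 powr \<gamma> / \<gamma>)" by (rule nn_integral_powr_interval) (use g in auto)
        also have "ennreal (A powr (- p) * E powr (- (M + \<gamma>))) * ennreal (2 powr \<gamma> / \<gamma>)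
            = ennreal ((A powr (- p) * E powr (- (M + \<gamma>))) * (2 powr \<gamma> / \<gamma>))"
          using g by (subst ennreal_mult'') auto
        also have "(A powr (- p) * E powr (- (M + \<gamma>))) * (2 powr \<gamma> / \<gamma>)
           \<le> (A powr (- p) * ((2 powr \<gamma> * (E + A) powr (- \<gamma>)) * E powr (- M))) * (2 powr \<gamma> / \<gamma> * (?B / Beta (1 + \<gamma>) (2 * K')))"
        proof (intro mult_mono)
          have "E powr (- (M + \<gamma>)) = E powr (- \<gamma>) * E powr (- M)" using E by (simp flip: powr_add add: algebra_simps)
          also have "\<dots> \<le> (2 powr \<gamma> * (E + A) powr (- \<gamma>)) * E powr (- M)" using EA[OF AE A] by (intro mult_right_mono) auto
          finally show "E powr (- (M + \<gamma>)) \<le> (2 powr \<gamma> * (E + A) powr (- \<gamma>)) * E powr (- M)" .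
          have "K' * (1 + p) \<le> K' * 2" using False K' by (intro mult_left_mono) auto
          with MK' have "M \<le> 2 * K'" by linarith
          \<comment> \<open>For p < 1 both arguments of the Beta function are bounded, so its
            monotonicity gives a positive lower bound by which the remaining constant can be
            absorbed.\<close>
          then have "Beta (1 + \<gamma>) (2 * K') \<le> ?B"
            using False p g M K' MK' by (intro Beta_real_mono) auto
          then have "1 \<le> ?B / Beta (1 + \<gamma>) (2 * K')" using Beta_pos_real[of "1+\<gamma>" "2*K'"] g K' by simp
          then show "2 powr \<gamma> / \<gamma> \<le> 2 powr \<gamma> / \<gamma> * (?B / Beta (1 + \<gamma>) (2 * K'))"
            using g mult_left_mono[of 1 _ "2 powr \<gamma> / \<gamma>"] by fastforce
        qed (use g in auto)
        also have "\<dots> = (2 powr \<gamma> * 2 powr \<gamma>) / (\<gamma> * Beta (1 + \<gamma>) (2 * K')) * ?R" by (simp add: mult_ac)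
        also have "2 powr \<gamma> * 2 powr \<gamma> = 4 powr \<gamma>" by (simp flip: powr_mult)
        also have "4 powr \<gamma> / (\<gamma> * Beta (1 + \<gamma>) (2 * K')) * ?R \<le> C3 * ?R"
          unfolding C3_def using g K' Beta_pos_real[of "1+\<gamma>" "2*K'"] Rp
          by (intro mult_right_mono divide_right_mono powr_mono) auto
        finally show ?thesis by (auto simp: ennreal_leI)
      qed
    qed
    then obtain C where C: "C \<in> {C1, C2, C3}" "?I \<le> ennreal (C * ?R)" by blast
    have "C * ?R \<le> (C1 + C2 + C3) * ?R" using C(1) Cpos Rp by (intro mult_right_mono) auto
    with C(2) show "?I \<le> ennreal ((C1 + C2 + C3) * Beta (p + \<gamma>) M * A powr (- p) * (E + A) powr (- \<gamma>) * E powr (- M))"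
      by (smt (verit, best) ennreal_leI mult.assoc order_trans)
  qed
qed

text \<open>The one-dimensional bound is used in x with E = D + B y and M = q + \<delta> + \<kappa>,
  then in y with M = \<kappa>. The condition q \<le> K (1 + p) is what the first integration asks
  for. The two Beta functions telescope to a single Gamma quotient.\<close>

lemma double_beta_integral:
  fixes \<gamma> \<delta> \<kappa> K :: real
  assumes g: "\<gamma> > 0" and d: "\<delta> > 0" and k: "\<kappa> > 0" and K: "K \<ge> 0"
  shows "\<exists>C>0. \<forall>p q A B D. p \<ge> 0 \<longrightarrow> q \<ge> 0 \<longrightarrow> q \<le> K * (1 + p) \<longrightarrow> A > 0 \<longrightarrow> B > 0 \<longrightarrow> D > 0 \<longrightarrow>
    (\<integral>\<^sup>+y\<in>{0<..<2}. ennreal (y powr (q + \<delta> - 1)) *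
       (\<integral>\<^sup>+x\<in>{0<..<2}. ennreal (x powr (p + \<gamma> - 1) * (D + B * y + A * x) powr (- (p + q + \<gamma> + \<delta> + \<kappa>))) \<partial>lborel) \<partial>lborel)
     \<le> ennreal (C * (Gamma (p + \<gamma>) * Gamma (q + \<delta>) / Gamma (p + q + \<gamma> + \<delta> + \<kappa>)
          * A powr (- p) * B powr (- q) * (D + A) powr (- \<gamma>) * (D + B) powr (- \<delta>) * D powr (- \<kappa>)))"
proof -
  obtain C1 where C1: "C1 > 0" "\<And>p M A E. p \<ge> 0 \<Longrightarrow> \<delta> + \<kappa> \<le> M \<Longrightarrow> M \<le> (K + \<delta> + \<kappa>) * (1 + p) \<Longrightarrow> A > 0 \<Longrightarrow> E > 0 \<Longrightarrow>
    (\<integral>\<^sup>+x\<in>{0<..<2}. ennreal (x powr (p + \<gamma> - 1) * (E + A * x) powr (- (M + p + \<gamma>))) \<partial>lborel)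
     \<le> ennreal (C1 * Beta (p + \<gamma>) M * A powr (- p) * (E + A) powr (- \<gamma>) * E powr (- M))"
    using beta_integral_two_regimes[OF g, of "\<delta> + \<kappa>" "K + \<delta> + \<kappa>"] d k by auto
  obtain C2 where C2: "C2 > 0" "\<And>p M A E. p \<ge> 0 \<Longrightarrow> \<kappa> \<le> M \<Longrightarrow> M \<le> \<kappa> * (1 + p) \<Longrightarrow> A > 0 \<Longrightarrow> E > 0 \<Longrightarrow>
    (\<integral>\<^sup>+x\<in>{0<..<2}. ennreal (x powr (p + \<delta> - 1) * (E + A * x) powr (- (M + p + \<delta>))) \<partial>lborel)
     \<le> ennreal (C2 * Beta (p + \<delta>) M * A powr (- p) * (E + A) powr (- \<delta>) * E powr (- M))"
    using beta_integral_two_regimes[OF d k, of \<kappa>] by auto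
  show ?thesis
  proof (intro exI[of _ "C1 * C2 * Gamma \<kappa>"] conjI allI impI)
    show "C1 * C2 * Gamma \<kappa> > 0" using C1 C2 k by (simp add: Gamma_real_pos)
    fix p q A B D :: real
    assume p: "p \<ge> 0" and q: "q \<ge> 0" and qp: "q \<le> K * (1 + p)" and A: "A > 0" and B: "B > 0" and D: "D > 0"
    let ?M = "q + \<delta> + \<kappa>"
    define c where "c = C1 * Beta (p + \<gamma>) ?M * A powr (- p) * (D + A) powr (- \<gamma>)"
    have Bp: "Beta (p + \<gamma>) ?M > 0" "Beta (q + \<delta>) \<kappa> > 0" using p q g d k by (auto intro!: Beta_pos_real)
    have c: "c \<ge> 0" using C1 Bp by (simp add: c_def)
    have inner: "(\<integral>\<^sup>+x\<in>{0<..<2}. ennreal (x powr (p + \<gamma> - 1) * (D + B * y + A * x) powr (- (p + q + \<gamma> + \<delta> + \<kappa>))) \<partial>lborel)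
       \<le> ennreal (c * (D + B * y) powr (- ?M))" if y: "y > 0" for y
    proof -
      have E: "D + B * y > 0" using D B y by (simp add: add_pos_pos)
      have "?M \<le> (K + \<delta> + \<kappa>) * (1 + p)"
      proof -
        have "0 \<le> (\<delta> + \<kappa>) * p" using d k p by simp
        then show ?thesis using qp by (simp add: algebra_simps)
      qed
      then have "(\<integral>\<^sup>+x\<in>{0<..<2}. ennreal (x powr (p + \<gamma> - 1) * (D + B * y + A * x) powr (- (?M + p + \<gamma>))) \<partial>lborel)
        \<le> ennreal (C1 * Beta (p + \<gamma>) ?M * A powr (- p) * (D + B * y + A) powr (- \<gamma>) * (D + B * y) powr (- ?M))"
        by (intro C1(2)) (use p q A E in auto)
      \<comment> \<open>Replacing \<open>D + B * y + A\<close> by \<open>D + A\<close> makes this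
        factor independent of y and lets it leave the outer integral.\<close>
      also have "\<dots> \<le> ennreal (c * (D + B * y) powr (- ?M))"
        unfolding c_def using C1(1) Bp A B D y g
        by (intro ennreal_leI mult_right_mono mult_left_mono powr_mono2') auto
      also have "?M + p + \<gamma> = p + q + \<gamma> + \<delta> + \<kappa>" by simp
      finally show ?thesis .
    qed
    have "(\<integral>\<^sup>+y\<in>{0<..<2}. ennreal (y powr (q + \<delta> - 1)) *
       (\<integral>\<^sup>+x\<in>{0<..<2}. ennreal (x powr (p + \<gamma> - 1) * (D + B * y + A * x) powr (- (p + q + \<gamma> + \<delta> + \<kappa>))) \<partial>lborel) \<partial>lborel)
      \<le> (\<integral>\<^sup>+y. ennreal c * (ennreal (y powr (q + \<delta> - 1) * (D + B * y) powr (- (\<kappa> + q + \<delta>))) * indicator {0<..<2} y) \<partial>lborel)"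
    proof (intro nn_integral_mono)
      fix y :: real
      show "ennreal (y powr (q + \<delta> - 1)) *
       (\<integral>\<^sup>+x\<in>{0<..<2}. ennreal (x powr (p + \<gamma> - 1) * (D + B * y + A * x) powr (- (p + q + \<gamma> + \<delta> + \<kappa>))) \<partial>lborel) * indicator {0<..<2} y
       \<le> ennreal c * (ennreal (y powr (q + \<delta> - 1) * (D + B * y) powr (- (\<kappa> + q + \<delta>))) * indicator {0<..<2} y)"
      proof (cases "0 < y \<and> y < 2")
        case True
        have "ennreal (y powr (q + \<delta> - 1)) *
          (\<integral>\<^sup>+x\<in>{0<..<2}. ennreal (x powr (p + \<gamma> - 1) * (D + B * y + A * x) powr (- (p + q + \<gamma> + \<delta> + \<kappa>))) \<partial>lborel)
          \<le> ennreal (y powr (q + \<delta> - 1)) * ennreal (c * (D + B * y) powr (- ?M))"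
          by (intro mult_left_mono inner) (use True in auto)
        also have "\<dots> = ennreal c * ennreal (y powr (q + \<delta> - 1) * (D + B * y) powr (- ?M))"
          using c by (simp add: ennreal_mult'[symmetric] mult_ac)
        also have "?M = \<kappa> + q + \<delta>" by simp
        finally show ?thesis using True by simp
      qed simp
    qed
    also have "\<dots> = ennreal c * (\<integral>\<^sup>+y\<in>{0<..<2}. ennreal (y powr (q + \<delta> - 1) * (D + B * y) powr (- (\<kappa> + q + \<delta>))) \<partial>lborel)"
      by (intro nn_integral_cmult) measurable
    also have "\<dots> \<le> ennreal c * ennreal (C2 * Beta (q + \<delta>) \<kappa> * B powr (- q) * (D + B) powr (- \<delta>) * D powr (- \<kappa>))"
      by (intro mult_left_mono C2(2)) (use q k B D in auto)
    also have "\<dots> = ennreal (c * (C2 * Beta (q + \<delta>) \<kappa> * B powr (- q) * (D + B) powr (- \<delta>) * D powr (- \<kappa>)))"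
      using c by (simp add: ennreal_mult')
    also have "c * (C2 * Beta (q + \<delta>) \<kappa> * B powr (- q) * (D + B) powr (- \<delta>) * D powr (- \<kappa>))
      = C1 * C2 * (Beta (p + \<gamma>) ?M * Beta (q + \<delta>) \<kappa>) * A powr (- p) * B powr (- q) * (D + A) powr (- \<gamma>) * (D + B) powr (- \<delta>) * D powr (- \<kappa>)"
      by (simp add: c_def mult_ac)
    also have "Beta (p + \<gamma>) ?M * Beta (q + \<delta>) \<kappa> = Gamma \<kappa> * (Gamma (p + \<gamma>) * Gamma (q + \<delta>) / Gamma (p + q + \<gamma> + \<delta> + \<kappa>))"
    proof -
      have "Gamma ?M > 0" using q d k by (intro Gamma_real_pos) auto
      moreover have "p + \<gamma> + ?M = p + q + \<gamma> + \<delta> + \<kappa>" by simp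
      ultimately show ?thesis by (simp only: Beta_def times_divide_eq_left times_divide_eq_right divide_divide_eq_left) (simp add: field_simps)
    qed
    finally show "(\<integral>\<^sup>+y\<in>{0<..<2}. ennreal (y powr (q + \<delta> - 1)) *
       (\<integral>\<^sup>+x\<in>{0<..<2}. ennreal (x powr (p + \<gamma> - 1) * (D + B * y + A * x) powr (- (p + q + \<gamma> + \<delta> + \<kappa>))) \<partial>lborel) \<partial>lborel)
     \<le> ennreal (C1 * C2 * Gamma \<kappa> * (Gamma (p + \<gamma>) * Gamma (q + \<delta>) / Gamma (p + q + \<gamma> + \<delta> + \<kappa>)
          * A powr (- p) * B powr (- q) * (D + A) powr (- \<gamma>) * (D + B) powr (- \<delta>) * D powr (- \<kappa>)))"
      by (simp only: mult_ac)
  qed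
qed

section \<open>From the Jacobi weight to a pure power\<close>

text \<open>The weight \<open>(1 - u\<^sup>2) powr (a - 1)\<close> in the variable \<open>x = 1 - u\<close>.\<close>
definition jacobi_weight :: "real \<Rightarrow> real \<Rightarrow> real" where
  "jacobi_weight a x = (x * (2 - x)) powr (a - 1)"

lemma jacobi_weight_nonneg [simp]: "0 \<le> jacobi_weight a x"
  by (simp add: jacobi_weight_def)

lemma jacobi_weight_measurable [measurable]: "jacobi_weight a \<in> borel_measurable borel"
  unfolding jacobi_weight_def by measurable

text \<open>With x = 2t and a = p + w - 1, the factor (1 - t)^a is at most exp(-a t), which pays for
  (1 + a t)^2 \<le> 4 exp(a t). The factor 2^p stays in the bound and is compensated later by the
  power of 2 in the normalising constant.\<close>

lemma jacobi_weight_decay: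
  fixes w :: real
  assumes w: "w > 0"
  shows "\<exists>C>0. \<forall>p\<ge>1. \<forall>x\<in>{0<..<2}. jacobi_weight (p + w) x * (1 + (1 + p) * x)\<^sup>2 \<le> C * 2 powr p * x powr (p + w - 1)"
proof -
  define w' where "w' = min w 1"
  have w': "0 < w'" "w' \<le> 1" "w' \<le> w" using w by (auto simp: w'_def)
  show ?thesis
  proof (intro exI[of _ "2 powr (w - 1) * ((4 / w')\<^sup>2 * 4)"] conjI allI impI ballI)
    show "2 powr (w - 1) * ((4 / w')\<^sup>2 * 4) > 0" using w' by simp
    fix p x :: real assume p: "p \<ge> 1" and x: "x \<in> {0<..<2}"
    define a where "a = p + w - 1"
    define t where "t = x / 2"
    have t: "0 < t" "t < 1" "x = 2 * t" using x by (auto simp: t_def)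
    \<comment> \<open>Even if w < 1, the exponent a is at least a fixed multiple of p, because p
      \<ge> 1.\<close>
    have "w' * (p - 1) \<le> p - 1" using w' p by (simp add: mult_left_le_one_le)
    then have wa: "w' * p \<le> a" using w' by (simp add: algebra_simps a_def)
    then have a: "a > 0" using w' p by (smt (verit) mult_pos_pos)
    have "1 + (1 + p) * x \<le> (4 / w') * (1 + a * t)"
    proof -
      have "(1 + p) * x \<le> (2 * p) * x" using p x by (intro mult_right_mono) auto
      also have "\<dots> = 4 / w' * ((w' * p) * t)" using w' t by simp
      also have "\<dots> \<le> 4 / w' * (a * t)" using wa t w' by (intro mult_left_mono mult_right_mono) auto
      finally have "(1 + p) * x \<le> 4 / w' * (a * t)" .
      moreover have "1 \<le> 4 / w'" using w' by simp
      ultimately show ?thesis by (simp only: distrib_left mult_1_right add_mono)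
    qed
    then have R: "(1 + (1 + p) * x)\<^sup>2 \<le> ((4 / w') * (1 + a * t))\<^sup>2" using p x by (intro power_mono) auto
    have ex: "(1 + a * t)\<^sup>2 \<le> 4 * exp (a * t)"
    proof -
      have at: "0 \<le> a * t" using a t by simp
      have "1 + a * t / 2 \<le> exp (a * t / 2)" by (rule exp_ge_add_one_self)
      moreover have "(1 + a * t) / 2 \<le> 1 + a * t / 2" by (simp add: field_simps)
      ultimately have "(1 + a * t) / 2 \<le> exp (a * t / 2)" by (rule order_trans[rotated])
      then have "((1 + a * t) / 2)\<^sup>2 \<le> (exp (a * t / 2))\<^sup>2" using at by (intro power_mono) auto
      also have "\<dots> = exp (a * t)" by (simp add: power2_eq_square flip: exp_add)
      finally show ?thesis by (simp add: power_divide)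
    qed
    have "(2 - x) powr a = 2 powr a * (1 - t) powr a"
      using t by (simp add: powr_mult[symmetric] algebra_simps)
    also have "(1 - t) powr a \<le> (exp (- t)) powr a"
      using t a exp_ge_add_one_self[of "- t"] by (intro powr_mono2) auto
    also have "(exp (- t)) powr a = exp (- (a * t))" by (simp add: powr_def)
    finally have dec: "(2 - x) powr a \<le> 2 powr a * exp (- (a * t))" by simp
    have "jacobi_weight (p + w) x * (1 + (1 + p) * x)\<^sup>2 = x powr a * ((2 - x) powr a * (1 + (1 + p) * x)\<^sup>2)"
      using x by (simp add: jacobi_weight_def a_def powr_mult)
    also have "\<dots> \<le> x powr a * ((2 powr a * exp (- (a * t))) * ((4 / w') * (1 + a * t))\<^sup>2)"
      using dec R by (intro mult_left_mono mult_mono) auto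
    also have "\<dots> = x powr a * (2 powr a * exp (- (a * t)) * (4 / w')\<^sup>2 * (1 + a * t)\<^sup>2)"
      by (simp only: power_mult_distrib mult_ac)
    also have "\<dots> \<le> x powr a * (2 powr a * exp (- (a * t)) * (4 / w')\<^sup>2 * (4 * exp (a * t)))"
      using ex by (intro mult_left_mono) auto
    also have "\<dots> = 2 powr a * ((4 / w')\<^sup>2 * 4) * x powr a" by (simp add: exp_minus)
    also have "2 powr a = 2 powr (w - 1) * 2 powr p" by (simp add: a_def algebra_simps flip: powr_add)
    finally show "jacobi_weight (p + w) x * (1 + (1 + p) * x)\<^sup>2 \<le> 2 powr (w - 1) * ((4 / w')\<^sup>2 * 4) * 2 powr p * x powr (p + w - 1)"
      by (simp add: a_def mult_ac)
  qed
qed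

text \<open>For p \<ge> 1 the weight is bounded pointwise. For p = 0 the factor (2 - x)^(w - 1) may
  blow up at x = 2 but remains integrable; as g is decreasing, the contribution of [1, 2) is at most
  a multiple of g(1), and this in turn is controlled by the integral over (0, 1).\<close>

lemma nn_integral_jacobi_weight_reduce:
  fixes w e :: real
  assumes w: "w > 0"
  shows "\<exists>C>0. \<forall>p g. (p = 0 \<and> e \<ge> 0 \<or> p \<ge> 1) \<longrightarrow> g \<in> borel_measurable borel \<longrightarrow>
     (\<forall>x y. 0 < x \<longrightarrow> x \<le> y \<longrightarrow> y < 2 \<longrightarrow> g y \<le> g x) \<longrightarrow>
     (\<integral>\<^sup>+x\<in>{0<..<2}. ennreal (jacobi_weight (p + w) x * (1 + (1 + p) * x)\<^sup>2 * x powr e) * g x \<partial>lborel)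
     \<le> ennreal (C * 2 powr p) * (\<integral>\<^sup>+x\<in>{0<..<2}. ennreal (x powr (p + e + w - 1)) * g x \<partial>lborel)"
proof -
  obtain C1 where C1: "C1 > 0" "\<And>p x. p \<ge> 1 \<Longrightarrow> x \<in> {0<..<2} \<Longrightarrow>
      jacobi_weight (p + w) x * (1 + (1 + p) * x)\<^sup>2 \<le> C1 * 2 powr p * x powr (p + w - 1)"
    using jacobi_weight_decay[OF w] by blast
  define C2 where "C2 = 4 * (1 + 2 powr w)"
  \<comment> \<open>On [1, 2), 9 bounds (1 + x)^2, \<open>2 powr (w + e)\<close> bounds the power of
    x, and 1 / w is the integral of (2 - x)^(w - 1). The factor w + e undoes the integral 1 / (w +
    e) of x^(w + e - 1) over (0, 1).\<close>
  define C3 where "C3 = 9 * 2 powr (w + e) * (1 / w) * (w + e)"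
  let ?C = "C1 + (C2 + \<bar>C3\<bar>)"
  have C2: "C2 > 0" by (simp add: C2_def add_pos_nonneg)
  show ?thesis
  proof (intro exI[of _ ?C] conjI allI impI)
    show "?C > 0" using C1 C2 by simp
    fix p :: real and g :: "real \<Rightarrow> ennreal"
    assume pe: "p = 0 \<and> e \<ge> 0 \<or> p \<ge> 1" and [measurable]: "g \<in> borel_measurable borel"
      and mono: "\<forall>x y. 0 < x \<longrightarrow> x \<le> y \<longrightarrow> y < 2 \<longrightarrow> g y \<le> g x"
    let ?L = "\<integral>\<^sup>+x\<in>{0<..<2}. ennreal (jacobi_weight (p + w) x * (1 + (1 + p) * x)\<^sup>2 * x powr e) * g x \<partial>lborel"
    let ?J = "\<integral>\<^sup>+x\<in>{0<..<2}. ennreal (x powr (p + e + w - 1)) * g x \<partial>lborel"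
    have "?L \<le> ennreal (C1 * 2 powr p) * ?J \<or> ?L \<le> ennreal ((C2 + \<bar>C3\<bar>) * 2 powr p) * ?J"
    proof (cases "p \<ge> 1")
      case True
      have "?L \<le> (\<integral>\<^sup>+x. ennreal (C1 * 2 powr p) * (ennreal (x powr (p + e + w - 1)) * g x * indicator {0<..<2} x) \<partial>lborel)"
      proof (intro nn_integral_mono)
        fix x :: real
        show "ennreal (jacobi_weight (p + w) x * (1 + (1 + p) * x)\<^sup>2 * x powr e) * g x * indicator {0<..<2} x
          \<le> ennreal (C1 * 2 powr p) * (ennreal (x powr (p + e + w - 1)) * g x * indicator {0<..<2} x)"
        proof (cases "0 < x \<and> x < 2")
          case x: True
          have "jacobi_weight (p + w) x * (1 + (1 + p) * x)\<^sup>2 * x powr e \<le> C1 * 2 powr p * x powr (p + w - 1) * x powr e"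
            using C1(2)[OF True, of x] x by (intro mult_right_mono) auto
          also have "\<dots> = C1 * 2 powr p * x powr (p + e + w - 1)"
            using x by (simp add: mult.assoc algebra_simps flip: powr_add)
          finally have "ennreal (jacobi_weight (p + w) x * (1 + (1 + p) * x)\<^sup>2 * x powr e) \<le> ennreal (C1 * 2 powr p) * ennreal (x powr (p + e + w - 1))"
            using C1(1) by (simp add: ennreal_leI flip: ennreal_mult')
          then show ?thesis using x by (auto simp: mult.assoc[symmetric] intro!: mult_right_mono)
        qed simp
      qed
      also have "\<dots> = ennreal (C1 * 2 powr p) * ?J" by (intro nn_integral_cmult) measurable
      finally show ?thesis by simp
    next
      case False
      then have p: "p = 0" and e: "e \<ge> 0" using pe by auto
      have we: "w + e > 0" using w e by simp
      let ?f = "\<lambda>x. ennreal (x powr (w + e - 1)) * g x"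
      have J: "?J = (\<integral>\<^sup>+x\<in>{0<..<2}. ?f x \<partial>lborel)" using p by (simp add: add_ac)
      have "?L \<le> (\<integral>\<^sup>+x. (ennreal C2 * (?f x * indicator {0<..<1} x) + ennreal (9 * 2 powr (w + e)) * g 1 * (ennreal ((2 - x) powr (w - 1)) * indicator {1..<2} x)) \<partial>lborel)"
      proof (intro nn_integral_mono)
        fix x :: real
        consider "0 < x" "x < 1" | "1 \<le> x" "x < 2" | "x \<notin> {0<..<2}" by fastforce
        then show "ennreal (jacobi_weight (p + w) x * (1 + (1 + p) * x)\<^sup>2 * x powr e) * g x * indicator {0<..<2} x
          \<le> ennreal C2 * (?f x * indicator {0<..<1} x) + ennreal (9 * 2 powr (w + e)) * g 1 * (ennreal ((2 - x) powr (w - 1)) * indicator {1..<2} x)"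
        proof cases
          case 1
          have "(2 - x) powr (w - 1) \<le> 1 + 2 powr w"
          proof (cases "w \<ge> 1")
            case True
            have "(2 - x) powr (w - 1) \<le> 2 powr (w - 1)" using 1 True by (intro powr_mono2) auto
            also have "\<dots> \<le> 2 powr w" by (intro powr_mono) auto
            finally show ?thesis by simp
          next
            case False
            have "(2 - x) powr (w - 1) \<le> 1 powr (w - 1)" using 1 False by (intro powr_mono2') auto
            moreover have "(1::real) powr (w - 1) \<le> 1 + 2 powr w" by (simp add: add_increasing2)
            ultimately show ?thesis by (rule order_trans)
          qed
          moreover have "(1 + x)\<^sup>2 \<le> 2\<^sup>2" using 1 by (intro power_mono) auto
          ultimately have b: "(2 - x) powr (w - 1) * (1 + x)\<^sup>2 \<le> C2"
            unfolding C2_def using mult_mono[of "(2 - x) powr (w - 1)" "1 + 2 powr w" "(1 + x)\<^sup>2" 4] by (simp add: mult_ac)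
          have "jacobi_weight (p + w) x * (1 + (1 + p) * x)\<^sup>2 * x powr e = ((2 - x) powr (w - 1) * (1 + x)\<^sup>2) * (x powr (w - 1) * x powr e)"
            using 1 p by (simp add: jacobi_weight_def powr_mult mult_ac)
          also have "\<dots> \<le> C2 * (x powr (w - 1) * x powr e)" using b by (intro mult_right_mono) auto
          also have "x powr (w - 1) * x powr e = x powr (w + e - 1)" using 1 by (simp flip: powr_add add: algebra_simps)
          finally have "ennreal (jacobi_weight (p + w) x * (1 + (1 + p) * x)\<^sup>2 * x powr e) \<le> ennreal C2 * ennreal (x powr (w + e - 1))"
            using C2 by (simp add: ennreal_leI flip: ennreal_mult')
          then show ?thesis using 1 by (auto simp: mult.assoc[symmetric] intro!: mult_right_mono)
        next
          case 2
          have "x powr (w - 1 + e) \<le> 2 powr (w + e)"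
          proof (cases "w - 1 + e \<ge> 0")
            case True
            have "x powr (w - 1 + e) \<le> 2 powr (w - 1 + e)" using 2 True by (intro powr_mono2) auto
            also have "\<dots> \<le> 2 powr (w + e)" by (intro powr_mono) auto
            finally show ?thesis .
          next
            case False
            have "x powr (w - 1 + e) \<le> 1 powr (w - 1 + e)" using 2 False by (intro powr_mono2') auto
            also have "\<dots> \<le> 2 powr (w + e)" using we ge_one_powr_ge_zero[of 2 "w + e"] by simp
            finally show ?thesis .
          qed
          moreover have "(1 + x)\<^sup>2 \<le> 3\<^sup>2" using 2 by (intro power_mono) auto
          ultimately have b: "(1 + x)\<^sup>2 * x powr (w - 1 + e) \<le> 9 * 2 powr (w + e)"
            by (intro mult_mono) auto
          have "jacobi_weight (p + w) x * (1 + (1 + p) * x)\<^sup>2 * x powr e = ((1 + x)\<^sup>2 * (x powr (w - 1) * x powr e)) * (2 - x) powr (w - 1)"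
            using 2 p by (simp add: jacobi_weight_def powr_mult mult_ac)
          also have "x powr (w - 1) * x powr e = x powr (w - 1 + e)" using 2 by (simp flip: powr_add)
          also have "((1 + x)\<^sup>2 * x powr (w - 1 + e)) * (2 - x) powr (w - 1) \<le> 9 * 2 powr (w + e) * (2 - x) powr (w - 1)"
            using b by (intro mult_right_mono) auto
          finally have "ennreal (jacobi_weight (p + w) x * (1 + (1 + p) * x)\<^sup>2 * x powr e) * g x \<le> ennreal (9 * 2 powr (w + e)) * ennreal ((2 - x) powr (w - 1)) * g 1"
            using 2 mono[rule_format, of 1 x] by (intro mult_mono) (auto simp: ennreal_leI simp flip: ennreal_mult')
          then show ?thesis using 2 by (simp add: mult_ac)
        qed simp
      qed
      also have "\<dots> = ennreal C2 * (\<integral>\<^sup>+x\<in>{0<..<1}. ?f x \<partial>lborel) + ennreal (9 * 2 powr (w + e)) * g 1 * (\<integral>\<^sup>+x\<in>{1..<2}. ennreal ((2 - x) powr (w - 1)) \<partial>lborel)"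
        by (simp add: nn_integral_add nn_integral_cmult)
      also have "(\<integral>\<^sup>+x\<in>{1..<2}. ennreal ((2 - x) powr (w - 1)) \<partial>lborel) = (\<integral>\<^sup>+x. ennreal (x powr (w - 1)) * indicator {0..1} x \<partial>lborel)"
        by (subst nn_integral_real_affine[where c="-1" and t=2]) (auto intro!: nn_integral_cong split: split_indicator)
      also have "\<dots> = ennreal (1 / w)"
      proof (intro nn_integral_has_integral_lebesgue')
        show "((\<lambda>x. x powr (w - 1)) has_integral (1 / w)) {0..1}"
          using has_integral_powr_from_0[of "w - 1" 1] w by simp
      qed auto
      also have "ennreal (9 * 2 powr (w + e)) * g 1 * ennreal (1 / w) = ennreal C3 * (g 1 * ennreal (1 / (w + e)))"
      proof -
        have "ennreal C3 * (g 1 * ennreal (1 / (w + e))) = ennreal C3 * ennreal (1 / (w + e)) * g 1" by (simp only: mult_ac)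
        also have "ennreal C3 * ennreal (1 / (w + e)) = ennreal (9 * 2 powr (w + e) * (1 / w))"
          using we w by (simp add: C3_def flip: ennreal_mult')
        also have "\<dots> = ennreal (9 * 2 powr (w + e)) * ennreal (1 / w)" using w by (subst ennreal_mult') auto
        finally show ?thesis by (simp only: mult_ac)
      qed
      also have "g 1 * ennreal (1 / (w + e)) \<le> (\<integral>\<^sup>+x\<in>{0<..<1}. ?f x \<partial>lborel)"
      proof -
        have "g 1 * ennreal (1 / (w + e)) = g 1 * (\<integral>\<^sup>+x\<in>{0<..<1}. ennreal (x powr (w + e - 1)) \<partial>lborel)"
          using nn_integral_powr_interval[OF we, of 1] by simp
        also have "\<dots> = (\<integral>\<^sup>+x. g 1 * (ennreal (x powr (w + e - 1)) * indicator {0<..<1} x) \<partial>lborel)"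
          by (intro nn_integral_cmult[symmetric]) measurable
        also have "\<dots> \<le> (\<integral>\<^sup>+x\<in>{0<..<1}. ?f x \<partial>lborel)"
          using mono by (intro nn_integral_mono) (auto split: split_indicator simp: mult.commute[of "g 1"] intro!: mult_left_mono)
        finally show ?thesis .
      qed
      also have "ennreal C2 * (\<integral>\<^sup>+x\<in>{0<..<1}. ?f x \<partial>lborel) + ennreal C3 * (\<integral>\<^sup>+x\<in>{0<..<1}. ?f x \<partial>lborel)
          \<le> ennreal (C2 + \<bar>C3\<bar>) * (\<integral>\<^sup>+x\<in>{0<..<1}. ?f x \<partial>lborel)"
      proof -
        have "C3 \<ge> 0" using we w by (simp add: C3_def)
        then show ?thesis using C2 by (simp add: ennreal_plus[symmetric] distrib_right[symmetric] del: ennreal_plus)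
      qed
      also have "\<dots> \<le> ennreal (C2 + \<bar>C3\<bar>) * (\<integral>\<^sup>+x\<in>{0<..<2}. ?f x \<partial>lborel)"
        by (intro mult_left_mono nn_integral_mono) (auto split: split_indicator)
      finally show ?thesis unfolding J using p by (simp add: add_left_mono mult_left_mono)
    qed
    moreover have "ennreal (C1 * 2 powr p) * ?J \<le> ennreal (?C * 2 powr p) * ?J" "ennreal ((C2 + \<bar>C3\<bar>) * 2 powr p) * ?J \<le> ennreal (?C * 2 powr p) * ?J"
      using C1 C2 by (auto intro!: mult_right_mono ennreal_leI)
    ultimately show "?L \<le> ennreal (?C * 2 powr p) * ?J" by (meson order_trans)
  qed
qed

text \<open>The Dirichlet integral is applied to p + e and q + f, with \<kappa> = 1 + m - e - f
  chosen so that the total exponent is still N + m. The shifted Gamma values become powers of 1 + p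
  and 1 + q, and Gamma(N + m) = N^m Gamma(N) supplies the gain 1 / N that later balances a
  derivative of the power.\<close>

lemma weighted_kernel_integral_bound:
  fixes w1 w2 e f K :: real and m :: nat
  assumes w: "w1 > 0" "w2 > 0" and e: "\<bar>e\<bar> \<le> 1" and f: "\<bar>f\<bar> \<le> 1" and m: "m \<le> 1"
    and \<kappa>: "1 + real m - e - f > 0" and K: "K \<ge> 0"
  shows "\<exists>C>0. \<forall>p q A B D N. (p = 0 \<and> e \<ge> 0 \<or> p \<ge> 1) \<longrightarrow> (q = 0 \<and> f \<ge> 0 \<or> q \<ge> 1) \<longrightarrow> q \<le> K * (1 + p) \<longrightarrow>
    A > 0 \<longrightarrow> B > 0 \<longrightarrow> D > 0 \<longrightarrow> N = p + q + w1 + w2 + 1 \<longrightarrow>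
    (\<integral>\<^sup>+y\<in>{0<..<2}. ennreal (jacobi_weight (q + w2) y * (1 + (1 + q) * y)\<^sup>2 * y powr f) *
       (\<integral>\<^sup>+x\<in>{0<..<2}. ennreal (jacobi_weight (p + w1) x * (1 + (1 + p) * x)\<^sup>2 * x powr e) *
          ennreal ((D + B * y + A * x) powr (- (N + real m))) \<partial>lborel) \<partial>lborel)
     \<le> ennreal (C * (2 powr (p + q) * (Gamma (p + w1) * Gamma (q + w2) / (N ^ m * Gamma N))
          * ((1 + p) powr e * (1 + q) powr f) * A powr (- (p + e)) * B powr (- (q + f))
          * (D + A) powr (- w1) * (D + B) powr (- w2) * D powr (- (1 + real m - e - f))))"
proof -
  obtain Cx where Cx: "Cx > 0" "\<And>p g. (p = 0 \<and> e \<ge> 0 \<or> p \<ge> 1) \<Longrightarrow> g \<in> borel_measurable borel \<Longrightarrow>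
     (\<And>x y. 0 < x \<Longrightarrow> x \<le> y \<Longrightarrow> y < 2 \<Longrightarrow> g y \<le> g x) \<Longrightarrow>
     (\<integral>\<^sup>+x\<in>{0<..<2}. ennreal (jacobi_weight (p + w1) x * (1 + (1 + p) * x)\<^sup>2 * x powr e) * g x \<partial>lborel)
     \<le> ennreal (Cx * 2 powr p) * (\<integral>\<^sup>+x\<in>{0<..<2}. ennreal (x powr (p + e + w1 - 1)) * g x \<partial>lborel)"
    using nn_integral_jacobi_weight_reduce[OF w(1), of e] by blast
  obtain Cy where Cy: "Cy > 0" "\<And>p g. (p = 0 \<and> f \<ge> 0 \<or> p \<ge> 1) \<Longrightarrow> g \<in> borel_measurable borel \<Longrightarrow>
     (\<And>x y. 0 < x \<Longrightarrow> x \<le> y \<Longrightarrow> y < 2 \<Longrightarrow> g y \<le> g x) \<Longrightarrow>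
     (\<integral>\<^sup>+x\<in>{0<..<2}. ennreal (jacobi_weight (p + w2) x * (1 + (1 + p) * x)\<^sup>2 * x powr f) * g x \<partial>lborel)
     \<le> ennreal (Cy * 2 powr p) * (\<integral>\<^sup>+x\<in>{0<..<2}. ennreal (x powr (p + f + w2 - 1)) * g x \<partial>lborel)"
    using nn_integral_jacobi_weight_reduce[OF w(2), of f] by blast
  \<comment> \<open>The enlarged constant 2K + 1 makes room for the shifts: q + f has to be compared
    with 1 + p + e.\<close>
  obtain Cd where Cd: "Cd > 0" "\<And>p q A B D. p \<ge> 0 \<Longrightarrow> q \<ge> 0 \<Longrightarrow> q \<le> (2 * K + 1) * (1 + p) \<Longrightarrow> A > 0 \<Longrightarrow> B > 0 \<Longrightarrow> D > 0 \<Longrightarrow>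
    (\<integral>\<^sup>+y\<in>{0<..<2}. ennreal (y powr (q + w2 - 1)) *
       (\<integral>\<^sup>+x\<in>{0<..<2}. ennreal (x powr (p + w1 - 1) * (D + B * y + A * x) powr (- (p + q + w1 + w2 + (1 + real m - e - f)))) \<partial>lborel) \<partial>lborel)
     \<le> ennreal (Cd * (Gamma (p + w1) * Gamma (q + w2) / Gamma (p + q + w1 + w2 + (1 + real m - e - f))
          * A powr (- p) * B powr (- q) * (D + A) powr (- w1) * (D + B) powr (- w2) * D powr (- (1 + real m - e - f))))"
    using double_beta_integral[OF w \<kappa>, of "2 * K + 1"] K by auto
  obtain G1 where G1: "G1 > 0" "\<And>p. (p = 0 \<and> e \<ge> 0 \<or> p \<ge> 1) \<Longrightarrow> Gamma (p + e + w1) \<le> G1 * (1 + p) powr e * Gamma (p + w1)"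
    using Gamma_shift_bound[OF w(1) e] by blast
  obtain G2 where G2: "G2 > 0" "\<And>p. (p = 0 \<and> f \<ge> 0 \<or> p \<ge> 1) \<Longrightarrow> Gamma (p + f + w2) \<le> G2 * (1 + p) powr f * Gamma (p + w2)"
    using Gamma_shift_bound[OF w(2) f] by blast
  show ?thesis
  proof (intro exI[of _ "Cx * Cy * Cd * G1 * G2"] conjI allI impI)
    show "Cx * Cy * Cd * G1 * G2 > 0" using Cx Cy Cd G1 G2 by simp
    fix p q A B D N :: real
    assume p: "p = 0 \<and> e \<ge> 0 \<or> p \<ge> 1" and q: "q = 0 \<and> f \<ge> 0 \<or> q \<ge> 1" and qp: "q \<le> K * (1 + p)"
      and A: "A > 0" and B: "B > 0" and D: "D > 0" and N: "N = p + q + w1 + w2 + 1"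
    have p0: "p \<ge> 0" "p + e \<ge> 0" and q0: "q \<ge> 0" "q + f \<ge> 0" using p q e f by auto
    define T where "T = N + real m"
    have T: "T > 0" using p0 q0 w by (simp add: T_def N)
    define h where "h y = (\<integral>\<^sup>+x\<in>{0<..<2}. ennreal (x powr (p + e + w1 - 1)) * ennreal ((D + B * y + A * x) powr (- T)) \<partial>lborel)" for y
    have h_meas [measurable]: "h \<in> borel_measurable borel" unfolding h_def by measurable
    have inner: "(\<integral>\<^sup>+x\<in>{0<..<2}. ennreal (jacobi_weight (p + w1) x * (1 + (1 + p) * x)\<^sup>2 * x powr e) *
          ennreal ((D + B * y + A * x) powr (- T)) \<partial>lborel) \<le> ennreal (Cx * 2 powr p) * h y" if y: "y > 0" for y
      unfolding h_def
    proof (rule Cx(2)[OF p])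
      fix x x' :: real assume "0 < x" "x \<le> x'" "x' < 2"
      then show "ennreal ((D + B * y + A * x') powr (- T)) \<le> ennreal ((D + B * y + A * x) powr (- T))"
        using A B D y T by (intro ennreal_leI powr_mono2') (auto intro!: add_pos_pos)
    qed measurable
    \<comment> \<open>Monotonicity in y of the inner integral is what allows the weight reduction to
      be used a second time.\<close>
    have h_anti: "h y' \<le> h y" if "0 < y" "y \<le> y'" for y y'
      unfolding h_def
    proof (intro nn_integral_mono)
      fix x :: real
      have "(D + B * y' + A * x) powr (- T) \<le> (D + B * y + A * x) powr (- T)" if "0 < x"
        using that \<open>0 < y\<close> \<open>y \<le> y'\<close> A B D T by (intro powr_mono2') (auto intro!: add_pos_pos)
      then show "ennreal (x powr (p + e + w1 - 1)) * ennreal ((D + B * y' + A * x) powr - T) * indicator {0<..<2} x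
         \<le> ennreal (x powr (p + e + w1 - 1)) * ennreal ((D + B * y + A * x) powr - T) * indicator {0<..<2} x"
        by (auto split: split_indicator intro!: mult_left_mono ennreal_leI)
    qed
    let ?W = "\<lambda>y. ennreal (jacobi_weight (q + w2) y * (1 + (1 + q) * y)\<^sup>2 * y powr f)"
    have "(\<integral>\<^sup>+y\<in>{0<..<2}. ?W y * (\<integral>\<^sup>+x\<in>{0<..<2}. ennreal (jacobi_weight (p + w1) x * (1 + (1 + p) * x)\<^sup>2 * x powr e) *
          ennreal ((D + B * y + A * x) powr (- T)) \<partial>lborel) \<partial>lborel)
      \<le> (\<integral>\<^sup>+y. ennreal (Cx * 2 powr p) * (?W y * h y * indicator {0<..<2} y) \<partial>lborel)"
    proof (intro nn_integral_mono)
      fix y :: real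
      show "?W y * (\<integral>\<^sup>+x\<in>{0<..<2}. ennreal (jacobi_weight (p + w1) x * (1 + (1 + p) * x)\<^sup>2 * x powr e) *
          ennreal ((D + B * y + A * x) powr (- T)) \<partial>lborel) * indicator {0<..<2} y
          \<le> ennreal (Cx * 2 powr p) * (?W y * h y * indicator {0<..<2} y)"
        using mult_left_mono[OF inner[of y], of "?W y"] by (auto split: split_indicator simp: mult.left_commute)
    qed
    also have "\<dots> = ennreal (Cx * 2 powr p) * (\<integral>\<^sup>+y\<in>{0<..<2}. ?W y * h y \<partial>lborel)"
      by (intro nn_integral_cmult) measurable
    also have "\<dots> \<le> ennreal (Cx * 2 powr p) * (ennreal (Cy * 2 powr q) * (\<integral>\<^sup>+y\<in>{0<..<2}. ennreal (y powr (q + f + w2 - 1)) * h y \<partial>lborel))"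
      by (intro mult_left_mono Cy(2)[OF q]) (auto intro: h_anti)
    also have "(\<integral>\<^sup>+y\<in>{0<..<2}. ennreal (y powr (q + f + w2 - 1)) * h y \<partial>lborel)
      = (\<integral>\<^sup>+y\<in>{0<..<2}. ennreal (y powr (q + f + w2 - 1)) *
       (\<integral>\<^sup>+x\<in>{0<..<2}. ennreal (x powr (p + e + w1 - 1) * (D + B * y + A * x) powr (- (p + e + (q + f) + w1 + w2 + (1 + real m - e - f)))) \<partial>lborel) \<partial>lborel)"
    proof -
      have "p + e + (q + f) + w1 + w2 + (1 + real m - e - f) = T" by (simp add: T_def N)
      then show ?thesis unfolding h_def by (simp only: ennreal_mult' powr_ge_zero)
    qed
    also have "\<dots> \<le> ennreal (Cd * (Gamma (p + e + w1) * Gamma (q + f + w2) / Gamma (p + e + (q + f) + w1 + w2 + (1 + real m - e - f))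
          * A powr (- (p + e)) * B powr (- (q + f)) * (D + A) powr (- w1) * (D + B) powr (- w2) * D powr (- (1 + real m - e - f))))" (is "?I \<le> ennreal ?Z")
    proof (rule Cd(2))
      have "q + f \<le> K * (1 + p) + 1" using qp f by simp
      also have "\<dots> \<le> K * (2 + (p + e)) + 1" using K e by (intro add_right_mono mult_left_mono) auto
      also have "\<dots> \<le> (2 * K + 1) * (1 + (p + e))"
      proof -
        have "0 \<le> K * (p + e)" using K p0 by simp
        then show ?thesis using p0(2) by (simp add: algebra_simps)
      qed
      finally show "q + f \<le> (2 * K + 1) * (1 + (p + e))" .
    qed (use p0 q0 A B D in auto)
    then have "ennreal (Cx * 2 powr p) * (ennreal (Cy * 2 powr q) * ?I) \<le> ennreal (Cx * 2 powr p) * (ennreal (Cy * 2 powr q) * ennreal ?Z)"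
      by (intro mult_left_mono) auto
    also have "\<dots> = ennreal (Cx * 2 powr p * (Cy * 2 powr q * ?Z))"
    proof -
      have "0 \<le> Cx * 2 powr p" "0 \<le> Cy * 2 powr q" using Cx(1) Cy(1) by simp_all
      then show ?thesis by (simp only: ennreal_mult'[symmetric])
    qed
    also have "\<dots> \<le> ennreal (Cx * Cy * Cd * G1 * G2 * (2 powr (p + q) * (Gamma (p + w1) * Gamma (q + w2) / (N ^ m * Gamma N))
          * ((1 + p) powr e * (1 + q) powr f) * A powr (- (p + e)) * B powr (- (q + f))
          * (D + A) powr (- w1) * (D + B) powr (- w2) * D powr (- (1 + real m - e - f))))"
    proof (intro ennreal_leI)
      let ?P = "A powr (- (p + e)) * B powr (- (q + f)) * (D + A) powr (- w1) * (D + B) powr (- w2) * D powr (- (1 + real m - e - f))"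
      have Npos: "N > 0" using p0 q0 w by (simp add: N)
      have "p + e + (q + f) + w1 + w2 + (1 + real m - e - f) = N + real m" by (simp add: N)
      moreover have "Gamma (N + real m) = N ^ m * Gamma N"
        using m Gamma_real_plus1[OF Npos] by (cases m) auto
      ultimately have GT: "Gamma (p + e + (q + f) + w1 + w2 + (1 + real m - e - f)) = N ^ m * Gamma N" by (simp only:)
      have GTpos: "N ^ m * Gamma N > 0" using Npos by (simp add: Gamma_real_pos)
      have "Gamma (p + e + w1) * Gamma (q + f + w2) \<le> (G1 * (1 + p) powr e * Gamma (p + w1)) * (G2 * (1 + q) powr f * Gamma (q + w2))"
        using G1 G2 p q p0 q0 w by (intro mult_mono) (auto simp: Gamma_real_pos less_imp_le)
      then have "Gamma (p + e + w1) * Gamma (q + f + w2) / (N ^ m * Gamma N) \<le> (G1 * (1 + p) powr e * Gamma (p + w1)) * (G2 * (1 + q) powr f * Gamma (q + w2)) / (N ^ m * Gamma N)"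
        using GTpos by (intro divide_right_mono) auto
      then have "(Cx * Cy * Cd * 2 powr (p + q) * ?P) * (Gamma (p + e + w1) * Gamma (q + f + w2) / (N ^ m * Gamma N))
         \<le> (Cx * Cy * Cd * 2 powr (p + q) * ?P) * ((G1 * (1 + p) powr e * Gamma (p + w1)) * (G2 * (1 + q) powr f * Gamma (q + w2)) / (N ^ m * Gamma N))"
        using Cx Cy Cd by (intro mult_left_mono) auto
      then show "Cx * 2 powr p * (Cy * 2 powr q * ?Z) \<le> Cx * Cy * Cd * G1 * G2 * (2 powr (p + q) * (Gamma (p + w1) * Gamma (q + w2) / (N ^ m * Gamma N))
          * ((1 + p) powr e * (1 + q) powr f) * A powr (- (p + e)) * B powr (- (q + f))
          * (D + A) powr (- w1) * (D + B) powr (- w2) * D powr (- (1 + real m - e - f)))"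
        unfolding GT powr_add[of 2 p q] by (simp only: times_divide_eq_left times_divide_eq_right mult_ac)
    qed
    finally show "(\<integral>\<^sup>+y\<in>{0<..<2}. ?W y * (\<integral>\<^sup>+x\<in>{0<..<2}. ennreal (jacobi_weight (p + w1) x * (1 + (1 + p) * x)\<^sup>2 * x powr e) *
          ennreal ((D + B * y + A * x) powr (- (N + real m))) \<partial>lborel) \<partial>lborel)
     \<le> ennreal (Cx * Cy * Cd * G1 * G2 * (2 powr (p + q) * (Gamma (p + w1) * Gamma (q + w2) / (N ^ m * Gamma N))
          * ((1 + p) powr e * (1 + q) powr f) * A powr (- (p + e)) * B powr (- (q + f))
          * (D + A) powr (- w1) * (D + B) powr (- w2) * D powr (- (1 + real m - e - f))))"
      unfolding T_def .
  qed
qed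

section \<open>The product formula\<close>

text \<open>A density on the whole line, so that products and continuous functions can be treated
  with the ordinary Borel sets; the interval is recovered almost everywhere.\<close>

definition jacobi_interval :: "real \<Rightarrow> real measure" where
  "jacobi_interval a = density lborel (\<lambda>x. ennreal (jacobi_weight a x * indicator {0<..<2} x))"

lemma sets_jacobi_interval [measurable_cong, simp]: "sets (jacobi_interval a) = sets borel"
  and space_jacobi_interval [simp]: "space (jacobi_interval a) = UNIV"
  by (simp_all add: jacobi_interval_def)

lemma AE_jacobi_interval: "AE x in jacobi_interval a. x \<in> {0<..<2}"
  unfolding jacobi_interval_def by (subst AE_density) (auto split: split_indicator)

lemma nn_integral_jacobi_interval:
  assumes [measurable]: "g \<in> borel_measurable borel"
  shows "(\<integral>\<^sup>+x. g x \<partial>jacobi_interval a) = (\<integral>\<^sup>+x\<in>{0<..<2}. ennreal (jacobi_weight a x) * g x \<partial>lborel)"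
  unfolding jacobi_interval_def
  by (subst nn_integral_density) (auto intro!: nn_integral_cong split: split_indicator)

text \<open>The substitution t = u^2 turns the Beta integral into two copies of an integral over 0 <
  u \<le> 1. One copy is carried to the left of x = 1 by x = 1 - u, the other to the right by x = 1
  + u; the point x = 1 itself is a null set.\<close>

lemma nn_integral_even_moment:
  assumes a: "a > 0"
  shows "(\<integral>\<^sup>+x. ennreal ((1 - x) ^ (2 * i)) \<partial>jacobi_interval a) = ennreal (Beta (real i + 1 / 2) a)"
proof -
  let ?f = "\<lambda>t::real. t powr (real i - 1 / 2) * (1 - t) powr (a - 1)"
  let ?h = "\<lambda>u::real. (1 - u\<^sup>2) powr (a - 1) * u ^ (2 * i)"
  have "((\<lambda>t. ?f t) has_integral Beta (real i + 1/2) a) {0..1}"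
    using has_integral_Beta_real[of "real i + 1/2" a] a by simp
  then have "ennreal (Beta (real i + 1/2) a) = (\<integral>\<^sup>+t. ennreal (?f t) * indicator {0..1} t \<partial>lborel)"
    by (intro nn_integral_has_integral_lebesgue'[symmetric]) auto
  also have "\<dots> = (\<integral>\<^sup>+t. ennreal (?f t * indicator {0\<^sup>2..1\<^sup>2} t) \<partial>lborel)"
    by (intro nn_integral_cong) (auto split: split_indicator)
  also have "\<dots> = (\<integral>\<^sup>+u. ennreal (?f (u\<^sup>2) * (2 * u) * indicator {0..1} u) \<partial>lborel)"
    by (subst nn_integral_substitution[where g = "\<lambda>x. x\<^sup>2" and g' = "\<lambda>x. 2 * x"])
       (auto intro!: derivative_eq_intros continuous_intros simp: set_borel_measurable_def)
  also have "\<dots> = (\<integral>\<^sup>+u. ennreal (?h u) * indicator {0<..1} u + ennreal (?h u) * indicator {0<..1} u \<partial>lborel)"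
  proof (intro nn_integral_cong)
    fix u :: real
    show "ennreal (?f (u\<^sup>2) * (2 * u) * indicator {0..1} u) = ennreal (?h u) * indicator {0<..1} u + ennreal (?h u) * indicator {0<..1} u"
    proof (cases "0 < u \<and> u \<le> 1")
      case True
      have "(u\<^sup>2) powr (real i - 1/2) * u = u ^ (2 * i)"
      proof -
        have "(u\<^sup>2) powr (real i - 1/2) = (u powr 2) powr (real i - 1/2)" using True by (simp add: powr_numeral)
        also have "\<dots> = u powr (2 * (real i - 1/2))" by (rule powr_powr)
        finally have "(u\<^sup>2) powr (real i - 1/2) * u = u powr (2 * (real i - 1/2)) * u powr 1" using True by simp
        also have "\<dots> = u powr (2 * (real i - 1/2) + 1)" by (rule powr_add[symmetric])
        also have "\<dots> = u powr (real (2 * i))" by (simp add: algebra_simps)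
        also have "\<dots> = u ^ (2 * i)" using True by (subst powr_realpow) auto
        finally show ?thesis .
      qed
      then have "?f (u\<^sup>2) * (2 * u) = ?h u + ?h u" by (simp add: mult_ac)
      then show ?thesis using True by (simp add: ennreal_plus[symmetric] del: ennreal_plus)
    next
      case False
      then show ?thesis by (cases "u = 0") (auto split: split_indicator)
    qed
  qed
  also have "\<dots> = (\<integral>\<^sup>+u. ennreal (?h u) * indicator {0<..1} u \<partial>lborel) + (\<integral>\<^sup>+u. ennreal (?h u) * indicator {0<..1} u \<partial>lborel)"
    by (intro nn_integral_add) measurable
  finally have split: "ennreal (Beta (real i + 1/2) a) = (\<integral>\<^sup>+u. ennreal (?h u) * indicator {0<..1} u \<partial>lborel) + (\<integral>\<^sup>+u. ennreal (?h u) * indicator {0<..1} u \<partial>lborel)" .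
  have half1: "(\<integral>\<^sup>+u. ennreal (?h u) * indicator {0<..1} u \<partial>lborel) = (\<integral>\<^sup>+x. ennreal (jacobi_weight a x * (1 - x) ^ (2 * i)) * indicator {0..<1} x \<partial>lborel)"
    by (subst nn_integral_real_affine[where c="-1" and t=1])
       (auto intro!: nn_integral_cong simp: jacobi_weight_def power2_eq_square algebra_simps split: split_indicator)
  have half2: "(\<integral>\<^sup>+u. ennreal (?h u) * indicator {0<..1} u \<partial>lborel) = (\<integral>\<^sup>+x. ennreal (jacobi_weight a x * (1 - x) ^ (2 * i)) * indicator {1<..2} x \<partial>lborel)"
  proof (subst nn_integral_real_affine[where c="1" and t="-1"])
    have h1: "1 - (- 1 + 1 * x)\<^sup>2 = x * (2 - x)" for x :: real
      by (simp add: algebra_simps power2_eq_square)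
    have h2: "(- 1 + 1 * x) ^ (2 * i) = (1 - x) ^ (2 * i)" for x :: real
      unfolding power_mult by (rule arg_cong[where f="\<lambda>y. y ^ i"]) (simp add: power2_eq_square algebra_simps)
    from h1 h2 show "ennreal \<bar>1\<bar> * (\<integral>\<^sup>+x. ennreal (?h (- 1 + 1 * x)) * indicator {0<..1} (- 1 + 1 * x) \<partial>lborel) = (\<integral>\<^sup>+x. ennreal (jacobi_weight a x * (1 - x) ^ (2 * i)) * indicator {1<..2} x \<partial>lborel)"
      by (auto intro!: nn_integral_cong simp: jacobi_weight_def split: split_indicator)
  qed auto
  note split
  also have "(\<integral>\<^sup>+u. ennreal (?h u) * indicator {0<..1} u \<partial>lborel) + (\<integral>\<^sup>+u. ennreal (?h u) * indicator {0<..1} u \<partial>lborel)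
    = (\<integral>\<^sup>+x. ennreal (jacobi_weight a x * (1 - x) ^ (2 * i)) * indicator {0..<1} x \<partial>lborel) + (\<integral>\<^sup>+x. ennreal (jacobi_weight a x * (1 - x) ^ (2 * i)) * indicator {1<..2} x \<partial>lborel)"
    by (rule arg_cong2[where f="(+)", OF half1 half2])
  also have "\<dots> = (\<integral>\<^sup>+x. ennreal (jacobi_weight a x * (1 - x) ^ (2 * i)) * indicator {0..<1} x + ennreal (jacobi_weight a x * (1 - x) ^ (2 * i)) * indicator {1<..2} x \<partial>lborel)"
    by (intro nn_integral_add[symmetric]) measurable
  also have "\<dots> = (\<integral>\<^sup>+x\<in>{0<..<2}. ennreal (jacobi_weight a x) * ennreal ((1 - x) ^ (2 * i)) \<partial>lborel)"
  proof (intro nn_integral_cong_AE)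
    have "AE x in lborel. x \<noteq> (1::real)" using AE_lborel_singleton[of 1] .
    then show "AE x in lborel. ennreal (jacobi_weight a x * (1 - x) ^ (2 * i)) * indicator {0..<1} x + ennreal (jacobi_weight a x * (1 - x) ^ (2 * i)) * indicator {1<..2} x
       = ennreal (jacobi_weight a x) * ennreal ((1 - x) ^ (2 * i)) * indicator {0<..<2} x"
    proof eventually_elim
      case (elim x)
      then show ?case
        by (cases "x = 0"; cases "x = 2") (auto split: split_indicator simp: jacobi_weight_def ennreal_mult')
    qed
  qed
  also have "\<dots> = (\<integral>\<^sup>+x. ennreal ((1 - x) ^ (2 * i)) \<partial>jacobi_interval a)"
    by (simp add: nn_integral_jacobi_interval)
  finally show ?thesis ..
qed

lemma finite_measure_jacobi_interval: "a > 0 \<Longrightarrow> finite_measure (jacobi_interval a)"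
  using nn_integral_even_moment[of a 0] by (intro finite_measureI) simp

lemma even_moment:
  assumes a: "a > 0"
  shows "(\<integral>x. (1 - x) ^ (2 * i) \<partial>jacobi_interval a) = Beta (1 / 2) a * (pochhammer (1 / 2) i / pochhammer (a + 1 / 2) i)"
proof -
  have "(\<integral>x. (1 - x) ^ (2 * i) \<partial>jacobi_interval a) = Beta (real i + 1 / 2) a"
    using nn_integral_even_moment[OF a, of i] Beta_pos_real[of "real i + 1 / 2" a] a
    by (intro integral_eq_nn_integral[THEN trans]) auto
  also have "\<dots> = Beta (1 / 2) a * (pochhammer (1 / 2) i / pochhammer (a + 1 / 2) i)"
  proof -
    have n: "(1/2 :: real) \<notin> \<int>\<^sub>\<le>\<^sub>0" "a + 1/2 \<notin> \<int>\<^sub>\<le>\<^sub>0" using a by (auto elim!: nonpos_Ints_cases')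
    show ?thesis unfolding Beta_def pochhammer_Gamma[OF n(1)] pochhammer_Gamma[OF n(2)]
      using a Gamma_pos_nz[of "a + 1/2"] Gamma_pos_nz[of "1/2"] by (simp add: add_ac field_simps)
  qed
  finally show ?thesis .
qed

text \<open>The reflection x to 2 - x preserves the weight and changes the sign of the
  integrand.\<close>

lemma odd_moment: "(\<integral>x. (1 - x) ^ (2 * i + 1) \<partial>jacobi_interval a) = 0"
proof -
  let ?F = "\<lambda>x. (jacobi_weight a x * indicator {0<..<2} x) *\<^sub>R ((1 - x) ^ (2 * i + 1) :: real)"
  have F: "?F (2 + (- 1) * x) = - ?F x" for x
  proof -
    have "(x - 1) ^ (2 * i + 1) = - ((1 - x) ^ (2 * i + 1))"
      using power_minus_odd[of "2 * i + 1" "1 - x"] by simp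
    moreover have "indicator {0<..<2} (2 - x) = (indicator {0<..<2} x :: real)"
      by (auto split: split_indicator)
    moreover have "jacobi_weight a (2 - x) = jacobi_weight a x" by (simp add: jacobi_weight_def mult.commute)
    moreover have "2 + (-1) * x = 2 - x" "1 - (2 - x) = x - 1" by simp_all
    ultimately show ?thesis by simp
  qed
  have "(\<integral>x. ?F x \<partial>lborel) = \<bar>-1\<bar> *\<^sub>R (\<integral>x. ?F (2 + (- 1) * x) \<partial>lborel)"
    by (rule lborel_integral_real_affine) simp
  also have "\<dots> = (\<integral>x. ?F (2 + (- 1) * x) \<partial>lborel)" by (simp only: abs_minus_cancel abs_one scaleR_one)
  also have "\<dots> = (\<integral>x. - ?F x \<partial>lborel)" by (intro Bochner_Integration.integral_cong refl F)
  also have "\<dots> = - (\<integral>x. ?F x \<partial>lborel)" by (rule Bochner_Integration.integral_minus)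
  finally have "(\<integral>x. ?F x \<partial>lborel) = 0" by linarith
  then show ?thesis unfolding jacobi_interval_def by (subst integral_density) auto
qed

section \<open>The product measure and the moments of z\<close>

definition jacobi_square :: "real \<Rightarrow> real \<Rightarrow> (real \<times> real) measure" where
  "jacobi_square a b = jacobi_interval a \<Otimes>\<^sub>M jacobi_interval b"

lemma sets_jacobi_square [measurable_cong, simp]: "sets (jacobi_square a b) = sets borel"
proof -
  have "sets (jacobi_square a b) = sets (borel \<Otimes>\<^sub>M borel :: (real \<times> real) measure)"
    unfolding jacobi_square_def by (rule sets_pair_measure_cong) auto
  then show ?thesis by (simp only: borel_prod)
qed

lemma borel_measurable_jacobi_square_continuous:
  "continuous_on UNIV f \<Longrightarrow> f \<in> borel_measurable (jacobi_square a b)"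
  using borel_measurable_continuous_onI by (simp add: measurable_cong_sets[OF sets_jacobi_square refl])

lemma space_jacobi_square [simp]: "space (jacobi_square a b) = UNIV"
  by (simp add: jacobi_square_def space_pair_measure)

lemma finite_measure_jacobi_square: "a > 0 \<Longrightarrow> b > 0 \<Longrightarrow> finite_measure (jacobi_square a b)"
  unfolding jacobi_square_def by (intro finite_measure_pair_measure finite_measure_jacobi_interval)

lemma pair_sigma_finite_jacobi: "a > 0 \<Longrightarrow> b > 0 \<Longrightarrow> pair_sigma_finite (jacobi_interval a) (jacobi_interval b)"
  using finite_measure_jacobi_interval by (auto simp: pair_sigma_finite_def finite_measure_def)

lemma AE_jacobi_square:
  assumes "a > 0" "b > 0"
  shows "AE w in jacobi_square a b. w \<in> {0<..<2} \<times> {0<..<2}"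
proof -
  interpret pair_sigma_finite "jacobi_interval a" "jacobi_interval b" by (rule pair_sigma_finite_jacobi[OF assms])
  show ?thesis unfolding jacobi_square_def
  proof (rule AE_pair_measure)
    show "{x \<in> space (jacobi_interval a \<Otimes>\<^sub>M jacobi_interval b). x \<in> {0<..<2} \<times> {0<..<2}} \<in> sets (jacobi_interval a \<Otimes>\<^sub>M jacobi_interval b)"
      by measurable
    show "AE x in jacobi_interval a. AE y in jacobi_interval b. (x, y) \<in> {0<..<2} \<times> {0<..<2}"
      using AE_jacobi_interval[of a] by eventually_elim (use AE_jacobi_interval[of b] in auto)
  qed
qed

lemma nn_integral_jacobi_square:
  assumes "a > 0" "b > 0" and g [measurable]: "g \<in> borel_measurable borel"
  shows "(\<integral>\<^sup>+w. g w \<partial>jacobi_square a b) =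
     (\<integral>\<^sup>+y\<in>{0<..<2}. ennreal (jacobi_weight b y) * (\<integral>\<^sup>+x\<in>{0<..<2}. ennreal (jacobi_weight a x) * g (x, y) \<partial>lborel) \<partial>lborel)"
proof -
  interpret pair_sigma_finite "jacobi_interval a" "jacobi_interval b" by (rule pair_sigma_finite_jacobi[OF assms(1,2)])
  have g' [measurable]: "g \<in> borel_measurable (borel \<Otimes>\<^sub>M borel)" using g by (simp add: borel_prod)
  have "g \<in> borel_measurable (jacobi_interval a \<Otimes>\<^sub>M jacobi_interval b)" by measurable
  from nn_integral_snd[OF this]
  have "(\<integral>\<^sup>+w. g w \<partial>jacobi_square a b) = (\<integral>\<^sup>+y. (\<integral>\<^sup>+x. g (x, y) \<partial>jacobi_interval a) \<partial>jacobi_interval b)"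
    by (simp add: jacobi_square_def)
  also have "\<dots> = (\<integral>\<^sup>+y. (\<integral>\<^sup>+x\<in>{0<..<2}. ennreal (jacobi_weight a x) * g (x, y) \<partial>lborel) \<partial>jacobi_interval b)"
    by (intro nn_integral_cong nn_integral_jacobi_interval) measurable
  also have "\<dots> = (\<integral>\<^sup>+y\<in>{0<..<2}. ennreal (jacobi_weight b y) * (\<integral>\<^sup>+x\<in>{0<..<2}. ennreal (jacobi_weight a x) * g (x, y) \<partial>lborel) \<partial>lborel)"
    by (intro nn_integral_jacobi_interval) measurable
  finally show ?thesis .
qed

lemma integrable_jacobi_square_product:
  assumes "a > 0" "b > 0"
  shows "integrable (jacobi_square a b) (\<lambda>w. (1 - fst w) ^ i * (1 - snd w) ^ k)"
proof -
  interpret finite_measure "jacobi_square a b" by (rule finite_measure_jacobi_square[OF assms])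
  show ?thesis
  proof (rule integrable_const_bound[where B=1])
    show "AE w in jacobi_square a b. norm ((1 - fst w) ^ i * (1 - snd w) ^ k) \<le> 1"
      using AE_jacobi_square[OF assms]
      by eventually_elim (auto simp: power_abs abs_mult intro!: mult_le_one power_le_one)
  qed (intro borel_measurable_jacobi_square_continuous continuous_intros)
qed

lemma integral_jacobi_square_product:
  assumes "a > 0" "b > 0"
  shows "(\<integral>w. (1 - fst w) ^ i * (1 - snd w) ^ k \<partial>jacobi_square a b)
    = (\<integral>x. (1 - x) ^ i \<partial>jacobi_interval a) * (\<integral>y. (1 - y) ^ k \<partial>jacobi_interval b)"
proof -
  interpret pair_sigma_finite "jacobi_interval a" "jacobi_interval b" by (rule pair_sigma_finite_jacobi[OF assms])
  have "(\<integral>w. (1 - fst w) ^ i * (1 - snd w) ^ k \<partial>jacobi_square a b)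
     = (\<integral>x. (\<integral>y. (1 - x) ^ i * (1 - y) ^ k \<partial>jacobi_interval b) \<partial>jacobi_interval a)"
    using integral_fst'[of "\<lambda>w. (1 - fst w) ^ i * (1 - snd w) ^ k"] integrable_jacobi_square_product[OF assms]
    by (simp add: jacobi_square_def)
  then show ?thesis by simp
qed

abbreviation jacobi_mass :: "real \<Rightarrow> real \<Rightarrow> real" where
  "jacobi_mass a b \<equiv> Beta (1 / 2) a * Beta (1 / 2) b"

lemma sum_even_only:
  fixes f :: "nat \<Rightarrow> real"
  assumes "\<And>k. odd k \<Longrightarrow> f k = 0"
  shows "(\<Sum>k\<le>2 * m. f k) = (\<Sum>i\<le>m. f (2 * i))"
  by (induction m) (use assms in auto)

definition jacobi_z :: "real \<Rightarrow> real \<Rightarrow> real \<times> real \<Rightarrow> real" where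
  "jacobi_z A B w = A * (1 - fst w) + B * (1 - snd w)"

lemma jacobi_z_measurable [measurable]: "jacobi_z A B \<in> borel_measurable borel"
  unfolding jacobi_z_def by (intro borel_measurable_continuous_onI continuous_intros)

lemma jacobi_z_power: "jacobi_z A B w ^ n = (\<Sum>k\<le>n. (of_nat (n choose k) * A ^ k * B ^ (n - k)) * ((1 - fst w) ^ k * (1 - snd w) ^ (n - k)))"
  unfolding jacobi_z_def binomial_ring by (simp add: power_mult_distrib mult_ac)

lemma integrable_jacobi_z_power:
  assumes "a > 0" "b > 0"
  shows "integrable (jacobi_square a b) (\<lambda>w. jacobi_z A B w ^ n)"
  unfolding jacobi_z_power by (intro Bochner_Integration.integrable_sum integrable_mult_right integrable_jacobi_square_product assms)

lemma integral_jacobi_z_power: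
  assumes "a > 0" "b > 0"
  shows "(\<integral>w. jacobi_z A B w ^ n \<partial>jacobi_square a b) =
     (\<Sum>k\<le>n. (of_nat (n choose k) * A ^ k * B ^ (n - k)) * ((\<integral>x. (1 - x) ^ k \<partial>jacobi_interval a) * (\<integral>y. (1 - y) ^ (n - k) \<partial>jacobi_interval b)))"
  unfolding jacobi_z_power
  by (subst Bochner_Integration.integral_sum)
     (auto intro!: integrable_mult_right integrable_jacobi_square_product assms simp: integral_jacobi_square_product[OF assms])

lemma odd_moment': "odd k \<Longrightarrow> (\<integral>x. (1 - x) ^ k \<partial>jacobi_interval a) = 0"
  using odd_moment by (metis oddE)

lemma integral_jacobi_z_odd_power:
  assumes "a > 0" "b > 0" "odd n"
  shows "(\<integral>w. jacobi_z A B w ^ n \<partial>jacobi_square a b) = 0"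
  unfolding integral_jacobi_z_power[OF assms(1,2)]
proof (intro sum.neutral ballI)
  fix k assume "k \<in> {..n}"
  then have "odd k \<or> odd (n - k)" using assms(3) by auto
  then show "(of_nat (n choose k) * A ^ k * B ^ (n - k)) * ((\<integral>x. (1 - x) ^ k \<partial>jacobi_interval a) * (\<integral>y. (1 - y) ^ (n - k) \<partial>jacobi_interval b)) = 0"
    using odd_moment'[of k a] odd_moment'[of "n - k" b] by (elim disjE) (simp_all del: even_diff_nat)
qed

text \<open>By (2k)! = 4^k (1/2)_k k!, the Pochhammer symbols of 1/2 in the moments cancel against
  the binomial coefficient. Those of a + 1/2 and b + 1/2 remain; for a = \<alpha> + 1/2 and b =
  \<beta> + 1/2 they are the denominators in Bailey's coefficients.\<close>

lemma integral_jacobi_z_even_power: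
  assumes a: "a > 0" and b: "b > 0"
  shows "(\<integral>w. jacobi_z A B w ^ (2 * m) \<partial>jacobi_square a b) = jacobi_mass a b * (fact (2 * m) / 4 ^ m) *
     (\<Sum>i\<le>m. (A\<^sup>2) ^ i * (B\<^sup>2) ^ (m - i) / (fact i * fact (m - i) * pochhammer (a + 1 / 2) i * pochhammer (b + 1 / 2) (m - i)))"
proof -
  let ?t = "\<lambda>k. (of_nat ((2 * m) choose k) * A ^ k * B ^ (2 * m - k)) * ((\<integral>x. (1 - x) ^ k \<partial>jacobi_interval a) * (\<integral>y. (1 - y) ^ (2 * m - k) \<partial>jacobi_interval b))"
  have "(\<integral>w. jacobi_z A B w ^ (2 * m) \<partial>jacobi_square a b) = (\<Sum>k\<le>2 * m. ?t k)"
    by (rule integral_jacobi_z_power[OF a b])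
  also have "\<dots> = (\<Sum>i\<le>m. ?t (2 * i))" by (rule sum_even_only) (simp add: odd_moment')
  also have "\<dots> = (\<Sum>i\<le>m. jacobi_mass a b * (fact (2 * m) / 4 ^ m) * ((A\<^sup>2) ^ i * (B\<^sup>2) ^ (m - i) / (fact i * fact (m - i) * pochhammer (a + 1 / 2) i * pochhammer (b + 1 / 2) (m - i))))"
  proof (rule sum.cong[OF refl])
    fix i assume "i \<in> {..m}"
    then obtain l where m: "m = i + l" by (metis atMost_iff le_add_diff_inverse)
    have ch: "real ((2 * m) choose (2 * i)) = fact (2 * m) / (fact (2 * i) * fact (2 * l))"
      using binomial_fact[of "2 * i" "2 * m"] m by (simp add: algebra_simps)
    have d: "fact (2 * k) = 4 ^ k * pochhammer (1/2) k * (fact k :: real)" for k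
      by (simp add: fact_double power_mult)
    have pos: "pochhammer (1/2) k > (0::real)" for k by (rule pochhammer_pos) simp
    have e: "2 * m - 2 * i = 2 * l" "m - i = l" using m by auto
    have ch': "real ((2 * m) choose (2 * i)) = fact (2 * m) / 4 ^ m / (pochhammer (1/2) i * fact i * (pochhammer (1/2) l * fact l))"
    proof -
      have "(4::real) ^ m = 4 ^ i * 4 ^ l" unfolding m power_add ..
      then show ?thesis unfolding ch d[of i] d[of l] by (simp add: mult_ac)
    qed
    show "?t (2 * i) = jacobi_mass a b * (fact (2 * m) / 4 ^ m) * ((A\<^sup>2) ^ i * (B\<^sup>2) ^ (m - i) / (fact i * fact (m - i) * pochhammer (a + 1 / 2) i * pochhammer (b + 1 / 2) (m - i)))"
      unfolding e even_moment[OF a] even_moment[OF b] ch' using pos[of i] pos[of l]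
      by (simp add: power_mult[symmetric] del: power_mult) (simp add: divide_simps power_mult)
  qed
  finally show ?thesis by (simp only: sum_distrib_left)
qed

section \<open>Averages of Gegenbauer polynomials\<close>

lemma gegenbauer_measurable [measurable]: "gegenbauer l m \<in> borel_measurable borel"
  unfolding gegenbauer_def by measurable

text \<open>Every power that occurs has exponent 2n - m, which is odd along with m; where this
  subtraction truncates, the binomial coefficient is zero.\<close>

lemma integral_gegenbauer_odd:
  assumes "a > 0" "b > 0" "odd m"
  shows "(\<integral>w. gegenbauer l m (jacobi_z A B w) \<partial>jacobi_square a b) = 0"
proof -
  have "(\<integral>w. gegenbauer l m (jacobi_z A B w) \<partial>jacobi_square a b)
     = (\<Sum>n\<le>m. (\<integral>w. (pochhammer l n / fact n * of_nat (n choose (m - n)) * (- 1) ^ (m - n) * 2 ^ (n - (m - n))) * jacobi_z A B w ^ (n - (m - n)) \<partial>jacobi_square a b))"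
    unfolding gegenbauer_def power_mult_distrib
    by (subst Bochner_Integration.integral_sum[symmetric])
       (auto intro!: integrable_mult_right integrable_jacobi_z_power assms simp: mult_ac)
  also have "\<dots> = 0"
  proof (intro sum.neutral ballI)
    fix n assume n: "n \<in> {..m}"
    show "(\<integral>w. (pochhammer l n / fact n * of_nat (n choose (m - n)) * (- 1) ^ (m - n) * 2 ^ (n - (m - n))) * jacobi_z A B w ^ (n - (m - n)) \<partial>jacobi_square a b) = 0"
    proof (cases "m - n \<le> n")
      case True
      then have "odd (n - (m - n))" using n assms(3) by (auto simp: even_diff_nat)
      then show ?thesis using assms by (simp add: integral_jacobi_z_odd_power)
    qed (simp add: binomial_eq_0)
  qed
  finally show ?thesis .
qed

text \<open>The index N = n + m carries the power z^(2m), whose average is the homogeneous part i +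
  l = m of the Bailey sum. Combined with Bailey's expansion this is the product formula for Jacobi
  polynomials.\<close>

lemma integral_gegenbauer_even:
  fixes \<alpha> \<beta> :: real
  assumes a: "\<alpha> > - 1 / 2" and b: "\<beta> > - 1 / 2"
  shows "(\<integral>w. gegenbauer (\<alpha> + \<beta> + 1) (2 * n) (jacobi_z A B w) \<partial>jacobi_square (\<alpha> + 1 / 2) (\<beta> + 1 / 2))
    = jacobi_mass (\<alpha> + 1 / 2) (\<beta> + 1 / 2) * bailey_sum \<alpha> \<beta> n (A\<^sup>2) (B\<^sup>2)"
proof -
  let ?l = "\<alpha> + \<beta> + 1" let ?M = "jacobi_square (\<alpha> + 1 / 2) (\<beta> + 1 / 2)" let ?B = "jacobi_mass (\<alpha> + 1 / 2) (\<beta> + 1 / 2)"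
  have ab: "\<alpha> + 1/2 > 0" "\<beta> + 1/2 > 0" using a b by auto
  define c where "c N = pochhammer ?l N / fact N * of_nat (N choose (2 * n - N)) * (- 1) ^ (2 * n - N) * 2 ^ (N - (2 * n - N))" for N
  define T where "T i k = (A\<^sup>2) ^ i * (B\<^sup>2) ^ k / (fact i * fact k * pochhammer (\<alpha> + 1) i * pochhammer (\<beta> + 1) k)" for i k
  have "(\<integral>w. gegenbauer ?l (2 * n) (jacobi_z A B w) \<partial>?M) = (\<Sum>N\<le>2 * n. (\<integral>w. c N * jacobi_z A B w ^ (N - (2 * n - N)) \<partial>?M))"
    unfolding gegenbauer_def power_mult_distrib c_def
    by (subst Bochner_Integration.integral_sum[symmetric])
       (auto intro!: integrable_mult_right integrable_jacobi_z_power ab simp: mult_ac)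
  \<comment> \<open>For N < n the binomial coefficient vanishes, since then 2n - N > N.\<close>
  also have "\<dots> = (\<Sum>N\<in>{n..2 * n}. (\<integral>w. c N * jacobi_z A B w ^ (N - (2 * n - N)) \<partial>?M))"
    by (rule sum.mono_neutral_right) (auto simp: c_def binomial_eq_0)
  also have "\<dots> = (\<Sum>m\<le>n. (\<integral>w. c (n + m) * jacobi_z A B w ^ (n + m - (2 * n - (n + m))) \<partial>?M))"
    by (rule sum.reindex_bij_witness[of _ "\<lambda>m. n + m" "\<lambda>N. N - n"]) auto
  also have "\<dots> = (\<Sum>m\<le>n. ?B * (\<Sum>i\<le>m. bailey_coeff \<alpha> \<beta> n i (m - i) * (A\<^sup>2) ^ i * (B\<^sup>2) ^ (m - i)))"
  proof (rule sum.cong[OF refl])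
    fix m assume "m \<in> {..n}"
    then have m: "m \<le> n" by simp
    have e: "n + m - (2 * n - (n + m)) = 2 * m" "2 * n - (n + m) = n - m" and e3: "n + m - (n - m) = 2 * m" using m by auto
    have ch: "real ((n + m) choose (n - m)) = fact (n + m) / (fact (n - m) * fact (2 * m))"
    proof -
      have d: "n + m - (n - m) = 2 * m" and le: "n - m \<le> n + m" using m by auto
      show ?thesis using binomial_fact[OF le, where 'a = real] by (simp only: d)
    qed
    have c: "c (n + m) = (- 1) ^ (n - m) * pochhammer ?l (n + m) / fact (n - m) * (4 ^ m / fact (2 * m))"
      unfolding c_def e(2) e3 ch power_mult by simp
    have "(\<integral>w. c (n + m) * jacobi_z A B w ^ (n + m - (2 * n - (n + m))) \<partial>?M) = c (n + m) * (?B * (fact (2 * m) / 4 ^ m) * (\<Sum>i\<le>m. T i (m - i)))"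
      unfolding e(2) e3 T_def using integral_jacobi_z_even_power[OF ab, of A B m] by (simp add: add.assoc)
    also have "\<dots> = ?B * ((- 1) ^ (n - m) * pochhammer ?l (n + m) / fact (n - m) * (\<Sum>i\<le>m. T i (m - i)))"
      unfolding c by simp
    also have "(- 1) ^ (n - m) * pochhammer ?l (n + m) / fact (n - m) * (\<Sum>i\<le>m. T i (m - i))
        = (\<Sum>i\<le>m. bailey_coeff \<alpha> \<beta> n i (m - i) * (A\<^sup>2) ^ i * (B\<^sup>2) ^ (m - i))"
      unfolding sum_distrib_left
    proof (rule sum.cong[OF refl])
      fix i assume "i \<in> {..m}"
      then have "i + (m - i) = m" by simp
      then show "(- 1) ^ (n - m) * pochhammer ?l (n + m) / fact (n - m) * T i (m - i) = bailey_coeff \<alpha> \<beta> n i (m - i) * (A\<^sup>2) ^ i * (B\<^sup>2) ^ (m - i)"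
        using m by (simp add: T_def bailey_coeff_def mult_ac)
    qed
    finally show "(\<integral>w. c (n + m) * jacobi_z A B w ^ (n + m - (2 * n - (n + m))) \<partial>?M) = ?B * (\<Sum>i\<le>m. bailey_coeff \<alpha> \<beta> n i (m - i) * (A\<^sup>2) ^ i * (B\<^sup>2) ^ (m - i))" .
  qed
  also have "\<dots> = ?B * (\<Sum>m\<le>n. \<Sum>i\<le>m. bailey_coeff \<alpha> \<beta> n i (m - i) * (A\<^sup>2) ^ i * (B\<^sup>2) ^ (m - i))"
    by (simp only: sum_distrib_left)
  also have "(\<Sum>m\<le>n. \<Sum>i\<le>m. bailey_coeff \<alpha> \<beta> n i (m - i) * (A\<^sup>2) ^ i * (B\<^sup>2) ^ (m - i))
     = (\<Sum>(i, k) | i + k \<le> n. bailey_coeff \<alpha> \<beta> n i k * (A\<^sup>2) ^ i * (B\<^sup>2) ^ k)"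
    by (rule sum.triangle_reindex_eq[symmetric])
  also have "\<dots> = (\<Sum>(i, k)\<in>{..n} \<times> {..n}. bailey_coeff \<alpha> \<beta> n i k * (A\<^sup>2) ^ i * (B\<^sup>2) ^ k)"
    by (rule sum.mono_neutral_left) (auto simp: bailey_coeff_def split: if_splits)
  also have "\<dots> = bailey_sum \<alpha> \<beta> n (A\<^sup>2) (B\<^sup>2)"
    unfolding bailey_sum_def by (simp add: sum.cartesian_product)
  finally show ?thesis .
qed

section \<open>Integral representation of the Riesz kernel\<close>

text \<open>On a convex set the bound L for the gradients is a Lipschitz constant. The normalised
  remainder is then at most 2L, one L for the increment and one for its linear part, and dominated
  convergence applies. The lemma serves the one-variable derivative of the Poisson kernel and the
  two-variable gradient of the Riesz kernel.\<close>

lemma gderiv_integral: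
  fixes F :: "'a::euclidean_space \<Rightarrow> 'w \<Rightarrow> real" and G :: "'a \<Rightarrow> 'w \<Rightarrow> 'a"
  assumes M: "finite_measure M" and S: "open S" "convex S" "x \<in> S"
    and int: "\<And>y. y \<in> S \<Longrightarrow> integrable M (F y)"
    and G_meas [measurable]: "G x \<in> borel_measurable M"
    and AE: "AE w in M. \<forall>y\<in>S. GDERIV (\<lambda>y. F y w) y :> G y w \<and> norm (G y w) \<le> L"
  shows "GDERIV (\<lambda>y. \<integral>w. F y w \<partial>M) x :> (\<integral>w. G x w \<partial>M)"
proof -
  interpret finite_measure M by (rule M)
  have G_int: "integrable M (G x)"
    by (rule integrable_const_bound[where B=L]) (use AE S(3) in auto)
  define I where "I y = (\<integral>w. F y w \<partial>M)" for y
  define J where "J = (\<integral>w. G x w \<partial>M)"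
  have lip: "AE w in M. \<forall>y\<in>S. \<bar>F y w - F x w\<bar> \<le> L * norm (y - x)"
    using AE
  proof eventually_elim
    case (elim w)
    have d: "((\<lambda>y. F y w) has_derivative (\<lambda>h. inner h (G y w))) (at y within S)" if "y \<in> S" for y
      using elim that by (auto simp: gderiv_def intro: has_derivative_at_withinI)
    have o: "onorm (\<lambda>h. inner h (G y w)) \<le> L" if "y \<in> S" for y
    proof (rule onorm_le)
      fix h
      have "norm (inner h (G y w)) \<le> norm h * norm (G y w)" using Cauchy_Schwarz_ineq2 by auto
      also have "\<dots> \<le> norm h * L" using elim that by (intro mult_left_mono) auto
      finally show "norm (inner h (G y w)) \<le> L * norm h" by (simp add: mult.commute)
    qed
    show ?case
      using differentiable_bound[OF S(2) d o _ S(3)] by (auto simp: real_norm_def)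
  qed
  have "((\<lambda>y. norm (I y - I x - inner (y - x) J) / norm (y - x)) \<longlongrightarrow> 0) (at x)"
    unfolding tendsto_at_iff_sequentially
  proof (intro allI impI)
    fix X :: "nat \<Rightarrow> 'a" assume X: "\<forall>i. X i \<in> UNIV - {x}" and lim: "X \<longlonglongrightarrow> x"
    \<comment> \<open>Dominated convergence concerns sequences, so the limit is tested along
      sequences, cut off until they stay in \<open>S\<close>.\<close>
    obtain n where n: "\<And>i. i \<ge> n \<Longrightarrow> X i \<in> S"
      using topological_tendstoD[OF lim S(1,3)] unfolding eventually_sequentially by blast
    define Y where "Y i = X (i + n)" for i
    have Y: "Y i \<in> S" "Y i \<noteq> x" for i using n X by (auto simp: Y_def)
    have Ylim: "Y \<longlonglongrightarrow> x" unfolding Y_def using lim by (rule LIMSEQ_ignore_initial_segment)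
    define R where "R i w = (F (Y i) w - F x w - inner (Y i - x) (G x w)) / norm (Y i - x)" for i w
    have R_int: "integrable M (R i)" for i
      unfolding R_def by (intro Bochner_Integration.integrable_diff integrable_inner_right integrable_divide int Y S G_int) 
    have R_eq: "(\<integral>w. R i w \<partial>M) = (I (Y i) - I x - inner (Y i - x) J) / norm (Y i - x)" for i
      unfolding R_def I_def J_def
      by (simp add: int Y S G_int integral_inner_right)
    have "(\<lambda>i. \<integral>w. R i w \<partial>M) \<longlonglongrightarrow> (\<integral>w. 0 \<partial>M)"
    proof (rule integral_dominated_convergence[where w="\<lambda>_. 2 * L"])
      show "R i \<in> borel_measurable M" for i using R_int by auto
      show "integrable M (\<lambda>_. 2 * L)" by simp
      show "AE w in M. (\<lambda>i. R i w) \<longlonglongrightarrow> 0"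
        using AE
      proof eventually_elim
        case (elim w)
        then have "((\<lambda>y. F y w) has_derivative (\<lambda>h. inner h (G x w))) (at x)" using S(3) by (auto simp: gderiv_def)
        then have "((\<lambda>y. norm (F y w - F x w - inner (y - x) (G x w)) / norm (y - x)) \<longlongrightarrow> 0) (at x)"
          by (simp add: has_derivative_iff_norm)
        then have "((\<lambda>y. norm (F y w - F x w - inner (y - x) (G x w)) / norm (y - x)) \<circ> Y) \<longlonglongrightarrow> 0"
          using Ylim Y unfolding tendsto_at_iff_sequentially by auto
        moreover have "((\<lambda>y. norm (F y w - F x w - inner (y - x) (G x w)) / norm (y - x)) \<circ> Y) = (\<lambda>i. norm (R i w))"
          by (auto simp: R_def)
        ultimately show ?case using tendsto_norm_zero_cancel by metis
      qed
      show "AE w in M. norm (R i w) \<le> 2 * L" for i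
        using AE lip
      proof eventually_elim
        case (elim w)
        have pos: "norm (Y i - x) > 0" using Y by auto
        have "\<bar>inner (Y i - x) (G x w)\<bar> \<le> norm (Y i - x) * norm (G x w)" by (rule Cauchy_Schwarz_ineq2)
        also have "\<dots> \<le> norm (Y i - x) * L" using elim S(3) by (intro mult_left_mono) auto
        finally have "\<bar>inner (Y i - x) (G x w)\<bar> \<le> L * norm (Y i - x)" by (simp add: mult.commute)
        moreover have "\<bar>F (Y i) w - F x w\<bar> \<le> L * norm (Y i - x)" using elim Y by auto
        ultimately have "\<bar>F (Y i) w - F x w - inner (Y i - x) (G x w)\<bar> \<le> (2 * L) * norm (Y i - x)" by linarith
        then show ?case using pos by (simp add: R_def pos_divide_le_eq)
      qed
    qed simp
    then have "(\<lambda>i. norm (\<integral>w. R i w \<partial>M)) \<longlonglongrightarrow> 0" by (intro tendsto_norm_zero) simp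
    then have "(\<lambda>i. norm (I (Y i) - I x - inner (Y i - x) J) / norm (Y i - x)) \<longlonglongrightarrow> 0"
      unfolding R_eq by (simp add: norm_divide)
    then have "(\<lambda>i. ((\<lambda>y. norm (I y - I x - inner (y - x) J) / norm (y - x)) \<circ> X) (i + n)) \<longlonglongrightarrow> 0"
      by (simp add: Y_def)
    then show "((\<lambda>y. norm (I y - I x - inner (y - x) J) / norm (y - x)) \<circ> X) \<longlonglongrightarrow> 0"
      by (rule LIMSEQ_offset)
  qed
  then have "(I has_derivative (\<lambda>h. inner h J)) (at x)"
    by (simp add: has_derivative_iff_norm bounded_linear_inner_left)
  then show ?thesis by (simp add: gderiv_def I_def[abs_def] J_def)
qed

text \<open>\<open>jz\<close> is the function \<open>z\<close> of the paper at \<open>u = 1 - x\<close>, \<open>v = 1 - y\<close>; its derivatives \<open>\<partial>z/\<partial>\<theta>\<close> and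
  \<open>\<partial>\<^sup>2z/\<partial>\<theta>\<partial>\<phi>\<close> are \<open>jz_d\<close> and, below, \<open>jz_m\<close>.\<close>
definition jz :: "real \<Rightarrow> real \<Rightarrow> real \<times> real \<Rightarrow> real" where
  "jz \<theta> \<phi> w = jacobi_z (sin (\<theta> / 2) * sin (\<phi> / 2)) (cos (\<theta> / 2) * cos (\<phi> / 2)) w"

definition jz_d :: "real \<Rightarrow> real \<Rightarrow> real \<times> real \<Rightarrow> real" where
  "jz_d \<theta> \<phi> w = jacobi_z (cos (\<theta> / 2) * sin (\<phi> / 2)) (- sin (\<theta> / 2) * cos (\<phi> / 2)) w / 2"

lemma abs_jacobi_z_le:
  assumes "w \<in> {0<..<2} \<times> {0<..<2}"
  shows "\<bar>jacobi_z A B w\<bar> \<le> \<bar>A\<bar> + \<bar>B\<bar>"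
proof -
  have "\<bar>1 - fst w\<bar> \<le> 1" "\<bar>1 - snd w\<bar> \<le> 1" using assms by auto
  then have "\<bar>A * (1 - fst w)\<bar> \<le> \<bar>A\<bar>" "\<bar>B * (1 - snd w)\<bar> \<le> \<bar>B\<bar>"
    unfolding abs_mult by (auto intro: mult_left_le)
  then show ?thesis unfolding jacobi_z_def by linarith
qed

text \<open>With sines and cosines of half angles in suitable order this bounds z as well as its
  derivatives.\<close>

lemma abs_unit_products_le:
  fixes s c s' c' :: real
  assumes "s\<^sup>2 + c\<^sup>2 = 1" "s'\<^sup>2 + c'\<^sup>2 = 1"
  shows "\<bar>s * s'\<bar> + \<bar>c * c'\<bar> \<le> 1"
proof -
  have "2 * (\<bar>s\<bar> * \<bar>s'\<bar>) \<le> s\<^sup>2 + s'\<^sup>2" "2 * (\<bar>c\<bar> * \<bar>c'\<bar>) \<le> c\<^sup>2 + c'\<^sup>2"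
    using sum_squares_bound[of "\<bar>s\<bar>" "\<bar>s'\<bar>"] sum_squares_bound[of "\<bar>c\<bar>" "\<bar>c'\<bar>"] by (simp_all add: mult.assoc)
  then show ?thesis using assms by (simp add: abs_mult)
qed

lemma abs_jz_le_1:
  assumes "w \<in> {0<..<2} \<times> {0<..<2}"
  shows "\<bar>jz \<theta> \<phi> w\<bar> \<le> 1"
  unfolding jz_def
  by (rule order_trans[OF abs_jacobi_z_le[OF assms] abs_unit_products_le]) simp_all

lemma abs_jz_d_le:
  assumes "w \<in> {0<..<2} \<times> {0<..<2}"
  shows "\<bar>jz_d \<theta> \<phi> w\<bar> \<le> 1 / 2"
proof -
  have "\<bar>jacobi_z (cos (\<theta> / 2) * sin (\<phi> / 2)) (- sin (\<theta> / 2) * cos (\<phi> / 2)) w\<bar> \<le> 1"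
    by (rule order_trans[OF abs_jacobi_z_le[OF assms] abs_unit_products_le]) simp_all
  then show ?thesis by (simp add: jz_d_def)
qed

lemma continuous_jz [continuous_intros]: "continuous_on S (jz \<theta> \<phi>)" "continuous_on S (jz_d \<theta> \<phi>)"
  unfolding jz_def[abs_def] jz_d_def[abs_def] jacobi_z_def by (intro continuous_intros; simp)+

lemma jz_measurable [measurable]: "jz \<theta> \<phi> \<in> borel_measurable borel" "jz_d \<theta> \<phi> \<in> borel_measurable borel"
  by (auto intro!: borel_measurable_continuous_onI continuous_intros)

lemma integrable_jacobi_square_bounded:
  fixes f :: "real \<times> real \<Rightarrow> 'b::{banach, second_countable_topology}"
  assumes "a > 0" "b > 0" "f \<in> borel_measurable borel"
    and "\<And>w. w \<in> {0<..<2} \<times> {0<..<2} \<Longrightarrow> norm (f w) \<le> C"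
  shows "integrable (jacobi_square a b) f"
proof -
  interpret finite_measure "jacobi_square a b" by (rule finite_measure_jacobi_square[OF assms(1,2)])
  show ?thesis
  proof (rule integrable_const_bound[where B=C])
    show "AE w in jacobi_square a b. norm (f w) \<le> C"
      using AE_jacobi_square[OF assms(1,2)] by eventually_elim (rule assms(4))
    show "f \<in> borel_measurable (jacobi_square a b)"
      using assms(3) by (simp add: measurable_cong_sets[OF sets_jacobi_square refl])
  qed
qed

section \<open>The Poisson kernel\<close>

text \<open>In the product of the squared normalisation and Bailey's constant all Gamma factors
  depending on n cancel; only 2n + \<alpha> + \<beta> + 1 survives.\<close>

lemma jacobi_trig_product:
  fixes \<alpha> \<beta> :: real
  assumes a: "\<alpha> > - 1 / 2" and b: "\<beta> > - 1 / 2"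
  shows "jacobi_trig \<alpha> \<beta> n \<theta> * jacobi_trig \<alpha> \<beta> n \<phi> =
     Gamma (\<alpha> + \<beta> + 1) / (Gamma (\<alpha> + 1) * Gamma (\<beta> + 1)) * (2 * real n + (\<alpha> + \<beta> + 1)) *
       bailey_sum \<alpha> \<beta> n ((sin (\<theta> / 2) * sin (\<phi> / 2))\<^sup>2) ((cos (\<theta> / 2) * cos (\<phi> / 2))\<^sup>2)"
proof -
  let ?l = "\<alpha> + \<beta> + 1"
  have l: "?l > 0" using a b by simp
  have c: "cos x = 1 - 2 * (sin (x / 2))\<^sup>2" for x :: real
    using cos_double_sin[of "x / 2"] by simp
  have c2: "1 - (sin (x / 2))\<^sup>2 = (cos (x / 2))\<^sup>2" for x :: real by (simp add: cos_squared_eq)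
  have poch: "pochhammer z n = Gamma (z + real n) / Gamma z" if "z > 0" for z
    by (rule pochhammer_Gamma) (use that in \<open>auto elim!: nonpos_Ints_cases'\<close>)
  have pos: "Gamma ?l > 0" "Gamma (\<alpha> + 1) > 0" "Gamma (\<beta> + 1) > 0" "Gamma (?l + n) > 0" "Gamma (\<alpha> + 1 + n) > 0" "Gamma (\<beta> + 1 + n) > 0"
    using a b by (auto intro!: Gamma_real_pos)
  have d2: "(jacobi_d \<alpha> \<beta> n)\<^sup>2 = (2 * real n + ?l) * fact n * Gamma (?l + n) / (Gamma (\<alpha> + 1 + n) * Gamma (\<beta> + 1 + n))"
  proof -
    have "(2 * real n + \<alpha> + \<beta> + 1) * Gamma (real n + 1) * Gamma (real n + \<alpha> + \<beta> + 1)
           / (Gamma (real n + \<alpha> + 1) * Gamma (real n + \<beta> + 1)) = (2 * real n + ?l) * fact n * Gamma (?l + n) / (Gamma (\<alpha> + 1 + n) * Gamma (\<beta> + 1 + n))"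
      using Gamma_fact[of n, where 'a=real] by (simp add: add_ac)
    moreover have "\<dots> \<ge> 0" using pos l by simp
    ultimately show ?thesis unfolding jacobi_d_def by simp
  qed
  have "jacobi_trig \<alpha> \<beta> n \<theta> * jacobi_trig \<alpha> \<beta> n \<phi> = (jacobi_d \<alpha> \<beta> n)\<^sup>2 * (jacobi_P \<alpha> \<beta> n (cos \<theta>) * jacobi_P \<alpha> \<beta> n (cos \<phi>))"
    by (simp add: jacobi_trig_def power2_eq_square)
  also have "jacobi_P \<alpha> \<beta> n (cos \<theta>) * jacobi_P \<alpha> \<beta> n (cos \<phi>) =
    pochhammer (\<alpha> + 1) n * pochhammer (\<beta> + 1) n / (fact n * pochhammer ?l n)
       * bailey_sum \<alpha> \<beta> n ((sin (\<theta> / 2) * sin (\<phi> / 2))\<^sup>2) ((cos (\<theta> / 2) * cos (\<phi> / 2))\<^sup>2)"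
    unfolding c[of \<theta>] c[of \<phi>] using a b
    by (subst jacobi_P_product) (simp_all add: c2 power_mult_distrib)
  finally have eq: "jacobi_trig \<alpha> \<beta> n \<theta> * jacobi_trig \<alpha> \<beta> n \<phi> = (jacobi_d \<alpha> \<beta> n)\<^sup>2 * (pochhammer (\<alpha> + 1) n * pochhammer (\<beta> + 1) n / (fact n * pochhammer ?l n)
       * bailey_sum \<alpha> \<beta> n ((sin (\<theta> / 2) * sin (\<phi> / 2))\<^sup>2) ((cos (\<theta> / 2) * cos (\<phi> / 2))\<^sup>2))" .
  have alg: "(N * F * Gln / (Gan * Gbn)) * ((Gan / Ga) * (Gbn / Gb) / (F * (Gln / Gl)) * S) = Gl / (Ga * Gb) * N * S"
    if "Gan > 0" "Gbn > 0" "F > 0" "Gln > 0" "Gl > 0" "Ga > 0" "Gb > 0" for N F Gln Gan Gbn Ga Gb Gl S :: real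
    using that by (simp add: divide_simps)
  have z: "\<alpha> + 1 > 0" "\<beta> + 1 > 0" using a b by auto
  show ?thesis unfolding eq d2 poch[OF z(1)] poch[OF z(2)] poch[OF l]
    by (rule alg) (use pos in auto)
qed

text \<open>The weighted Gegenbauer series with r = exp(-t / 2) is integrated termwise over the
  square. Odd degrees give zero, and degree 2n gives, up to a factor independent of n, the n-th term
  of the Poisson series. As \<alpha> + \<beta> + 1 > 0, the absolute value in the exponent
  disappears.\<close>

lemma jacobi_poisson_integral:
  fixes \<alpha> \<beta> :: real
  assumes a: "\<alpha> > - 1 / 2" and b: "\<beta> > - 1 / 2" and t: "t > 0"
  shows "jacobi_poisson \<alpha> \<beta> t \<theta> \<phi> =
    2 powr (- (\<alpha> + \<beta> + 1)) * Gamma (\<alpha> + \<beta> + 2) / (pi * Gamma (\<alpha> + 1 / 2) * Gamma (\<beta> + 1 / 2)) *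
    (\<integral>w. sinh (t / 2) * (cosh (t / 2) - jz \<theta> \<phi> w) powr (- (\<alpha> + \<beta> + 2)) \<partial>jacobi_square (\<alpha> + 1 / 2) (\<beta> + 1 / 2))"
proof -
  let ?l = "\<alpha> + \<beta> + 1" let ?M = "jacobi_square (\<alpha> + 1 / 2) (\<beta> + 1 / 2)" let ?B = "jacobi_mass (\<alpha> + 1 / 2) (\<beta> + 1 / 2)"
  let ?A1 = "sin (\<theta> / 2) * sin (\<phi> / 2)" let ?B1 = "cos (\<theta> / 2) * cos (\<phi> / 2)"
  have l: "?l > 0" using a b by simp
  have ab: "\<alpha> + 1/2 > 0" "\<beta> + 1/2 > 0" using a b by auto
  interpret finite_measure ?M by (rule finite_measure_jacobi_square[OF ab])
  define r where "r = exp (- t / 2)"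
  have r: "0 < r" "r < 1" "\<bar>r\<bar> < 1" using t by (auto simp: r_def)
  define f where "f m w = (real m + ?l) * (gegenbauer ?l m (jz \<theta> \<phi> w) * r ^ m)" for m w
  define g where "g m = (real m + ?l) * (gegenbauer_bound ?l m * r ^ m)" for m
  have fg: "\<bar>f m w\<bar> \<le> g m" if "w \<in> {0<..<2} \<times> {0<..<2}" for m w
    unfolding f_def g_def abs_mult using l r abs_gegenbauer_le[OF l abs_jz_le_1[OF that], of m \<theta> \<phi>]
    by (intro mult_mono) (auto simp: abs_of_nonneg)
  have sg: "summable g" unfolding g_def by (rule summable_weighted_gegenbauer_bound[OF l r(3)])
  have f_int: "integrable ?M (f m)" for m
    by (rule integrable_jacobi_square_bounded[OF ab _ fg[THEN order_trans[OF eq_refl[OF real_norm_def]]]]) (unfold f_def, measurable)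
  have f_sums: "(\<lambda>m. f m w) sums (?l * (1 - r\<^sup>2) * (1 - 2 * r * jz \<theta> \<phi> w + r\<^sup>2) powr (- ?l - 1))"
    if "w \<in> {0<..<2} \<times> {0<..<2}" for w
    unfolding f_def by (rule weighted_gegenbauer_sums[OF abs_jz_le_1[OF that] r(3) l])
  define h where "h w = sinh (t / 2) * (cosh (t / 2) - jz \<theta> \<phi> w) powr (- (\<alpha> + \<beta> + 2))" for w
  have fh: "(\<Sum>m. f m w) = ?l * (2 powr (- ?l) * r powr (- ?l)) * h w" if w: "w \<in> {0<..<2} \<times> {0<..<2}" for w
  proof -
    have ch: "cosh (t / 2) \<ge> 1" by (rule cosh_real_ge_1)
    have q: "cosh (t / 2) - jz \<theta> \<phi> w \<ge> 0" using ch abs_jz_le_1[OF w, of \<theta> \<phi>] by linarith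
    \<comment> \<open>These identities replace r by hyperbolic functions of t; the power of r that
      remains cancels against the factor r^(\<alpha> + \<beta> + 1) of the Poisson series.\<close>
    have r1: "2 * r * cosh (t / 2) = 1 + r\<^sup>2" "2 * r * sinh (t / 2) = 1 - r\<^sup>2"
      unfolding r_def cosh_def sinh_def by (simp_all add: power2_eq_square algebra_simps flip: exp_add)
    have "(\<Sum>m. f m w) = ?l * (1 - r\<^sup>2) * (1 - 2 * r * jz \<theta> \<phi> w + r\<^sup>2) powr (- ?l - 1)"
      using f_sums[OF w] by (simp add: sums_iff)
    also have "1 - 2 * r * jz \<theta> \<phi> w + r\<^sup>2 = 2 * r * (cosh (t / 2) - jz \<theta> \<phi> w)" unfolding right_diff_distrib r1 by simp
    also have "\<dots> powr (- ?l - 1) = (2 * r) powr (- ?l - 1) * (cosh (t / 2) - jz \<theta> \<phi> w) powr (- ?l - 1)"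
      using r q by (intro powr_mult) 
    also have "(2 * r) powr (- ?l - 1) = (2 * r) powr (- ?l) / (2 * r)" using r by (simp add: powr_diff power2_eq_square)
    also have "(2 * r) powr (- ?l) = 2 powr (- ?l) * r powr (- ?l)" using r by (intro powr_mult)
    also have "- ?l - 1 = - (\<alpha> + \<beta> + 2)" by simp
    also have "1 - r\<^sup>2 = 2 * r * sinh (t / 2)" using r1 by simp
    finally show ?thesis unfolding h_def using r by (simp add: power2_eq_square)
  qed
  have norm_sum: "AE w in ?M. summable (\<lambda>m. norm (f m w))"
    using AE_jacobi_square[OF ab]
    by eventually_elim (rule summable_comparison_test'[OF sg, of 0], use fg in auto)
  have int_sum: "summable (\<lambda>m. \<integral>w. norm (f m w) \<partial>?M)"
  proof (rule summable_comparison_test'[of "\<lambda>m. measure ?M (space ?M) * g m" 0])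
    show "summable (\<lambda>m. measure ?M (space ?M) * g m)" by (intro summable_mult sg)
    fix m
    have ae: "AE w in ?M. norm (f m w) \<le> g m"
      using AE_jacobi_square[OF ab] by eventually_elim (simp only: real_norm_def fg)
    have "(\<integral>w. norm (f m w) \<partial>?M) \<le> (\<integral>w. g m \<partial>?M)"
      by (intro integral_mono_AE integrable_norm f_int ae) simp
    then show "norm (\<integral>w. norm (f m w) \<partial>?M) \<le> measure ?M (space ?M) * g m"
      by (simp add: abs_of_nonneg)
  qed
  have "(\<lambda>m. \<integral>w. f m w \<partial>?M) sums (\<integral>w. (\<Sum>m. f m w) \<partial>?M)"
    by (rule sums_integral[OF f_int norm_sum int_sum])
  also have "(\<integral>w. (\<Sum>m. f m w) \<partial>?M) = (\<integral>w. ?l * (2 powr (- ?l) * r powr (- ?l)) * h w \<partial>?M)"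
  proof (rule integral_cong_AE)
    show "(\<lambda>w. \<Sum>m. f m w) \<in> borel_measurable ?M"
      by (rule borel_measurable_suminf) (use f_int in auto)
    show "(\<lambda>w. ?l * (2 powr (- ?l) * r powr (- ?l)) * h w) \<in> borel_measurable ?M"
      unfolding h_def by (simp add: measurable_cong_sets[OF sets_jacobi_square refl])
    show "AE w in ?M. (\<Sum>m. f m w) = ?l * (2 powr (- ?l) * r powr (- ?l)) * h w"
      using AE_jacobi_square[OF ab] by eventually_elim (rule fh)
  qed
  finally have "(\<lambda>m. \<integral>w. f m w \<partial>?M) sums (?l * (2 powr (- ?l) * r powr (- ?l)) * (\<integral>w. h w \<partial>?M))"
    by simp
  moreover have f_odd: "(\<integral>w. f m w \<partial>?M) = 0" if "odd m" for m
    using integral_gegenbauer_odd[OF ab that, of ?l ?A1 ?B1] unfolding f_def jz_def by simp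
  ultimately have "(\<lambda>n. \<integral>w. f (2 * n) w \<partial>?M) sums (?l * (2 powr (- ?l) * r powr (- ?l)) * (\<integral>w. h w \<partial>?M))"
    by (subst sums_mono_reindex) (auto simp: strict_mono_def elim!: evenE)
  moreover have "(\<integral>w. f (2 * n) w \<partial>?M) = (2 * real n + ?l) * (?B * bailey_sum \<alpha> \<beta> n (?A1\<^sup>2) (?B1\<^sup>2)) * r ^ (2 * n)" for n
    using integral_gegenbauer_even[OF a b, of n ?A1 ?B1] unfolding f_def jz_def by simp
  ultimately have S: "(\<lambda>n. (2 * real n + ?l) * (?B * bailey_sum \<alpha> \<beta> n (?A1\<^sup>2) (?B1\<^sup>2)) * r ^ (2 * n)) sums (?l * (2 powr (- ?l) * r powr (- ?l)) * (\<integral>w. h w \<partial>?M))"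
    by simp
  \<comment> \<open>The ratio, independent of n, of the n-th Poisson term to the integrated
    Gegenbauer term of degree 2n.\<close>
  define k where "k = Gamma ?l / (Gamma (\<alpha> + 1) * Gamma (\<beta> + 1)) / ?B * r powr ?l"
  have Bpos: "?B > 0" using ab by (intro mult_pos_pos Beta_pos_real) auto
  have summand: "exp (- t * \<bar>real n + (\<alpha> + \<beta> + 1) / 2\<bar>) * jacobi_trig \<alpha> \<beta> n \<theta> * jacobi_trig \<alpha> \<beta> n \<phi>
     = k * ((2 * real n + ?l) * (?B * bailey_sum \<alpha> \<beta> n (?A1\<^sup>2) (?B1\<^sup>2)) * r ^ (2 * n))" for n
  proof -
    have "- t * \<bar>real n + (\<alpha> + \<beta> + 1) / 2\<bar> = ?l * (- t / 2) + real (2 * n) * (- t / 2)"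
      using l by (simp add: field_simps)
    then have "exp (- t * \<bar>real n + (\<alpha> + \<beta> + 1) / 2\<bar>) = r powr ?l * r ^ (2 * n)"
      unfolding r_def by (simp only: exp_add exp_of_nat_mult) (simp add: powr_def)
    moreover have "exp (- t * \<bar>real n + (\<alpha> + \<beta> + 1) / 2\<bar>) * jacobi_trig \<alpha> \<beta> n \<theta> * jacobi_trig \<alpha> \<beta> n \<phi>
      = exp (- t * \<bar>real n + (\<alpha> + \<beta> + 1) / 2\<bar>) * (jacobi_trig \<alpha> \<beta> n \<theta> * jacobi_trig \<alpha> \<beta> n \<phi>)" by simp
    moreover have "Beta (1 / 2) (\<alpha> + 1 / 2) \<noteq> 0" "Beta (1 / 2) (\<beta> + 1 / 2) \<noteq> 0" using Bpos by auto
    ultimately show ?thesis unfolding jacobi_trig_product[OF a b] k_def by (simp add: mult_ac)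
  qed
  have "jacobi_poisson \<alpha> \<beta> t \<theta> \<phi> = k * (?l * (2 powr (- ?l) * r powr (- ?l)) * (\<integral>w. h w \<partial>?M))"
    unfolding jacobi_poisson_def summand using sums_mult[OF S, of k] by (simp add: sums_iff)
  also have "k * (?l * (2 powr (- ?l) * r powr (- ?l)) * (\<integral>w. h w \<partial>?M)) =
     2 powr (- ?l) * (?l * Gamma ?l) / (Gamma (\<alpha> + 1) * Gamma (\<beta> + 1) * ?B) * (\<integral>w. h w \<partial>?M)"
  proof -
    have rr: "r powr ?l * r powr (- ?l) = 1" using r by (simp flip: powr_add)
    have "k * (?l * (2 powr (- ?l) * r powr (- ?l)) * (\<integral>w. h w \<partial>?M)) = (r powr ?l * r powr (- ?l)) *
       (2 powr (- ?l) * (?l * Gamma ?l) / (Gamma (\<alpha> + 1) * Gamma (\<beta> + 1) * ?B) * (\<integral>w. h w \<partial>?M))"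
      unfolding k_def by (simp only: divide_inverse inverse_mult_distrib mult_ac)
    then show ?thesis unfolding rr by (simp only: mult_1_left)
  qed
  also have "?l * Gamma ?l = Gamma (\<alpha> + \<beta> + 2)"
    using Gamma_real_plus1[OF l] by (simp add: add.assoc)
  also have "Gamma (\<alpha> + 1) * Gamma (\<beta> + 1) * ?B = pi * Gamma (\<alpha> + 1 / 2) * Gamma (\<beta> + 1 / 2)"
  proof -
    have "Beta (1/2) (\<alpha> + 1/2) * Gamma (\<alpha> + 1) = sqrt pi * Gamma (\<alpha> + 1/2)" "Beta (1/2) (\<beta> + 1/2) * Gamma (\<beta> + 1) = sqrt pi * Gamma (\<beta> + 1/2)"
      using a b Gamma_pos_nz[of "\<alpha> + 1"] Gamma_pos_nz[of "\<beta> + 1"] unfolding Beta_def by (simp_all add: Gamma_one_half_real add_ac)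
    then have "Gamma (\<alpha> + 1) * Gamma (\<beta> + 1) * ?B = (sqrt pi * Gamma (\<alpha> + 1/2)) * (sqrt pi * Gamma (\<beta> + 1/2))"
      by (metis mult.assoc mult.left_commute mult.commute)
    also have "\<dots> = (sqrt pi * sqrt pi) * Gamma (\<alpha> + 1/2) * Gamma (\<beta> + 1/2)" by (simp only: mult_ac)
    finally show ?thesis by simp
  qed
  finally show ?thesis unfolding h_def .
qed

lemma borel_measurable_sinh_cosh [measurable]:
  "(sinh :: real \<Rightarrow> real) \<in> borel_measurable borel" "(cosh :: real \<Rightarrow> real) \<in> borel_measurable borel"
  by (intro borel_measurable_continuous_onI continuous_intros)+

lemma has_derivative_jz: "((\<lambda>x. jz x \<phi> w) has_real_derivative jz_d \<theta> \<phi> w) (at \<theta>)"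
  unfolding jz_def jz_d_def jacobi_z_def
  by (auto intro!: derivative_eq_intros simp: algebra_simps)

text \<open>For fixed t > 0 the base cosh(t / 2) - z is at least cosh(t / 2) - 1 > 0 whatever the
  angles are, so the domination holds on the whole line, including the diagonal.\<close>

lemma jacobi_poisson_deriv:
  fixes \<alpha> \<beta> :: real
  assumes a: "\<alpha> > - 1 / 2" and b: "\<beta> > - 1 / 2" and t: "t > 0"
  defines "N \<equiv> \<alpha> + \<beta> + 2"
  shows "deriv (\<lambda>x. jacobi_poisson \<alpha> \<beta> t x \<phi>) \<theta> =
    2 powr (1 - N) * Gamma N / (pi * Gamma (\<alpha> + 1 / 2) * Gamma (\<beta> + 1 / 2)) *
    (\<integral>w. N * sinh (t / 2) * (cosh (t / 2) - jz \<theta> \<phi> w) powr (- N - 1) * jz_d \<theta> \<phi> w \<partial>jacobi_square (\<alpha> + 1 / 2) (\<beta> + 1 / 2))"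
proof -
  let ?M = "jacobi_square (\<alpha> + 1 / 2) (\<beta> + 1 / 2)"
  have ab: "\<alpha> + 1/2 > 0" "\<beta> + 1/2 > 0" using a b by auto
  have N: "N > 0" using a b by (simp add: N_def)
  define c where "c = 2 powr (1 - N) * Gamma N / (pi * Gamma (\<alpha> + 1 / 2) * Gamma (\<beta> + 1 / 2))"
  define F where "F x w = sinh (t / 2) * (cosh (t / 2) - jz x \<phi> w) powr (- N)" for x w
  define G where "G x w = N * sinh (t / 2) * (cosh (t / 2) - jz x \<phi> w) powr (- N - 1) * jz_d x \<phi> w" for x w
  define \<delta> where "\<delta> = cosh (t / 2) - 1"
  have d: "\<delta> > 0" using cosh_real_nonneg_less_iff[of 0 "t / 2"] t by (simp add: \<delta>_def)
  have ge: "cosh (t / 2) - jz x \<phi> w \<ge> \<delta>" if "w \<in> {0<..<2} \<times> {0<..<2}" for x w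
    using abs_jz_le_1[OF that, of x \<phi>] by (simp add: \<delta>_def)
  have sinh: "sinh (t / 2) \<ge> 0" using t by simp
  have "GDERIV (\<lambda>x. \<integral>w. F x w \<partial>?M) \<theta> :> (\<integral>w. G \<theta> w \<partial>?M)"
  proof (rule gderiv_integral[OF finite_measure_jacobi_square[OF ab] open_UNIV convex_UNIV UNIV_I])
    fix x
    show "integrable ?M (F x)"
    proof (rule integrable_jacobi_square_bounded[OF ab, where C="sinh (t / 2) * \<delta> powr (- N)"])
      show "F x \<in> borel_measurable borel" unfolding F_def by measurable
      fix w :: "real \<times> real" assume w: "w \<in> {0<..<2} \<times> {0<..<2}"
      have "(cosh (t / 2) - jz x \<phi> w) powr (- N) \<le> \<delta> powr (- N)"
        using ge[OF w] d N by (intro powr_mono2') auto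
      then show "norm (F x w) \<le> sinh (t / 2) * \<delta> powr (- N)"
        unfolding F_def using sinh by (simp add: abs_mult mult_left_mono)
    qed
  next
    show "G \<theta> \<in> borel_measurable ?M" unfolding G_def by (simp add: measurable_cong_sets[OF sets_jacobi_square refl])
    show "AE w in ?M. \<forall>x\<in>UNIV. GDERIV (\<lambda>x. F x w) x :> G x w \<and> norm (G x w) \<le> N * sinh (t / 2) * \<delta> powr (- N - 1)"
      using AE_jacobi_square[OF ab]
    proof eventually_elim
      case (elim w)
      show ?case
      proof (intro ballI conjI)
        fix x
        have pos: "cosh (t / 2) - jz x \<phi> w > 0" using ge[OF elim, of x] d by simp
        show "GDERIV (\<lambda>x. F x w) x :> G x w"
          unfolding gderiv_deriv F_def G_def
          by (rule derivative_eq_intros has_derivative_jz refl | use pos in simp)+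
        have "(cosh (t / 2) - jz x \<phi> w) powr (- N - 1) \<le> \<delta> powr (- N - 1)"
          using ge[OF elim] d N by (intro powr_mono2') auto
        then have "\<bar>(cosh (t / 2) - jz x \<phi> w) powr (- N - 1) * jz_d x \<phi> w\<bar> \<le> \<delta> powr (- N - 1) * 1"
          unfolding abs_mult using abs_jz_d_le[OF elim, of x \<phi>] by (intro mult_mono) auto
        then have "N * sinh (t / 2) * \<bar>(cosh (t / 2) - jz x \<phi> w) powr (- N - 1) * jz_d x \<phi> w\<bar> \<le> N * sinh (t / 2) * (\<delta> powr (- N - 1) * 1)"
          using N sinh by (intro mult_left_mono) auto
        then show "norm (G x w) \<le> N * sinh (t / 2) * \<delta> powr (- N - 1)"
          unfolding G_def using N sinh by (simp add: abs_mult mult.assoc)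
      qed
    qed
  qed
  then have "((\<lambda>x. c * (\<integral>w. F x w \<partial>?M)) has_real_derivative c * (\<integral>w. G \<theta> w \<partial>?M)) (at \<theta>)"
    unfolding gderiv_deriv by (rule DERIV_cmult)
  moreover have "(\<lambda>x. jacobi_poisson \<alpha> \<beta> t x \<phi>) = (\<lambda>x. c * (\<integral>w. F x w \<partial>?M))"
  proof
    fix x
    have "- (\<alpha> + \<beta> + 1) = 1 - N" by (simp add: N_def)
    then show "jacobi_poisson \<alpha> \<beta> t x \<phi> = c * (\<integral>w. F x w \<partial>?M)"
      unfolding c_def F_def using jacobi_poisson_integral[OF a b t, of x \<phi>] by (simp only: N_def)
  qed
  ultimately show ?thesis unfolding c_def G_def by (simp add: DERIV_imp_deriv)
qed

section \<open>Integration in t and the Riesz kernel\<close>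

text \<open>The integrand has the antiderivative -2 (cosh(t / 2) - z)^(-N), which tends to 0 at
  infinity; integration in t removes the extra exponent produced by the \<theta>-derivative.\<close>

lemma nn_integral_sinh_cosh_powr:
  fixes z N :: real
  assumes z: "z < 1" and N: "N > 0"
  shows "(\<integral>\<^sup>+t. ennreal (indicator {0<..} t * (N * sinh (t / 2) * (cosh (t / 2) - z) powr (- N - 1))) \<partial>lborel) = ennreal (2 * (1 - z) powr (- N))"
proof -
  let ?f = "\<lambda>t::real. N * sinh (t / 2) * (cosh (t / 2) - z) powr (- N - 1)"
  let ?F = "\<lambda>t::real. - 2 * (cosh (t / 2) - z) powr (- N)"
  have pos: "cosh (t / 2) - z > 0" for t :: real using cosh_real_ge_1[of "t / 2"] z by linarith
  have "(\<integral>\<^sup>+t. ennreal (indicator {0<..} t * ?f t) \<partial>lborel) = (\<integral>\<^sup>+t. ennreal (?f t) * indicator {0..} t \<partial>lborel)"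
  proof (intro nn_integral_cong)
    fix t :: real
    show "ennreal (indicator {0<..} t * ?f t) = ennreal (?f t) * indicator {0..} t"
      by (cases "t = 0") (auto split: split_indicator)
  qed
  also have "\<dots> = ennreal (0 - ?F 0)"
  proof (rule nn_integral_FTC_atLeast)
    show "?f \<in> borel_measurable borel"
      using pos by (intro borel_measurable_continuous_onI continuous_intros) (auto simp: less_imp_neq[THEN not_sym])
    fix t :: real assume "0 \<le> t"
    show "(?F has_real_derivative ?f t) (at t)"
      by (rule derivative_eq_intros refl | use pos[of t] in simp)+
    show "0 \<le> ?f t" using N \<open>0 \<le> t\<close> by simp
  next
    have "filterlim (\<lambda>t::real. cosh (t / 2) - z) at_top at_top"
    proof (rule filterlim_at_top_mono)
      show "filterlim (\<lambda>t::real. t / 4 - z) at_top at_top"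
        by (rule filterlim_tendsto_add_at_top[of "\<lambda>_. - z" "- z" at_top "\<lambda>t. t / 4", simplified])
           (rule filterlim_at_top_mult_tendsto_pos[of "\<lambda>_. 1 / 4" "1 / 4" _ "\<lambda>t. t", simplified], auto simp: filterlim_ident)
      show "eventually (\<lambda>t::real. t / 4 - z \<le> cosh (t / 2) - z) at_top"
      proof (rule always_eventually, rule allI)
        fix t :: real
        have "t / 4 = (t / 2) / 2" by simp
        also have "\<dots> \<le> exp (t / 2) / 2" using exp_ge_add_one_self[of "t / 2"] by linarith
        also have "\<dots> \<le> (exp (t / 2) + exp (- (t / 2))) / 2" by simp
        also have "\<dots> = cosh (t / 2)" by (rule cosh_field_def[symmetric])
        finally show "t / 4 - z \<le> cosh (t / 2) - z" by simp
      qed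
    qed
    then have "((\<lambda>t::real. (cosh (t / 2) - z) powr (- N)) \<longlongrightarrow> 0) at_top"
      using N by (intro tendsto_neg_powr) auto
    from tendsto_mult[OF tendsto_const this, of "-2"] show "(?F \<longlongrightarrow> 0) at_top" by simp
  qed
  finally show ?thesis by simp
qed

lemma jz_eq:
  "jz \<theta> \<phi> (x, y) = sin (\<theta> / 2) * sin (\<phi> / 2) + cos (\<theta> / 2) * cos (\<phi> / 2) - sin (\<theta> / 2) * sin (\<phi> / 2) * x - cos (\<theta> / 2) * cos (\<phi> / 2) * y"
  by (simp add: jz_def jacobi_z_def algebra_simps)

lemma half_angle_pos:
  assumes "\<theta> \<in> {0<..<pi}"
  shows "sin (\<theta> / 2) > 0" "cos (\<theta> / 2) > 0"
  using assms by (auto intro!: sin_gt_zero cos_gt_zero)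

lemma jz_le_cos:
  assumes "\<theta> \<in> {0<..<pi}" "\<phi> \<in> {0<..<pi}" "w \<in> {0<..<2} \<times> {0<..<2}"
  shows "jz \<theta> \<phi> w \<le> cos ((\<theta> - \<phi>) / 2)"
proof -
  obtain x y where w: "w = (x, y)" "0 < x" "0 < y" using assms(3) by auto
  have "sin (\<theta> / 2) * sin (\<phi> / 2) * x \<ge> 0" "cos (\<theta> / 2) * cos (\<phi> / 2) * y \<ge> 0"
    using w half_angle_pos[OF assms(1)] half_angle_pos[OF assms(2)] by auto
  then show ?thesis unfolding w jz_eq by (simp add: diff_divide_distrib cos_diff)
qed

lemma cos_half_diff_less_1:
  assumes "\<theta> \<in> {0<..<pi}" "\<phi> \<in> {0<..<pi}" "\<theta> \<noteq> \<phi>"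
  shows "cos ((\<theta> - \<phi>) / 2) < 1"
proof -
  have "0 < \<bar>(\<theta> - \<phi>) / 2\<bar>" "\<bar>(\<theta> - \<phi>) / 2\<bar> \<le> pi" using assms by auto
  then have "cos \<bar>(\<theta> - \<phi>) / 2\<bar> < cos 0" by (intro cos_monotone_0_pi) auto
  then show ?thesis by (simp only: cos_abs_real cos_zero)
qed

text \<open>Fubini applies because the factor depending on t is nonnegative with an explicit
  integral, and off the diagonal 1 - z is bounded below by 1 - cos((\<theta> - \<phi>) / 2) > 0. The
  factor 2 of the t-integral turns 2^(1 - N) into 2^(2 - N).\<close>

lemma jacobi_riesz_integral:
  fixes \<alpha> \<beta> :: real
  assumes a: "\<alpha> > - 1 / 2" and b: "\<beta> > - 1 / 2"
    and \<theta>: "\<theta> \<in> {0<..<pi}" and \<phi>: "\<phi> \<in> {0<..<pi}" and ne: "\<theta> \<noteq> \<phi>"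
  defines "N \<equiv> \<alpha> + \<beta> + 2"
  shows "jacobi_riesz \<alpha> \<beta> \<theta> \<phi> = 2 powr (2 - N) * Gamma N / (pi * Gamma (\<alpha> + 1 / 2) * Gamma (\<beta> + 1 / 2)) *
    (\<integral>w. (1 - jz \<theta> \<phi> w) powr (- N) * jz_d \<theta> \<phi> w \<partial>jacobi_square (\<alpha> + 1 / 2) (\<beta> + 1 / 2))"
proof -
  let ?M = "jacobi_square (\<alpha> + 1 / 2) (\<beta> + 1 / 2)"
  have ab: "\<alpha> + 1/2 > 0" "\<beta> + 1/2 > 0" using a b by auto
  have N: "N > 0" using a b by (simp add: N_def)
  interpret M: finite_measure ?M by (rule finite_measure_jacobi_square[OF ab])
  interpret P: pair_sigma_finite ?M lborel by (simp add: pair_sigma_finite_def M.sigma_finite_measure_axioms lborel.sigma_finite_measure_axioms)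
  define c where "c = 2 powr (1 - N) * Gamma N / (pi * Gamma (\<alpha> + 1 / 2) * Gamma (\<beta> + 1 / 2))"
  define z0 where "z0 = cos ((\<theta> - \<phi>) / 2)"
  have z0: "z0 < 1" using cos_half_diff_less_1[OF \<theta> \<phi> ne] by (simp add: z0_def)
  have jz: "jz \<theta> \<phi> w \<le> z0" if "w \<in> {0<..<2} \<times> {0<..<2}" for w
    using jz_le_cos[OF \<theta> \<phi> that] by (simp add: z0_def)
  define f where "f w t = indicator {0<..} t * (N * sinh (t / 2) * (cosh (t / 2) - jz \<theta> \<phi> w) powr (- N - 1) * jz_d \<theta> \<phi> w)" for w and t :: real
  define g where "g w t = indicator {0<..} t * (N * sinh (t / 2) * (cosh (t / 2) - jz \<theta> \<phi> w) powr (- N - 1))" for w and t :: real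
  have fg: "f w t = g w t * jz_d \<theta> \<phi> w" for w t by (simp add: f_def g_def)
  have g0: "g w t \<ge> 0" for w t using N by (auto simp: g_def split: split_indicator)
  have g_meas [measurable]: "g w \<in> borel_measurable borel" for w
    unfolding g_def by measurable
  have g_nn: "(\<integral>\<^sup>+t. ennreal (g w t) \<partial>lborel) = ennreal (2 * (1 - jz \<theta> \<phi> w) powr (- N))" if "w \<in> {0<..<2} \<times> {0<..<2}" for w
    unfolding g_def using jz[OF that] z0 N by (intro nn_integral_sinh_cosh_powr) auto
  have g_int: "integrable lborel (g w)" if "w \<in> {0<..<2} \<times> {0<..<2}" for w
    by (rule integrableI_nonneg) (use g0 g_nn[OF that] in auto)
  have g_val: "(\<integral>t. g w t \<partial>lborel) = 2 * (1 - jz \<theta> \<phi> w) powr (- N)" if "w \<in> {0<..<2} \<times> {0<..<2}" for w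
    using g0 g_nn[OF that] by (subst integral_eq_nn_integral) auto
  have f_val: "(\<integral>t. f w t \<partial>lborel) = 2 * (1 - jz \<theta> \<phi> w) powr (- N) * jz_d \<theta> \<phi> w" if "w \<in> {0<..<2} \<times> {0<..<2}" for w
    unfolding fg using g_val[OF that] by simp
  have f_meas: "case_prod f \<in> borel_measurable (?M \<Otimes>\<^sub>M lborel)"
  proof -
    have [measurable]: "jz \<theta> \<phi> \<in> borel_measurable ?M" "jz_d \<theta> \<phi> \<in> borel_measurable ?M"
      by (auto simp: measurable_cong_sets[OF sets_jacobi_square refl])
    show ?thesis unfolding f_def split_def by measurable
  qed
  have f_int: "integrable (?M \<Otimes>\<^sub>M lborel) (case_prod f)"
  proof (rule P.Fubini_integrable[OF f_meas])
    show "AE w in ?M. integrable lborel (\<lambda>t. case_prod f (w, t))"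
      using AE_jacobi_square[OF ab] by eventually_elim (auto simp: fg intro: g_int)
    let ?h = "\<lambda>w. 2 * (1 - jz \<theta> \<phi> w) powr (- N) * \<bar>jz_d \<theta> \<phi> w\<bar>"
    have h_int: "integrable ?M ?h"
    proof (rule integrable_jacobi_square_bounded[OF ab, where C="2 * (1 - z0) powr (- N) * 1"])
      show "?h \<in> borel_measurable borel" by measurable
      fix w :: "real \<times> real" assume w: "w \<in> {0<..<2} \<times> {0<..<2}"
      have "(1 - jz \<theta> \<phi> w) powr (- N) \<le> (1 - z0) powr (- N)"
        using jz[OF w] z0 N by (intro powr_mono2') auto
      then have "2 * (1 - jz \<theta> \<phi> w) powr (- N) * \<bar>jz_d \<theta> \<phi> w\<bar> \<le> 2 * (1 - z0) powr (- N) * 1"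
        using abs_jz_d_le[OF w, of \<theta> \<phi>] by (intro mult_mono) auto
      then show "norm (?h w) \<le> 2 * (1 - z0) powr (- N) * 1" by simp
    qed
    have "integrable ?M (\<lambda>w. \<integral>t. norm (case_prod f (w, t)) \<partial>lborel) \<longleftrightarrow> integrable ?M ?h"
    proof (rule integrable_cong_AE)
      show "(\<lambda>w. \<integral>t. norm (case_prod f (w, t)) \<partial>lborel) \<in> borel_measurable ?M"
        using f_meas by measurable
      show "?h \<in> borel_measurable ?M" using h_int by auto
      show "AE w in ?M. (\<integral>t. norm (case_prod f (w, t)) \<partial>lborel) = ?h w"
        using AE_jacobi_square[OF ab]
        by eventually_elim (use g_val g0 in \<open>simp add: fg abs_mult\<close>)
    qed
    with h_int show "integrable ?M (\<lambda>w. \<integral>t. norm (case_prod f (w, t)) \<partial>lborel)" by simp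
  qed
  have "jacobi_riesz \<alpha> \<beta> \<theta> \<phi> = (\<integral>t. c * (\<integral>w. f w t \<partial>?M) \<partial>lborel)"
    unfolding jacobi_riesz_def set_lebesgue_integral_def
  proof (intro Bochner_Integration.integral_cong refl)
    fix t :: real
    show "indicat_real {0<..} t *\<^sub>R deriv (\<lambda>x. jacobi_poisson \<alpha> \<beta> t x \<phi>) \<theta> = c * (\<integral>w. f w t \<partial>?M)"
    proof (cases "t > 0")
      case True
      then show ?thesis using jacobi_poisson_deriv[OF a b True, of \<phi> \<theta>] by (simp add: f_def c_def N_def)
    qed (simp add: f_def)
  qed
  also have "\<dots> = c * (\<integral>t. (\<integral>w. f w t \<partial>?M) \<partial>lborel)" by simp
  also have "(\<integral>t. (\<integral>w. f w t \<partial>?M) \<partial>lborel) = (\<integral>w. (\<integral>t. f w t \<partial>lborel) \<partial>?M)"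
    by (rule P.Fubini_integral[OF f_int])
  also have "\<dots> = (\<integral>w. 2 * ((1 - jz \<theta> \<phi> w) powr (- N) * jz_d \<theta> \<phi> w) \<partial>?M)"
  proof (rule integral_cong_AE)
    show "(\<lambda>w. \<integral>t. f w t \<partial>lborel) \<in> borel_measurable ?M"
      using P.integrable_fst'[OF f_int] by auto
    show "(\<lambda>w. 2 * ((1 - jz \<theta> \<phi> w) powr (- N) * jz_d \<theta> \<phi> w)) \<in> borel_measurable ?M"
      by (simp add: measurable_cong_sets[OF sets_jacobi_square refl])
    show "AE w in ?M. (\<integral>t. f w t \<partial>lborel) = 2 * ((1 - jz \<theta> \<phi> w) powr (- N) * jz_d \<theta> \<phi> w)"
      using AE_jacobi_square[OF ab] by eventually_elim (simp add: f_val)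
  qed
  also have "\<dots> = 2 * (\<integral>w. (1 - jz \<theta> \<phi> w) powr (- N) * jz_d \<theta> \<phi> w \<partial>?M)" by simp
  also have "c * \<dots> = 2 powr (2 - N) * Gamma N / (pi * Gamma (\<alpha> + 1 / 2) * Gamma (\<beta> + 1 / 2)) * (\<integral>w. (1 - jz \<theta> \<phi> w) powr (- N) * jz_d \<theta> \<phi> w \<partial>?M)"
  proof -
    have "2 powr (2 - N) = 2 * 2 powr (1 - N)" using powr_add[of 2 1 "1 - N"] by simp
    then show ?thesis unfolding c_def by simp
  qed
  finally show ?thesis .
qed

section \<open>Majorants with uniformly bounded integrals\<close>

text \<open>The exponents \<open>e\<close> and \<open>f\<close> count the factors \<open>x\<close> and \<open>y\<close>, each divided by the size \<open>(1 + p) D / A\<close> resp.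
  \<open>(1 + q) D / B\<close> up to which it acts as a constant under the integral; \<open>m\<close> counts derivatives of the power of \<open>1 - z\<close>.
  The squared factors are free, because the weight decays like \<open>(1 - x / 2) powr p\<close> away from \<open>x = 0\<close>.\<close>
definition jacobi_majorant :: "real \<Rightarrow> real \<Rightarrow> nat \<Rightarrow> real \<Rightarrow> real \<Rightarrow> real \<Rightarrow> real \<Rightarrow> real \<Rightarrow> real \<Rightarrow> real \<times> real \<Rightarrow> real" where
  "jacobi_majorant e f m p q A B D N w =
     N ^ m * D ^ (m + 1) * (A * fst w / ((1 + p) * D)) powr e * (B * snd w / ((1 + q) * D)) powr f *
     ((1 + (1 + p) * fst w)\<^sup>2 * (1 + (1 + q) * snd w)\<^sup>2) * (D + B * snd w + A * fst w) powr (- (N + real m))"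

text \<open>The common size of the integrals of all majorants. Multiplied by the normalising
  constant and both weights it reduces to a fixed multiple of (D + A)^(-w1) (D + B)^(-w2), which is
  at most a constant times |\<theta> - \<phi>| over the ball measure.\<close>

definition jacobi_scale :: "real \<Rightarrow> real \<Rightarrow> real \<Rightarrow> real \<Rightarrow> real \<Rightarrow> real \<Rightarrow> real \<Rightarrow> real \<Rightarrow> real" where
  "jacobi_scale w1 w2 p q A B D N = 2 powr (p + q) * (Gamma (p + w1) * Gamma (q + w2) / Gamma N) * A powr (- p) * B powr (- q)
      * (D + A) powr (- w1) * (D + B) powr (- w2)"

lemma jacobi_majorant_measurable [measurable]: "jacobi_majorant e f m p q A B D N \<in> borel_measurable borel"
proof -
  have [measurable]: "fst \<in> borel_measurable (borel :: (real \<times> real) measure)" "snd \<in> borel_measurable (borel :: (real \<times> real) measure)"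
    by (intro borel_measurable_continuous_onI continuous_intros)+
  show ?thesis unfolding jacobi_majorant_def by measurable
qed

text \<open>The prefactors of the majorant are the inverses of the factors depending on e, f and m
  in \<open>weighted_kernel_integral_bound\<close>, so every admissible choice of exponents leads to
  the same scale.\<close>

lemma nn_integral_jacobi_majorant:
  fixes w1 w2 e f K :: real and m :: nat
  assumes w: "w1 > 0" "w2 > 0" and e: "\<bar>e\<bar> \<le> 1" and f: "\<bar>f\<bar> \<le> 1" and m: "m \<le> 1"
    and \<kappa>: "1 + real m - e - f > 0" and K: "K \<ge> 0"
  shows "\<exists>C>0. \<forall>p q A B D N. (p = 0 \<and> e \<ge> 0 \<or> p \<ge> 1) \<longrightarrow> (q = 0 \<and> f \<ge> 0 \<or> q \<ge> 1) \<longrightarrow> q \<le> K * (1 + p) \<longrightarrow>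
    A > 0 \<longrightarrow> B > 0 \<longrightarrow> D > 0 \<longrightarrow> N = p + q + w1 + w2 + 1 \<longrightarrow>
    (\<integral>\<^sup>+w. ennreal (jacobi_majorant e f m p q A B D N w) \<partial>jacobi_square (p + w1) (q + w2))
      \<le> ennreal (C * jacobi_scale w1 w2 p q A B D N)"
proof -
  obtain C where C: "C > 0" "\<And>p q A B D N. (p = 0 \<and> e \<ge> 0 \<or> p \<ge> 1) \<Longrightarrow> (q = 0 \<and> f \<ge> 0 \<or> q \<ge> 1) \<Longrightarrow> q \<le> K * (1 + p) \<Longrightarrow>
    A > 0 \<Longrightarrow> B > 0 \<Longrightarrow> D > 0 \<Longrightarrow> N = p + q + w1 + w2 + 1 \<Longrightarrow>
    (\<integral>\<^sup>+y\<in>{0<..<2}. ennreal (jacobi_weight (q + w2) y * (1 + (1 + q) * y)\<^sup>2 * y powr f) *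
       (\<integral>\<^sup>+x\<in>{0<..<2}. ennreal (jacobi_weight (p + w1) x * (1 + (1 + p) * x)\<^sup>2 * x powr e) *
          ennreal ((D + B * y + A * x) powr (- (N + real m))) \<partial>lborel) \<partial>lborel)
     \<le> ennreal (C * (2 powr (p + q) * (Gamma (p + w1) * Gamma (q + w2) / (N ^ m * Gamma N))
          * ((1 + p) powr e * (1 + q) powr f) * A powr (- (p + e)) * B powr (- (q + f))
          * (D + A) powr (- w1) * (D + B) powr (- w2) * D powr (- (1 + real m - e - f))))"
    using weighted_kernel_integral_bound[OF w e f m \<kappa> K] by blast
  show ?thesis
  proof (intro exI[of _ C] conjI allI impI)
    show "C > 0" by (rule C)
    fix p q A B D N :: real
    assume p: "p = 0 \<and> e \<ge> 0 \<or> p \<ge> 1" and q: "q = 0 \<and> f \<ge> 0 \<or> q \<ge> 1" and qp: "q \<le> K * (1 + p)"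
      and A: "A > 0" and B: "B > 0" and D: "D > 0" and N: "N = p + q + w1 + w2 + 1"
    have pq: "p \<ge> 0" "q \<ge> 0" "p + w1 > 0" "q + w2 > 0" using p q w by auto
    have Np: "N > 0" using pq w N by simp
    define s where "s = N ^ m * D powr (1 + real m - e - f) * A powr e * B powr f * (1 + p) powr (- e) * (1 + q) powr (- f)"
    have s: "s \<ge> 0" using Np by (simp add: s_def)
    let ?a = "\<lambda>x. jacobi_weight (p + w1) x * (1 + (1 + p) * x)\<^sup>2 * x powr e"
    let ?b = "\<lambda>y. jacobi_weight (q + w2) y * (1 + (1 + q) * y)\<^sup>2 * y powr f"
    let ?k = "\<lambda>x y. (D + B * y + A * x) powr (- (N + real m))"
    have eq: "jacobi_majorant e f m p q A B D N (x, y) = s * ((1 + (1 + p) * x)\<^sup>2 * x powr e) * ((1 + (1 + q) * y)\<^sup>2 * y powr f) * ?k x y" if "0 < x" "0 < y" for x y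
    proof -
      have 1: "(A * x / ((1 + p) * D)) powr e = A powr e * x powr e * (1 + p) powr (- e) * D powr (- e)"
        using A D pq that by (simp add: powr_divide powr_mult powr_minus divide_simps)
      have 2: "(B * y / ((1 + q) * D)) powr f = B powr f * y powr f * (1 + q) powr (- f) * D powr (- f)"
        using B D pq that by (simp add: powr_divide powr_mult powr_minus divide_simps)
      have "D powr (1 + real m - e - f) = D powr (real (m + 1)) * D powr (- e) * D powr (- f)"
        by (simp flip: powr_add add: algebra_simps)
      also have "D powr (real (m + 1)) = D ^ (m + 1)" using D by (rule powr_realpow)
      finally show ?thesis unfolding jacobi_majorant_def s_def fst_conv snd_conv 1 2 by (simp only: mult_ac)
    qed
    have "(\<integral>\<^sup>+w. ennreal (jacobi_majorant e f m p q A B D N w) \<partial>jacobi_square (p + w1) (q + w2))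
      = (\<integral>\<^sup>+y\<in>{0<..<2}. ennreal (jacobi_weight (q + w2) y) * (\<integral>\<^sup>+x\<in>{0<..<2}. ennreal (jacobi_weight (p + w1) x) * ennreal (jacobi_majorant e f m p q A B D N (x, y)) \<partial>lborel) \<partial>lborel)"
      using pq by (intro nn_integral_jacobi_square) auto
    also have "\<dots> = (\<integral>\<^sup>+y. ennreal s * (ennreal (?b y) * (\<integral>\<^sup>+x\<in>{0<..<2}. ennreal (?a x) * ennreal (?k x y) \<partial>lborel) * indicator {0<..<2} y) \<partial>lborel)"
    proof (intro nn_integral_cong)
      fix y :: real
      show "ennreal (jacobi_weight (q + w2) y) * (\<integral>\<^sup>+x\<in>{0<..<2}. ennreal (jacobi_weight (p + w1) x) * ennreal (jacobi_majorant e f m p q A B D N (x, y)) \<partial>lborel) * indicator {0<..<2} y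
         = ennreal s * (ennreal (?b y) * (\<integral>\<^sup>+x\<in>{0<..<2}. ennreal (?a x) * ennreal (?k x y) \<partial>lborel) * indicator {0<..<2} y)"
      proof (cases "0 < y \<and> y < 2")
        case True
        define b where "b = (1 + (1 + q) * y)\<^sup>2 * y powr f"
        have b: "b \<ge> 0" by (simp add: b_def)
        have "(\<integral>\<^sup>+x\<in>{0<..<2}. ennreal (jacobi_weight (p + w1) x) * ennreal (jacobi_majorant e f m p q A B D N (x, y)) \<partial>lborel)
          = (\<integral>\<^sup>+x. ennreal (s * b) * (ennreal (?a x) * ennreal (?k x y) * indicator {0<..<2} x) \<partial>lborel)"
        proof (intro nn_integral_cong)
          fix x :: real
          have "jacobi_weight (p + w1) x * jacobi_majorant e f m p q A B D N (x, y) = s * b * (?a x * ?k x y)" if "0 < x"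
            unfolding b_def eq[OF that conjunct1[OF True]] by (simp only: mult_ac)
          then show "ennreal (jacobi_weight (p + w1) x) * ennreal (jacobi_majorant e f m p q A B D N (x, y)) * indicator {0<..<2} x
             = ennreal (s * b) * (ennreal (?a x) * ennreal (?k x y) * indicator {0<..<2} x)"
            using s b by (auto split: split_indicator simp: ennreal_mult'[symmetric])
        qed
        also have "\<dots> = ennreal (s * b) * (\<integral>\<^sup>+x\<in>{0<..<2}. ennreal (?a x) * ennreal (?k x y) \<partial>lborel)"
          by (intro nn_integral_cmult) measurable
        finally have "ennreal (jacobi_weight (q + w2) y) * (\<integral>\<^sup>+x\<in>{0<..<2}. ennreal (jacobi_weight (p + w1) x) * ennreal (jacobi_majorant e f m p q A B D N (x, y)) \<partial>lborel)
           = (ennreal (jacobi_weight (q + w2) y) * ennreal (s * b)) * (\<integral>\<^sup>+x\<in>{0<..<2}. ennreal (?a x) * ennreal (?k x y) \<partial>lborel)"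
          by (simp only: mult.assoc)
        also have "ennreal (jacobi_weight (q + w2) y) * ennreal (s * b) = ennreal s * ennreal (?b y)"
          using s b by (simp add: ennreal_mult'[symmetric] b_def mult_ac)
        finally show ?thesis using True by (simp add: mult.assoc)
      qed simp
    qed
    also have "\<dots> = ennreal s * (\<integral>\<^sup>+y\<in>{0<..<2}. ennreal (?b y) * (\<integral>\<^sup>+x\<in>{0<..<2}. ennreal (?a x) * ennreal (?k x y) \<partial>lborel) \<partial>lborel)"
      by (intro nn_integral_cmult) measurable
    also have "\<dots> \<le> ennreal s * ennreal (C * (2 powr (p + q) * (Gamma (p + w1) * Gamma (q + w2) / (N ^ m * Gamma N))
          * ((1 + p) powr e * (1 + q) powr f) * A powr (- (p + e)) * B powr (- (q + f))
          * (D + A) powr (- w1) * (D + B) powr (- w2) * D powr (- (1 + real m - e - f))))"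
      by (intro mult_left_mono C(2)[OF p q qp A B D N]) simp
    also have "\<dots> = ennreal (s * (C * (2 powr (p + q) * (Gamma (p + w1) * Gamma (q + w2) / (N ^ m * Gamma N))
          * ((1 + p) powr e * (1 + q) powr f) * A powr (- (p + e)) * B powr (- (q + f))
          * (D + A) powr (- w1) * (D + B) powr (- w2) * D powr (- (1 + real m - e - f)))))"
      by (rule ennreal_mult'[OF s, symmetric])
    also have "s * (C * (2 powr (p + q) * (Gamma (p + w1) * Gamma (q + w2) / (N ^ m * Gamma N))
          * ((1 + p) powr e * (1 + q) powr f) * A powr (- (p + e)) * B powr (- (q + f))
          * (D + A) powr (- w1) * (D + B) powr (- w2) * D powr (- (1 + real m - e - f)))) = C * jacobi_scale w1 w2 p q A B D N"
    proof -
      have c1: "D powr (1 + real m - e - f) * D powr (- (1 + real m - e - f)) = 1" using D by (simp flip: powr_add)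
      have c2: "A powr e * A powr (- (p + e)) = A powr (- p)" "B powr f * B powr (- (q + f)) = B powr (- q)"
        by (simp_all flip: powr_add)
      have c3: "(1 + p) powr (- e) * (1 + p) powr e = 1" "(1 + q) powr (- f) * (1 + q) powr f = 1"
        using pq by (simp_all flip: powr_add)
      have c4: "N ^ m * (Gamma (p + w1) * Gamma (q + w2) / (N ^ m * Gamma N)) = Gamma (p + w1) * Gamma (q + w2) / Gamma N"
        using Np by simp
      have "s * (C * (2 powr (p + q) * (Gamma (p + w1) * Gamma (q + w2) / (N ^ m * Gamma N))
          * ((1 + p) powr e * (1 + q) powr f) * A powr (- (p + e)) * B powr (- (q + f))
          * (D + A) powr (- w1) * (D + B) powr (- w2) * D powr (- (1 + real m - e - f))))
        = C * 2 powr (p + q) * (N ^ m * (Gamma (p + w1) * Gamma (q + w2) / (N ^ m * Gamma N)))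
          * ((1 + p) powr (- e) * (1 + p) powr e) * ((1 + q) powr (- f) * (1 + q) powr f)
          * (A powr e * A powr (- (p + e))) * (B powr f * B powr (- (q + f)))
          * (D powr (1 + real m - e - f) * D powr (- (1 + real m - e - f))) * (D + A) powr (- w1) * (D + B) powr (- w2)"
        unfolding s_def by (simp only: mult_ac)
      also have "\<dots> = C * jacobi_scale w1 w2 p q A B D N"
        unfolding c1 c2 c3 c4 jacobi_scale_def by simp
      finally show ?thesis .
    qed
    finally show "(\<integral>\<^sup>+w. ennreal (jacobi_majorant e f m p q A B D N w) \<partial>jacobi_square (p + w1) (q + w2))
      \<le> ennreal (C * jacobi_scale w1 w2 p q A B D N)" .
  qed
qed

text \<open>A function that fails to be integrable has integral 0 by convention, so a bound for the
  nonnegative integral of the norm suffices.\<close>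

lemma norm_integral_le_nn_integral:
  fixes f :: "'w \<Rightarrow> 'b::{banach, second_countable_topology}"
  assumes "(\<integral>\<^sup>+w. ennreal (norm (f w)) \<partial>M) \<le> ennreal C" "C \<ge> 0"
  shows "norm (\<integral>w. f w \<partial>M) \<le> C"
proof (cases "integrable M f")
  case True
  from integral_norm_bound_ennreal[OF this] assms(1) have "ennreal (norm (\<integral>w. f w \<partial>M)) \<le> ennreal C" by (rule order_trans)
  then show ?thesis using assms(2) by simp
qed (use assms(2) in \<open>simp add: not_integrable_integral_eq\<close>)

text \<open>The constant depends on the list \<open>T\<close> of exponents and is fixed before p, q,
  the angles and the integrand. The condition 1 + m - e - f > 0 is the positivity of \<kappa> in the
  Dirichlet integral; a negative exponent excludes the value 0 of the corresponding parameter. The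
  factor k carries the constant of a pointwise estimate.\<close>

lemma jacobi_majorant_sum_bound:
  fixes w1 w2 K :: real
  assumes w: "w1 > 0" "w2 > 0" and K: "K \<ge> 0"
    and T: "\<And>e f m. (e, f, m) \<in> set T \<Longrightarrow> \<bar>e\<bar> \<le> 1 \<and> \<bar>f\<bar> \<le> 1 \<and> m \<le> 1 \<and> 1 + real m - e - f > 0"
  shows "\<exists>C>0. \<forall>p q A B D N Q k. (p = 0 \<and> (\<forall>(e, f, m)\<in>set T. e \<ge> 0) \<or> p \<ge> 1) \<longrightarrow> (q = 0 \<and> (\<forall>(e, f, m)\<in>set T. f \<ge> 0) \<or> q \<ge> 1) \<longrightarrow> q \<le> K * (1 + p) \<longrightarrow>
    A > 0 \<longrightarrow> B > 0 \<longrightarrow> D > 0 \<longrightarrow> N = p + q + w1 + w2 + 1 \<longrightarrow> k \<ge> 0 \<longrightarrow>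
    (\<forall>w\<in>{0<..<2} \<times> {0<..<2}. \<bar>Q w\<bar> \<le> k * (\<Sum>(e, f, m)\<leftarrow>T. jacobi_majorant e f m p q A B D N w)) \<longrightarrow>
    \<bar>\<integral>w. Q w \<partial>jacobi_square (p + w1) (q + w2)\<bar> \<le> k * (C * jacobi_scale w1 w2 p q A B D N)"
proof -
  let ?cond = "\<lambda>T p q A B D N. (p = 0 \<and> (\<forall>(e, f, m)\<in>set T. e \<ge> 0) \<or> p \<ge> 1) \<and> (q = 0 \<and> (\<forall>(e, f, m)\<in>set T. f \<ge> 0) \<or> q \<ge> 1) \<and> q \<le> K * (1 + p) \<and>
    A > 0 \<and> B > 0 \<and> D > 0 \<and> N = p + q + w1 + w2 + 1"
  have scale: "jacobi_scale w1 w2 p q A B D N \<ge> 0" if "?cond T p q A B D N" for T :: "(real \<times> real \<times> nat) list" and p q A B D N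
  proof -
    have "Gamma (p + w1) > 0" "Gamma (q + w2) > 0" "Gamma N > 0" using that w by (auto intro!: Gamma_real_pos)
    then show ?thesis by (simp add: jacobi_scale_def)
  qed
  have nonneg: "jacobi_majorant e f m p q A B D N w \<ge> 0" if "?cond T p q A B D N" for e f m T p q A B D N w
    using that w by (auto simp: jacobi_majorant_def)
  have "\<exists>C>0. \<forall>p q A B D N. ?cond T p q A B D N \<longrightarrow>
     (\<integral>\<^sup>+w. ennreal (\<Sum>(e, f, m)\<leftarrow>T. jacobi_majorant e f m p q A B D N w) \<partial>jacobi_square (p + w1) (q + w2)) \<le> ennreal (C * jacobi_scale w1 w2 p q A B D N)"
    using T
  proof (induction T)
    case Nil
    then show ?case by (intro exI[of _ 1]) auto
  next
    case (Cons z T)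
    obtain e f m where z: "z = (e, f, m)" by (cases z)
    have zc: "\<bar>e\<bar> \<le> 1" "\<bar>f\<bar> \<le> 1" "m \<le> 1" "1 + real m - e - f > 0" using Cons.prems[of e f m] z by auto
    obtain C1 where C1: "C1 > 0" "\<And>p q A B D N. ?cond T p q A B D N \<Longrightarrow>
     (\<integral>\<^sup>+w. ennreal (\<Sum>(e, f, m)\<leftarrow>T. jacobi_majorant e f m p q A B D N w) \<partial>jacobi_square (p + w1) (q + w2)) \<le> ennreal (C1 * jacobi_scale w1 w2 p q A B D N)"
    proof -
      have "\<bar>e\<bar> \<le> 1 \<and> \<bar>f\<bar> \<le> 1 \<and> m \<le> 1 \<and> 1 + real m - e - f > 0" if "(e, f, m) \<in> set T" for e f m
        using Cons.prems that by (meson list.set_intros(2))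
      from Cons.IH[OF this] show ?thesis using that by blast
    qed
    obtain C2 where C2: "C2 > 0" "\<And>p q A B D N. (p = 0 \<and> e \<ge> 0 \<or> p \<ge> 1) \<Longrightarrow> (q = 0 \<and> f \<ge> 0 \<or> q \<ge> 1) \<Longrightarrow> q \<le> K * (1 + p) \<Longrightarrow>
      A > 0 \<Longrightarrow> B > 0 \<Longrightarrow> D > 0 \<Longrightarrow> N = p + q + w1 + w2 + 1 \<Longrightarrow>
      (\<integral>\<^sup>+w. ennreal (jacobi_majorant e f m p q A B D N w) \<partial>jacobi_square (p + w1) (q + w2)) \<le> ennreal (C2 * jacobi_scale w1 w2 p q A B D N)"
      using nn_integral_jacobi_majorant[OF w zc K] by blast
    show ?case
    proof (intro exI[of _ "C1 + C2"] conjI allI impI)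
      show "C1 + C2 > 0" using C1 C2 by simp
      fix p q A B D N :: real assume c: "?cond (z # T) p q A B D N"
      then have c': "?cond T p q A B D N" by (auto simp: z)
      let ?M = "jacobi_square (p + w1) (q + w2)"
      have meas: "jacobi_majorant e f m p q A B D N \<in> borel_measurable ?M" for e f m
        by (simp add: measurable_cong_sets[OF sets_jacobi_square refl])
      have sum_meas: "(\<lambda>w. \<Sum>(e, f, m)\<leftarrow>T. jacobi_majorant e f m p q A B D N w) \<in> borel_measurable ?M" for T
        by (induction T) (use meas in auto)
      have sum_nn: "0 \<le> (\<Sum>(e, f, m)\<leftarrow>T. jacobi_majorant e f m p q A B D N w)" for w
      proof (rule sum_list_nonneg)
        fix u assume "u \<in> set (map (\<lambda>(e, f, m). jacobi_majorant e f m p q A B D N w) T)"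
        then show "0 \<le> u" using nonneg[OF c', of _ _ _ w] by (auto simp only: set_map image_iff split_beta)
      qed
      have "(\<integral>\<^sup>+w. ennreal (\<Sum>(e, f, m)\<leftarrow>z # T. jacobi_majorant e f m p q A B D N w) \<partial>?M)
        = (\<integral>\<^sup>+w. ennreal (jacobi_majorant e f m p q A B D N w) + ennreal (\<Sum>(e, f, m)\<leftarrow>T. jacobi_majorant e f m p q A B D N w) \<partial>?M)"
        using nonneg[OF c'] sum_nn by (intro nn_integral_cong) (simp add: z ennreal_plus)
      also have "\<dots> = (\<integral>\<^sup>+w. ennreal (jacobi_majorant e f m p q A B D N w) \<partial>?M) + (\<integral>\<^sup>+w. ennreal (\<Sum>(e, f, m)\<leftarrow>T. jacobi_majorant e f m p q A B D N w) \<partial>?M)"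
        using meas sum_meas by (intro nn_integral_add) auto
      also have "\<dots> \<le> ennreal (C2 * jacobi_scale w1 w2 p q A B D N) + ennreal (C1 * jacobi_scale w1 w2 p q A B D N)"
        using c by (intro add_mono C1(2)[OF c'] C2(2)) (auto simp: z)
      also have "\<dots> = ennreal ((C1 + C2) * jacobi_scale w1 w2 p q A B D N)"
        using C1(1) C2(1) scale[OF c] by (simp add: ennreal_plus[symmetric] algebra_simps del: ennreal_plus)
      finally show "(\<integral>\<^sup>+w. ennreal (\<Sum>(e, f, m)\<leftarrow>z # T. jacobi_majorant e f m p q A B D N w) \<partial>?M) \<le> ennreal ((C1 + C2) * jacobi_scale w1 w2 p q A B D N)" .
    qed
  qed
  then obtain C where C: "C > 0" "\<And>p q A B D N. ?cond T p q A B D N \<Longrightarrow>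
     (\<integral>\<^sup>+w. ennreal (\<Sum>(e, f, m)\<leftarrow>T. jacobi_majorant e f m p q A B D N w) \<partial>jacobi_square (p + w1) (q + w2)) \<le> ennreal (C * jacobi_scale w1 w2 p q A B D N)"
    by blast
  show ?thesis
  proof (intro exI[of _ C] conjI allI impI C(1))
    fix p q A B D N k :: real and Q :: "real \<times> real \<Rightarrow> real"
    assume c1: "p = 0 \<and> (\<forall>(e, f, m)\<in>set T. e \<ge> 0) \<or> p \<ge> 1" and c2: "q = 0 \<and> (\<forall>(e, f, m)\<in>set T. f \<ge> 0) \<or> q \<ge> 1"
      and c3: "q \<le> K * (1 + p)" "A > 0" "B > 0" "D > 0" "N = p + q + w1 + w2 + 1" and k: "k \<ge> 0"
      and Q: "\<forall>w\<in>{0<..<2} \<times> {0<..<2}. \<bar>Q w\<bar> \<le> k * (\<Sum>(e, f, m)\<leftarrow>T. jacobi_majorant e f m p q A B D N w)"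
    let ?M = "jacobi_square (p + w1) (q + w2)" let ?S = "\<lambda>w. \<Sum>(e, f, m)\<leftarrow>T. jacobi_majorant e f m p q A B D N w"
    have c: "?cond T p q A B D N" using c1 c2 c3 by simp
    have pw: "p + w1 > 0" "q + w2 > 0" using c1 c2 w by auto
    have meas: "jacobi_majorant e f m p q A B D N \<in> borel_measurable ?M" for e f m
      by (simp add: measurable_cong_sets[OF sets_jacobi_square refl])
    have sum_meas: "(\<lambda>w. \<Sum>(e, f, m)\<leftarrow>T. jacobi_majorant e f m p q A B D N w) \<in> borel_measurable ?M" for T
      by (induction T) (use meas in auto)
    have "(\<integral>\<^sup>+w. ennreal (norm (Q w)) \<partial>?M) \<le> (\<integral>\<^sup>+w. ennreal k * ennreal (?S w) \<partial>?M)"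
    proof (rule nn_integral_mono_AE)
      show "AE w in ?M. ennreal (norm (Q w)) \<le> ennreal k * ennreal (?S w)"
        using AE_jacobi_square[OF pw]
        by eventually_elim (use Q k in \<open>simp only: real_norm_def ennreal_mult'[symmetric] ennreal_leI\<close>)
    qed
    also have "\<dots> = ennreal k * (\<integral>\<^sup>+w. ennreal (?S w) \<partial>?M)" using sum_meas by (intro nn_integral_cmult) auto
    also have "\<dots> \<le> ennreal k * ennreal (C * jacobi_scale w1 w2 p q A B D N)" by (intro mult_left_mono C(2)[OF c]) simp
    also have "\<dots> = ennreal (k * (C * jacobi_scale w1 w2 p q A B D N))" using k by (rule ennreal_mult'[symmetric])
    finally show "\<bar>\<integral>w. Q w \<partial>?M\<bar> \<le> k * (C * jacobi_scale w1 w2 p q A B D N)"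
      using norm_integral_le_nn_integral[of ?M Q "k * (C * jacobi_scale w1 w2 p q A B D N)"] k C(1) scale[OF c] by simp
  qed
qed

section \<open>Pointwise comparison with the majorants\<close>

text \<open>\<open>\<Xi>\<close> stands for a bound of the first derivatives of z. A term linear in
  it needs the exponent 1/2, since exponent 1 with m = 0 would make \<kappa> vanish; its square
  comes with m = 1, which admits exponent 1. The last two estimates serve the logarithmic
  derivatives of the weights, whose factors p and q are paid for by the exponent -1.\<close>

lemma jacobi_majorant_pointwise:
  fixes p q A B D N x y \<Xi> :: real
  assumes pq: "p \<ge> 0" "q \<ge> 0" and A: "A > 0" and B: "B > 0" and D: "D > 0" and N: "N \<ge> 0" and x: "0 < x" and y: "0 < y"
    and \<Xi>: "0 \<le> \<Xi>" "\<Xi> \<le> k * (sqrt D + x * sqrt A + y * sqrt B)" and k: "k \<ge> 0"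
  defines "E \<equiv> D + B * y + A * x" and "\<Psi> \<equiv> \<lambda>e f m. jacobi_majorant e f m p q A B D N (x, y)"
  shows "sqrt D * (E powr (- N) * \<Xi>) \<le> k * (\<Psi> 0 0 0 + \<Psi> (1/2) 0 0 + \<Psi> 0 (1/2) 0)"
    and "D * (N * E powr (- N - 1) * \<Xi>\<^sup>2) \<le> 3 * k\<^sup>2 * (\<Psi> 0 0 1 + \<Psi> 1 0 1 + \<Psi> 0 1 1)"
    and "D * E powr (- N) \<le> \<Psi> 0 0 0"
    and "p * ((sqrt A + sqrt D) / A) * (D * (E powr (- N) * \<Xi>)) \<le> 4 * k * (\<Psi> 0 0 0 + \<Psi> (- 1) 0 0 + \<Psi> (- 1) 1 0)"
    and "q * ((sqrt B + sqrt D) / B) * (D * (E powr (- N) * \<Xi>)) \<le> 4 * k * (\<Psi> 0 0 0 + \<Psi> 0 (- 1) 0 + \<Psi> 1 (- 1) 0)"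
proof -
  \<comment> \<open>Square roots of the normalised factors of the majorant: half-integer exponents
    become polynomials in a and b, and x sqrt A equals sqrt D times a times sqrt((1 + p) x), the
    last factor being at most R.\<close>
  define a where "a = sqrt (A * x / ((1 + p) * D))"
  define b where "b = sqrt (B * y / ((1 + q) * D))"
  define R where "R = 1 + (1 + p) * x"
  define S where "S = 1 + (1 + q) * y"
  have ab: "a > 0" "b > 0" using A B D pq x y by (auto simp: a_def b_def)
  have a2: "a\<^sup>2 = A * x / ((1 + p) * D)" and b2: "b\<^sup>2 = B * y / ((1 + q) * D)" using A B D pq x y by (auto simp: a_def b_def)
  have RS: "R \<ge> 1" "S \<ge> 1" using pq x y by (auto simp: R_def S_def)
  define T where "T = R\<^sup>2 * S\<^sup>2"
  have R2: "R \<le> R\<^sup>2" "S \<le> S\<^sup>2" "1 \<le> R\<^sup>2" "1 \<le> S\<^sup>2" using RS by (auto intro: self_le_power one_le_power)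
  have T1: "1 \<le> T" unfolding T_def using R2 mult_mono[of 1 "R\<^sup>2" 1 "S\<^sup>2"] by simp
  have TR: "R \<le> T" unfolding T_def using R2 RS mult_mono[of R "R\<^sup>2" 1 "S\<^sup>2"] by simp
  have TS: "S \<le> T" unfolding T_def using R2 RS mult_mono[of 1 "R\<^sup>2" S "S\<^sup>2"] by simp
  have sq1: "sqrt t \<le> 1 + t" if "t \<ge> 0" for t
    by (rule real_le_lsqrt) (use that in \<open>auto simp: power2_eq_square algebra_simps\<close>)
  have sR: "sqrt ((1 + p) * x) \<le> R" and sS: "sqrt ((1 + q) * y) \<le> S"
    unfolding R_def S_def using pq x y by (auto intro!: sq1)
  have sqrt_eq: "x * sqrt A = sqrt D * (sqrt ((1 + p) * x) * sqrt (A * x / ((1 + p) * D)))"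
    if "p \<ge> 0" "A > 0" "x > 0" for p A x
  proof -
    have "D * ((1 + p) * x * (A * x / ((1 + p) * D))) = x\<^sup>2 * A" using that D by (simp add: power2_eq_square)
    moreover have "sqrt D * (sqrt ((1 + p) * x) * sqrt (A * x / ((1 + p) * D))) = sqrt (D * ((1 + p) * x * (A * x / ((1 + p) * D))))"
      by (simp only: real_sqrt_mult)
    ultimately show ?thesis using that by (simp add: real_sqrt_mult)
  qed
  note xa = sqrt_eq[OF pq(1) A x, folded a_def]
  note yb = sqrt_eq[OF pq(2) B y, folded b_def]
  have \<Psi>: "\<Psi> e f m = N ^ m * D ^ (m + 1) * (a\<^sup>2) powr e * (b\<^sup>2) powr f * T * E powr (- (N + real m))" for e f m
    unfolding \<Psi>_def jacobi_majorant_def a2 b2 T_def R_def S_def E_def by simp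
  have half: "(a\<^sup>2) powr (1/2) = a" "(b\<^sup>2) powr (1/2) = b" using ab by (simp_all add: powr_half_sqrt)
  have pw: "(a\<^sup>2) powr 1 = a\<^sup>2" "(b\<^sup>2) powr 1 = b\<^sup>2" "(a\<^sup>2) powr 0 = 1" "(b\<^sup>2) powr 0 = 1" "(a\<^sup>2) powr (- 1) = 1 / a\<^sup>2" "(b\<^sup>2) powr (- 1) = 1 / b\<^sup>2"
    using ab by (simp_all add: powr_minus divide_inverse)
  have \<Xi>': "\<Xi> \<le> k * sqrt D * (1 + R * a + S * b)"
  proof -
    have "x * sqrt A \<le> sqrt D * (R * a)" "y * sqrt B \<le> sqrt D * (S * b)"
      unfolding xa yb using sR sS ab D by (intro mult_left_mono mult_right_mono; simp)+
    then have "k * (sqrt D + x * sqrt A + y * sqrt B) \<le> k * (sqrt D + sqrt D * (R * a) + sqrt D * (S * b))"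
      using k by (intro mult_left_mono add_mono) auto
    with \<Xi>(2) show ?thesis by (simp add: algebra_simps)
  qed
  have En: "E powr z \<ge> 0" for z by simp
  have sD: "sqrt D * sqrt D = D" using D by simp
  show "sqrt D * (E powr (- N) * \<Xi>) \<le> k * (\<Psi> 0 0 0 + \<Psi> (1/2) 0 0 + \<Psi> 0 (1/2) 0)"
  proof -
    have "1 + R * a + S * b \<le> T + T * a + T * b"
      using T1 TR TS ab by (intro add_mono mult_right_mono) auto
    then have "k * sqrt D * (1 + R * a + S * b) \<le> k * sqrt D * (T + T * a + T * b)" using k D by (intro mult_left_mono) auto
    with \<Xi>' have "\<Xi> \<le> k * sqrt D * (T + T * a + T * b)" by simp
    then have "sqrt D * E powr (- N) * \<Xi> \<le> sqrt D * E powr (- N) * (k * sqrt D * (T + T * a + T * b))"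
      using D by (intro mult_left_mono) auto
    also have "\<dots> = (sqrt D * sqrt D) * (E powr (- N) * k * (T + T * a + T * b))" by (simp only: mult_ac)
    also have "\<dots> = k * (\<Psi> 0 0 0 + \<Psi> (1/2) 0 0 + \<Psi> 0 (1/2) 0)"
      unfolding sD \<Psi> half pw by (simp add: algebra_simps)
    finally show ?thesis by (simp add: mult.assoc)
  qed
  show "D * E powr (- N) \<le> \<Psi> 0 0 0"
    unfolding \<Psi> pw using T1 D mult_left_mono[of 1 T "D * E powr (- N)"] by (simp add: mult_ac)
  show "D * (N * E powr (- N - 1) * \<Xi>\<^sup>2) \<le> 3 * k\<^sup>2 * (\<Psi> 0 0 1 + \<Psi> 1 0 1 + \<Psi> 0 1 1)"
  proof -
    have sq: "(u + v + w)\<^sup>2 \<le> 3 * (u\<^sup>2 + v\<^sup>2 + w\<^sup>2)" for u v w :: real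
    proof -
      have "0 \<le> (u - v)\<^sup>2 + (v - w)\<^sup>2 + (u - w)\<^sup>2" by simp
      then show ?thesis by (simp add: power2_eq_square algebra_simps)
    qed
    have "\<Xi>\<^sup>2 \<le> (k * sqrt D * (1 + R * a + S * b))\<^sup>2" using \<Xi>(1) \<Xi>' by (intro power_mono)
    also have "\<dots> = k\<^sup>2 * D * (1 + R * a + S * b)\<^sup>2" using D by (simp add: power_mult_distrib)
    also have "\<dots> \<le> k\<^sup>2 * D * (3 * (1\<^sup>2 + (R * a)\<^sup>2 + (S * b)\<^sup>2))" using D by (intro mult_left_mono sq) auto
    also have "\<dots> \<le> k\<^sup>2 * D * (3 * (T + T * a\<^sup>2 + T * b\<^sup>2))"
    proof (intro mult_left_mono add_mono)
      show "(R * a)\<^sup>2 \<le> T * a\<^sup>2" "(S * b)\<^sup>2 \<le> T * b\<^sup>2"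
        unfolding power_mult_distrib T_def using R2 mult_left_mono[of 1 "S\<^sup>2" "R\<^sup>2"] mult_right_mono[of 1 "R\<^sup>2" "S\<^sup>2"]
        by (auto intro!: mult_right_mono)
    qed (use T1 D in auto)
    finally have "D * N * E powr (- N - 1) * \<Xi>\<^sup>2 \<le> D * N * E powr (- N - 1) * (k\<^sup>2 * D * (3 * (T + T * a\<^sup>2 + T * b\<^sup>2)))"
      using D N by (intro mult_left_mono) auto
    also have "\<dots> = 3 * k\<^sup>2 * (\<Psi> 0 0 1 + \<Psi> 1 0 1 + \<Psi> 0 1 1)"
    proof -
      have "- (N + real 1) = - N - 1" by simp
      then show ?thesis unfolding \<Psi> pw by (simp only:) (simp add: algebra_simps power2_eq_square)
    qed
    finally show ?thesis by (simp add: mult.assoc)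
  qed
  \<comment> \<open>Stated for c in place of p or q, as both cases agree up to exchanging the two
    variables. The factor c is compensated by the 1 + c hidden in a: c D / A is at most R / a^2, and
    c sqrt(D / A) is at most R / a. One power of R comes from here and one from
    \<open>\<Xi>\<close>, which is why the majorant carries squares.\<close>
  have cot: "c * ((sqrt A + sqrt D) / A) * (D * (E powr (- N) * \<Xi>)) \<le> 4 * k * (D * E powr (- N) * T * (1 + 1 / a\<^sup>2 + b\<^sup>2 / a\<^sup>2))"
    if c: "c \<ge> 0" and A: "A > 0" and x: "x > 0" and a: "a > 0" and b: "b > 0" and R: "R = 1 + (1 + c) * x" and S: "S \<ge> 1"
      and a2: "a\<^sup>2 = A * x / ((1 + c) * D)" and \<Xi>': "\<Xi> \<le> k * sqrt D * (1 + R * a + S * b)" and T: "T = R\<^sup>2 * S\<^sup>2"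
    for c A x a b R S
  proof -
    have R1: "R \<ge> 1" using R c x by simp
    have DA: "D / A = x / ((1 + c) * a\<^sup>2)" 
    proof -
      have "(1 + c) * (A * x / ((1 + c) * D)) = A * x / D" using c by simp
      then show ?thesis unfolding a2 using A D x by simp
    qed
    have 1: "c * (D / A) \<le> R / a\<^sup>2"
    proof -
      have "c * (D / A) = (c / (1 + c)) * x / a\<^sup>2" unfolding DA by simp
      also have "\<dots> \<le> R / a\<^sup>2"
      proof (intro divide_right_mono)
        have "(c / (1 + c)) * x \<le> 1 * x" using c x by (intro mult_right_mono) auto
        also have "\<dots> \<le> R" unfolding R using c x by (simp add: algebra_simps)
        finally show "c / (1 + c) * x \<le> R" .
      qed simp
      finally show ?thesis .
    qed
    have 2: "c * sqrt (D / A) \<le> R / a"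
    proof -
      have "(c * sqrt (D / A))\<^sup>2 = c\<^sup>2 * (D / A)" using A D by (simp add: power_mult_distrib)
      also have "\<dots> = (c / (1 + c)) * (c * x) / a\<^sup>2" unfolding DA by (simp add: power2_eq_square)
      also have "\<dots> \<le> 1 * R / a\<^sup>2"
        using c x R by (intro divide_right_mono mult_mono) (auto simp: algebra_simps)
      also have "\<dots> \<le> (R / a)\<^sup>2" unfolding power_divide using R1 self_le_power[of R 2] by (intro divide_right_mono) auto
      finally show ?thesis by (rule power2_le_imp_le) (use R1 a in simp)
    qed
    have sA: "sqrt A / A = 1 / sqrt A" "sqrt A * sqrt A = A" using A by (simp_all add: sqrt_divide_self_eq inverse_eq_divide)
    have "c * ((sqrt A + sqrt D) / A) * sqrt D = c * sqrt (D / A) + c * (D / A)"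
    proof -
      have "c * ((sqrt A + sqrt D) / A) * sqrt D = c * (sqrt D * (sqrt A / A)) + c * ((sqrt D * sqrt D) / A)"
        by (simp add: add_divide_distrib algebra_simps)
      then show ?thesis unfolding sA(1) sD by (simp add: real_sqrt_divide)
    qed
    also have "\<dots> \<le> R * (1 / a + 1 / a\<^sup>2)" using 1 2 by (simp add: algebra_simps)
    finally have L: "c * ((sqrt A + sqrt D) / A) * sqrt D \<le> R * (1 / a + 1 / a\<^sup>2)" .
    have M: "1 + R * a + S * b \<le> R * S\<^sup>2 * (1 + a + b)"
    proof -
      have s2: "S \<le> S\<^sup>2" "1 \<le> S\<^sup>2" using S by (auto intro: self_le_power one_le_power)
      have "1 \<le> R * S\<^sup>2" "R \<le> R * S\<^sup>2" "S \<le> R * S\<^sup>2"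
        using R1 s2 mult_mono[of 1 R 1 "S\<^sup>2"] mult_left_mono[of 1 "S\<^sup>2" R] mult_mono[of 1 R S "S\<^sup>2"] S by auto
      then have "1 + R * a + S * b \<le> R * S\<^sup>2 + (R * S\<^sup>2) * a + (R * S\<^sup>2) * b" using a b by (intro add_mono mult_right_mono) auto
      then show ?thesis by (simp add: algebra_simps)
    qed
    \<comment> \<open>The mixed terms 1/a, b/a and b/a^2 are dominated, by the arithmetic-geometric
      mean inequality, by 1, 1/a^2 and b^2/a^2, which are the three majorants available.\<close>
    have alg: "(1 / a + 1 / a\<^sup>2) * (1 + a + b) \<le> 4 * (1 + 1 / a\<^sup>2 + b\<^sup>2 / a\<^sup>2)"
    proof -
      define u where "u = 1 / a"
      have u: "u > 0" "u * a = 1" using a by (auto simp: u_def)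
      have i1: "2 * u \<le> 1 + u * u" using zero_le_power2[of "u - 1"] by (simp add: power2_eq_square algebra_simps)
      have i2: "2 * (u * b) \<le> 1 + u * u * (b * b)" using zero_le_power2[of "u * b - 1"] by (simp add: power2_eq_square algebra_simps)
      have i3: "2 * (u * u * b) \<le> u * u + u * u * (b * b)" using zero_le_power2[of "u * b - u"] by (simp add: power2_eq_square algebra_simps)
      have i4: "0 \<le> u * u" "0 \<le> u * u * (b * b)" by simp_all
      have lin: "2 * u + P + 1 + Q + V \<le> 4 * (1 + P + X)"
        if "2 * u \<le> 1 + P" "2 * Q \<le> 1 + X" "2 * V \<le> P + X" "0 \<le> P" "0 \<le> X" for P Q V X :: real
        using that by argo
      have "2 * u + u * u + 1 + u * b + u * u * b \<le> 4 * (1 + u\<^sup>2 + u\<^sup>2 * b\<^sup>2)"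
        unfolding power2_eq_square by (rule lin[OF i1 i2 i3 i4])
      moreover have "(u + u * u) * (1 + a + b) = 2 * u + u * u + 1 + u * b + u * u * b"
      proof -
        have "(u + u * u) * (1 + a + b) = u + u * a + u * b + u * u + u * (u * a) + u * u * b" by (simp add: algebra_simps)
        then show ?thesis unfolding u(2) by simp
      qed
      ultimately show ?thesis unfolding u_def by (simp add: power2_eq_square)
    qed
    have "c * ((sqrt A + sqrt D) / A) * (D * (E powr (- N) * \<Xi>)) \<le> c * ((sqrt A + sqrt D) / A) * (D * (E powr (- N) * (k * sqrt D * (1 + R * a + S * b))))"
      using c A D \<Xi>' by (intro mult_left_mono) auto
    also have "\<dots> = k * (D * E powr (- N)) * ((c * ((sqrt A + sqrt D) / A) * sqrt D) * (1 + R * a + S * b))" by (simp only: mult_ac)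
    also have "\<dots> \<le> k * (D * E powr (- N)) * ((R * (1 / a + 1 / a\<^sup>2)) * (R * S\<^sup>2 * (1 + a + b)))"
      using k D by (intro mult_left_mono mult_mono[OF L M]) (use R1 S a b in \<open>auto intro!: add_nonneg_nonneg\<close>)
    also have "\<dots> = k * (D * E powr (- N)) * (T * ((1 / a + 1 / a\<^sup>2) * (1 + a + b)))" unfolding T by (simp only: power2_eq_square mult_ac)
    also have "\<dots> \<le> k * (D * E powr (- N)) * (T * (4 * (1 + 1 / a\<^sup>2 + b\<^sup>2 / a\<^sup>2)))"
      using alg k D T1 by (intro mult_left_mono) auto
    finally show ?thesis by (simp add: mult_ac)
  qed
  show "p * ((sqrt A + sqrt D) / A) * (D * (E powr (- N) * \<Xi>)) \<le> 4 * k * (\<Psi> 0 0 0 + \<Psi> (- 1) 0 0 + \<Psi> (- 1) 1 0)"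
    using cot[OF pq(1) A x ab R_def RS(2) a2 \<Xi>' T_def] unfolding \<Psi> pw by (simp add: algebra_simps)
  have "\<Xi> \<le> k * sqrt D * (1 + S * b + R * a)" "T = S\<^sup>2 * R\<^sup>2" using \<Xi>' by (simp_all add: T_def mult.commute add_ac)
  from cot[OF pq(2) B y ab(2,1) S_def RS(1) b2 this]
  show "q * ((sqrt B + sqrt D) / B) * (D * (E powr (- N) * \<Xi>)) \<le> 4 * k * (\<Psi> 0 0 0 + \<Psi> 0 (- 1) 0 + \<Psi> 1 (- 1) 0)"
    unfolding \<Psi> pw by (simp add: algebra_simps)
qed

section \<open>The gradient of the kernel\<close>

definition jz_m :: "real \<Rightarrow> real \<Rightarrow> real \<times> real \<Rightarrow> real" where
  "jz_m \<theta> \<phi> w = jacobi_z (cos (\<theta> / 2) * cos (\<phi> / 2)) (sin (\<theta> / 2) * sin (\<phi> / 2)) w / 4"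

lemma jz_m_measurable [measurable]: "jz_m \<theta> \<phi> \<in> borel_measurable borel"
  unfolding jz_m_def by measurable

lemma abs_jz_m_le:
  assumes "w \<in> {0<..<2} \<times> {0<..<2}"
  shows "\<bar>jz_m \<theta> \<phi> w\<bar> \<le> 1"
proof -
  have "\<bar>jacobi_z (cos (\<theta> / 2) * cos (\<phi> / 2)) (sin (\<theta> / 2) * sin (\<phi> / 2)) w\<bar> \<le> 1"
    by (rule order_trans[OF abs_jacobi_z_le[OF assms] abs_unit_products_le]) simp_all
  then show ?thesis by (simp add: jz_m_def)
qed

definition riesz_integrand :: "real \<Rightarrow> real \<times> real \<Rightarrow> real \<times> real \<Rightarrow> real" where
  "riesz_integrand N v w = (1 - jz (fst v) (snd v) w) powr (- N) * jz_d (fst v) (snd v) w"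

text \<open>The second term is due to the identity that the second \<theta>-derivative of z equals
  -z / 4.\<close>

definition riesz_integrand_fst :: "real \<Rightarrow> real \<times> real \<Rightarrow> real \<times> real \<Rightarrow> real" where
  "riesz_integrand_fst N v w = N * (1 - jz (fst v) (snd v) w) powr (- N - 1) * (jz_d (fst v) (snd v) w)\<^sup>2
     - (1 - jz (fst v) (snd v) w) powr (- N) * (jz (fst v) (snd v) w / 4)"

text \<open>As z is symmetric in the two angles, its \<phi>-derivative is \<open>jz_d\<close> with
  the angles exchanged.\<close>

definition riesz_integrand_snd :: "real \<Rightarrow> real \<times> real \<Rightarrow> real \<times> real \<Rightarrow> real" where
  "riesz_integrand_snd N v w = N * (1 - jz (fst v) (snd v) w) powr (- N - 1) * (jz_d (fst v) (snd v) w * jz_d (snd v) (fst v) w)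
     + (1 - jz (fst v) (snd v) w) powr (- N) * jz_m (fst v) (snd v) w"

lemma riesz_integrand_measurable [measurable]:
  "riesz_integrand N v \<in> borel_measurable borel" "riesz_integrand_fst N v \<in> borel_measurable borel"
  "riesz_integrand_snd N v \<in> borel_measurable borel"
  unfolding riesz_integrand_def riesz_integrand_fst_def riesz_integrand_snd_def by measurable

lemma gderiv_riesz_integrand:
  assumes "jz (fst v) (snd v) w < 1"
  shows "GDERIV (\<lambda>v. riesz_integrand N v w) v :> (riesz_integrand_fst N v w, riesz_integrand_snd N v w)"
proof -
  let ?x = "fst v" let ?y = "snd v"
  have z: "((\<lambda>v. jz (fst v) (snd v) w) has_derivative (\<lambda>h. jz_d ?x ?y w * fst h + jz_d ?y ?x w * snd h)) (at v)"
    unfolding jz_def jz_d_def jacobi_z_def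
    by (rule derivative_eq_intros refl | simp)+ (auto simp: fun_eq_iff field_simps)
  have d: "((\<lambda>v. jz_d (fst v) (snd v) w) has_derivative (\<lambda>h. - (jz ?x ?y w / 4) * fst h + jz_m ?x ?y w * snd h)) (at v)"
    unfolding jz_def jz_d_def jz_m_def jacobi_z_def
    by (rule derivative_eq_intros refl | simp)+ (auto simp: fun_eq_iff field_simps)
  have "((\<lambda>t. (1 - t) powr (- N)) has_real_derivative N * (1 - jz ?x ?y w) powr (- N - 1)) (at (jz ?x ?y w))"
    by (rule derivative_eq_intros refl | use assms in simp)+
  from DERIV_compose_FDERIV[OF this z]
  have p: "((\<lambda>v. (1 - jz (fst v) (snd v) w) powr (- N)) has_derivative (\<lambda>h. (jz_d ?x ?y w * fst h + jz_d ?y ?x w * snd h) * (N * (1 - jz ?x ?y w) powr (- N - 1)))) (at v)" .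
  show ?thesis
    unfolding gderiv_def riesz_integrand_def
    by (rule has_derivative_eq_rhs[OF has_derivative_mult[OF p d]])
       (auto simp: fun_eq_iff inner_prod_def riesz_integrand_fst_def riesz_integrand_snd_def power2_eq_square algebra_simps)
qed

text \<open>Here \<delta> is half the gap 1 - cos((\<theta> - \<phi>) / 2). On the open set where
  the gap exceeds \<delta> all bounds are uniform, and a ball inside it provides the convexity
  required for differentiation under the integral.\<close>

lemma gderiv_riesz_integral:
  assumes ab: "a > 0" "b > 0" and N: "N > 0"
    and v: "fst v \<in> {0<..<pi}" "snd v \<in> {0<..<pi}" "fst v \<noteq> snd v"
  shows "GDERIV (\<lambda>v. \<integral>w. riesz_integrand N v w \<partial>jacobi_square a b) v :>
     (\<integral>w. riesz_integrand_fst N v w \<partial>jacobi_square a b, \<integral>w. riesz_integrand_snd N v w \<partial>jacobi_square a b)"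
proof -
  let ?M = "jacobi_square a b"
  define \<delta> where "\<delta> = (1 - cos ((fst v - snd v) / 2)) / 2"
  have d: "\<delta> > 0" using cos_half_diff_less_1[OF v] by (simp add: \<delta>_def)
  define U where "U = {u :: real \<times> real. 0 < fst u \<and> fst u < pi \<and> 0 < snd u \<and> snd u < pi \<and> cos ((fst u - snd u) / 2) < 1 - \<delta>}"
  have "open U" unfolding U_def by (intro open_Collect_conj open_Collect_less continuous_intros) auto
  moreover have vU: "v \<in> U" using v cos_half_diff_less_1[OF v] by (auto simp: U_def \<delta>_def field_simps)
  ultimately obtain r where r: "r > 0" "ball v r \<subseteq> U" by (meson openE)
  define L where "L = (N * \<delta> powr (- N - 1) + \<delta> powr (- N)) + (N * \<delta> powr (- N - 1) + \<delta> powr (- N))"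
  have ge: "1 - jz (fst u) (snd u) w \<ge> \<delta>" if "u \<in> U" "w \<in> {0<..<2} \<times> {0<..<2}" for u w
    using jz_le_cos[of "fst u" "snd u" w] that by (auto simp: U_def)
  have pw: "(1 - jz (fst u) (snd u) w) powr (- N) \<le> \<delta> powr (- N)" "(1 - jz (fst u) (snd u) w) powr (- N - 1) \<le> \<delta> powr (- N - 1)"
    if "u \<in> U" "w \<in> {0<..<2} \<times> {0<..<2}" for u w
    using ge[OF that] d N by (auto intro!: powr_mono2')
  have F: "\<bar>riesz_integrand N u w\<bar> \<le> \<delta> powr (- N)" if "u \<in> U" "w \<in> {0<..<2} \<times> {0<..<2}" for u w
    unfolding riesz_integrand_def abs_mult
    using mult_mono[OF pw(1)[OF that], of "\<bar>jz_d (fst u) (snd u) w\<bar>" 1] abs_jz_d_le[OF that(2), of "fst u" "snd u"] by simp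
  have G1: "\<bar>riesz_integrand_fst N u w\<bar> \<le> N * \<delta> powr (- N - 1) + \<delta> powr (- N)" if uw: "u \<in> U" "w \<in> {0<..<2} \<times> {0<..<2}" for u w
  proof -
    have "(jz_d (fst u) (snd u) w)\<^sup>2 \<le> 1" using abs_jz_d_le[OF uw(2), of "fst u" "snd u"] by (simp add: abs_square_le_1)
    then have "\<bar>N * (1 - jz (fst u) (snd u) w) powr (- N - 1) * (jz_d (fst u) (snd u) w)\<^sup>2\<bar> \<le> N * \<delta> powr (- N - 1) * 1"
      unfolding abs_mult using pw(2)[OF uw] N by (intro mult_mono) auto
    moreover have "\<bar>(1 - jz (fst u) (snd u) w) powr (- N) * (jz (fst u) (snd u) w / 4)\<bar> \<le> \<delta> powr (- N) * 1"
      unfolding abs_mult using pw(1)[OF uw] abs_jz_le_1[OF uw(2), of "fst u" "snd u"] by (intro mult_mono) auto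
    ultimately show ?thesis unfolding riesz_integrand_fst_def by linarith
  qed
  have G2: "\<bar>riesz_integrand_snd N u w\<bar> \<le> N * \<delta> powr (- N - 1) + \<delta> powr (- N)" if uw: "u \<in> U" "w \<in> {0<..<2} \<times> {0<..<2}" for u w
  proof -
    have "\<bar>jz_d (fst u) (snd u) w * jz_d (snd u) (fst u) w\<bar> \<le> 1"
      unfolding abs_mult using abs_jz_d_le[OF uw(2), of "fst u" "snd u"] abs_jz_d_le[OF uw(2), of "snd u" "fst u"] by (intro mult_le_one) auto
    then have "\<bar>N * (1 - jz (fst u) (snd u) w) powr (- N - 1) * (jz_d (fst u) (snd u) w * jz_d (snd u) (fst u) w)\<bar> \<le> N * \<delta> powr (- N - 1) * 1"
      unfolding abs_mult[of "N * _"] abs_mult[of N] using pw(2)[OF uw] N by (intro mult_mono) auto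
    moreover have "\<bar>(1 - jz (fst u) (snd u) w) powr (- N) * jz_m (fst u) (snd u) w\<bar> \<le> \<delta> powr (- N) * 1"
      unfolding abs_mult using pw(1)[OF uw] abs_jz_m_le[OF uw(2), of "fst u" "snd u"] by (intro mult_mono) auto
    ultimately show ?thesis unfolding riesz_integrand_snd_def by linarith
  qed
  let ?G = "\<lambda>u w. (riesz_integrand_fst N u w, riesz_integrand_snd N u w)"
  have "GDERIV (\<lambda>v. \<integral>w. riesz_integrand N v w \<partial>?M) v :> (\<integral>w. ?G v w \<partial>?M)"
  proof (rule gderiv_integral[OF finite_measure_jacobi_square[OF ab] open_ball convex_ball, of _ _ r])
    show "v \<in> ball v r" using r by simp
    show "integrable ?M (riesz_integrand N u)" if "u \<in> ball v r" for u
      using that r by (intro integrable_jacobi_square_bounded[OF ab]) (auto intro!: F)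
    show "?G v \<in> borel_measurable ?M"
      by (simp add: measurable_cong_sets[OF sets_jacobi_square refl])
    show "AE w in ?M. \<forall>u\<in>ball v r. GDERIV (\<lambda>u. riesz_integrand N u w) u :> ?G u w \<and> norm (?G u w) \<le> L"
      using AE_jacobi_square[OF ab]
    proof eventually_elim
      case (elim w)
      show ?case
      proof (intro ballI conjI)
        fix u assume "u \<in> ball v r"
        then have u: "u \<in> U" using r by auto
        show "GDERIV (\<lambda>u. riesz_integrand N u w) u :> ?G u w"
          by (rule gderiv_riesz_integrand) (use ge[OF u elim] d in simp)
        have "norm (?G u w) \<le> norm (riesz_integrand_fst N u w) + norm (riesz_integrand_snd N u w)" by (rule norm_Pair_le)
        also have "\<dots> \<le> L" unfolding L_def using G1[OF u elim] G2[OF u elim] by simp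
        finally show "norm (?G u w) \<le> L" .
      qed
    qed
  qed
  moreover have "(\<integral>w. ?G v w \<partial>?M) = (\<integral>w. riesz_integrand_fst N v w \<partial>?M, \<integral>w. riesz_integrand_snd N v w \<partial>?M)"
  proof -
    have int: "integrable ?M (?G v)"
    proof (rule integrable_jacobi_square_bounded[OF ab])
      fix w :: "real \<times> real" assume w: "w \<in> {0<..<2} \<times> {0<..<2}"
      have "norm (?G v w) \<le> norm (riesz_integrand_fst N v w) + norm (riesz_integrand_snd N v w)" by (rule norm_Pair_le)
      also have "\<dots> \<le> L" unfolding L_def using G1[OF vU w] G2[OF vU w] by simp
      finally show "norm (?G v w) \<le> L" .
    qed simp
    show ?thesis
      using integral_bounded_linear[OF bounded_linear_fst int] integral_bounded_linear[OF bounded_linear_snd int]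
      by (intro prod_eqI) simp_all
  qed
  ultimately show ?thesis by simp
qed

section \<open>Trigonometric bounds for the first derivatives of z\<close>

text \<open>Everything rests on (s - s')^2 + (c - c')^2 = 2D: sines and cosines of the two half
  angles differ by at most sqrt(2D). Hence s' is at most of order sqrt A + sqrt D although A = s s'
  contains the other sine, and 1/s = s'/A gives the bound for the cotangent. In the derivative of z
  the part without x and y is c s' - s c', whose square is D (2 - D).\<close>

lemma jz_d_le:
  assumes \<theta>: "\<theta> \<in> {0<..<pi}" and \<phi>: "\<phi> \<in> {0<..<pi}" and xy: "0 < x" "x < 2" "0 < y" "y < 2"
  defines "A \<equiv> sin (\<theta> / 2) * sin (\<phi> / 2)" and "B \<equiv> cos (\<theta> / 2) * cos (\<phi> / 2)"
  defines "D \<equiv> 1 - cos ((\<theta> - \<phi>) / 2)"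
  shows "\<bar>jz_d \<theta> \<phi> (x, y)\<bar> \<le> 5 * (sqrt D + x * sqrt A + y * sqrt B)"
    and "1 / sin (\<theta> / 2) \<le> 2 * ((sqrt A + sqrt D) / A)"
    and "1 / cos (\<theta> / 2) \<le> 2 * ((sqrt B + sqrt D) / B)"
proof -
  define s where "s = sin (\<theta> / 2)"
  define s' where "s' = sin (\<phi> / 2)"
  define c where "c = cos (\<theta> / 2)"
  define c' where "c' = cos (\<phi> / 2)"
  have pos: "s > 0" "s' > 0" "c > 0" "c' > 0"
    using half_angle_pos[OF \<theta>] half_angle_pos[OF \<phi>] by (auto simp: s_def s'_def c_def c'_def)
  have sc: "s\<^sup>2 + c\<^sup>2 = 1" "s'\<^sup>2 + c'\<^sup>2 = 1" by (simp_all add: s_def s'_def c_def c'_def)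
  have le1: "s \<le> 1" "s' \<le> 1" "c \<le> 1" "c' \<le> 1" by (simp_all add: s_def s'_def c_def c'_def)
  have AB: "A = s * s'" "B = c * c'" "A > 0" "B > 0" using pos by (auto simp: A_def B_def s_def s'_def c_def c'_def)
  have D: "D = 1 - A - B" by (simp add: D_def A_def B_def diff_divide_distrib cos_diff)
  have sum_sq: "(s - s')\<^sup>2 + (c - c')\<^sup>2 = 2 * D"
    using sc unfolding D AB by (simp add: power2_eq_square algebra_simps)
  have D0: "D \<ge> 0" by (simp add: D_def)
  have diff: "\<bar>s - s'\<bar> \<le> sqrt (2 * D)" "\<bar>c - c'\<bar> \<le> sqrt (2 * D)"
  proof -
    have "(s - s')\<^sup>2 \<le> 2 * D" "(c - c')\<^sup>2 \<le> 2 * D"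
      using sum_sq zero_le_power2[of "s - s'"] zero_le_power2[of "c - c'"] by linarith+
    then show "\<bar>s - s'\<bar> \<le> sqrt (2 * D)" "\<bar>c - c'\<bar> \<le> sqrt (2 * D)" by (auto intro!: real_le_rsqrt)
  qed
  \<comment> \<open>If t and u are comparable, u is of the order of sqrt(t u); otherwise u is
    controlled by |t - u|. The quadratic inequality covers both cases.\<close>
  have bound: "u \<le> 2 * (sqrt (t * u) + sqrt D)" if "t > 0" "u > 0" "\<bar>t - u\<bar> \<le> sqrt (2 * D)" for t u
  proof -
    have "u\<^sup>2 \<le> 2 * (t * u) + 2 * D"
    proof -
      have "\<bar>t - u\<bar>\<^sup>2 \<le> (sqrt (2 * D))\<^sup>2" by (intro power_mono that(3)) simp
      then have "(t - u)\<^sup>2 \<le> 2 * D" using D0 by simp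
      then have "t\<^sup>2 + u\<^sup>2 \<le> 2 * (t * u) + 2 * D" by (simp add: power2_eq_square algebra_simps)
      then show ?thesis using zero_le_power2[of t] by linarith
    qed
    also have "\<dots> \<le> (2 * (sqrt (t * u) + sqrt D))\<^sup>2"
    proof -
      have "(2 * (sqrt (t * u) + sqrt D))\<^sup>2 = 4 * (t * u) + 4 * D + 8 * (sqrt (t * u) * sqrt D)"
        using that D0 by (simp add: power2_eq_square algebra_simps)
      moreover have "0 \<le> sqrt (t * u) * sqrt D" "0 \<le> t * u" using that D0 by auto
      ultimately show ?thesis using D0 by linarith
    qed
    finally show ?thesis by (rule power2_le_imp_le) (use that D0 in simp)
  qed
  have s'b: "s' \<le> 2 * (sqrt A + sqrt D)" unfolding AB(1) by (rule bound) (use pos diff in auto)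
  have c'b: "c' \<le> 2 * (sqrt B + sqrt D)" unfolding AB(2) by (rule bound) (use pos diff in auto)
  show "1 / sin (\<theta> / 2) \<le> 2 * ((sqrt A + sqrt D) / A)"
  proof -
    have "1 / s = s' / A" using pos by (simp add: AB)
    also have "\<dots> \<le> 2 * (sqrt A + sqrt D) / A" using s'b AB by (intro divide_right_mono) auto
    finally show ?thesis by (simp add: s_def)
  qed
  show "1 / cos (\<theta> / 2) \<le> 2 * ((sqrt B + sqrt D) / B)"
  proof -
    have "1 / c = c' / B" using pos by (simp add: AB)
    also have "\<dots> \<le> 2 * (sqrt B + sqrt D) / B" using c'b AB by (intro divide_right_mono) auto
    finally show ?thesis by (simp add: c_def)
  qed
  have e: "jz_d \<theta> \<phi> (x, y) = ((c * s' - s * c') - x * (c * s') + y * (s * c')) / 2"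
    by (simp add: jz_d_def jacobi_z_def s_def s'_def c_def c'_def algebra_simps)
  have d1: "\<bar>c * s' - s * c'\<bar> \<le> 2 * sqrt D"
  proof -
    have "(c * s' - s * c')\<^sup>2 = (s\<^sup>2 + c\<^sup>2) * (s'\<^sup>2 + c'\<^sup>2) - (A + B)\<^sup>2" unfolding AB by (simp add: power2_eq_square algebra_simps)
    also have "\<dots> = D * (2 - D)" unfolding sc D by (simp add: power2_eq_square algebra_simps)
    also have "\<dots> \<le> D * 4" using D0 by (intro mult_left_mono) auto
    also have "\<dots> = (2 * sqrt D)\<^sup>2" using D0 by (simp add: power_mult_distrib)
    finally show ?thesis using D0 abs_le_square_iff[of "c * s' - s * c'" "2 * sqrt D"] by simp
  qed
  have d2: "x * (c * s') \<le> 2 * (x * sqrt A) + 4 * sqrt D"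
  proof -
    have "c * s' \<le> 1 * s'" using pos le1 by (intro mult_right_mono) auto
    then have "x * (c * s') \<le> x * (2 * (sqrt A + sqrt D))" using s'b xy by (intro mult_left_mono) auto
    moreover have "x * sqrt D \<le> 2 * sqrt D" using xy D0 by (intro mult_right_mono) auto
    ultimately show ?thesis by (simp add: algebra_simps)
  qed
  have d3: "y * (s * c') \<le> 2 * (y * sqrt B) + 4 * sqrt D"
  proof -
    have "s * c' \<le> 1 * c'" using pos le1 by (intro mult_right_mono) auto
    then have "y * (s * c') \<le> y * (2 * (sqrt B + sqrt D))" using c'b xy by (intro mult_left_mono) auto
    moreover have "y * sqrt D \<le> 2 * sqrt D" using xy D0 by (intro mult_right_mono) auto
    ultimately show ?thesis by (simp add: algebra_simps)
  qed
  have "x * (c * s') \<ge> 0" "y * (s * c') \<ge> 0" "x * sqrt A \<ge> 0" "y * sqrt B \<ge> 0" "sqrt D \<ge> 0" using xy pos AB D0 by auto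
  \<comment> \<open>The coefficient of sqrt D is 2 + 4 + 4, where each 4 uses that x and y are below
    2; halving gives the constant 5.\<close>
  with d1 d2 d3 have "\<bar>(c * s' - s * c') - x * (c * s') + y * (s * c')\<bar> \<le> 10 * sqrt D + 2 * (x * sqrt A) + 2 * (y * sqrt B)"
    by linarith
  then show "\<bar>jz_d \<theta> \<phi> (x, y)\<bar> \<le> 5 * (sqrt D + x * sqrt A + y * sqrt B)"
    unfolding e using \<open>x * sqrt A \<ge> 0\<close> \<open>y * sqrt B \<ge> 0\<close> by (simp add: algebra_simps)
qed

section \<open>Measures of balls and the final estimate\<close>

lemma sin_ge_half:
  fixes t :: real
  assumes "0 \<le> t" "t \<le> pi / 4"
  shows "t / 2 \<le> sin t"
proof -
  have "t < pi / 2" using assms pi_gt_zero by linarith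
  then have c: "cos t > 0" by (intro cos_gt_zero_pi) (use assms pi_gt_zero in linarith)+
  have "\<bar>t\<bar> \<le> \<bar>tan t\<bar>" by (rule abs_tan_ge) (use \<open>t < pi / 2\<close> assms in linarith)
  moreover have "0 \<le> tan t" by (rule tan_pos_pi2_le) (use \<open>t < pi / 2\<close> assms in auto)
  ultimately have "t \<le> tan t" using assms by simp
  then have "t * cos t \<le> sin t" using c by (simp add: tan_def field_simps)
  moreover have "1 / 2 \<le> cos t"
  proof -
    have "cos (pi / 4) \<le> cos t" using assms pi_gt_zero by (intro cos_monotone_0_pi_le) linarith+
    moreover have "1 / 2 \<le> cos (pi / 4 :: real)" by (simp add: cos_45 real_le_rsqrt power2_eq_square)
    ultimately show ?thesis by linarith
  qed
  then have "t * (1 / 2) \<le> t * cos t" using assms by (intro mult_left_mono)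
  ultimately show ?thesis by linarith
qed

text \<open>As 1 - cos(m / 2) = 2 sin(m / 4)^2 and sin t \<ge> t / 2 near 0, the left side is 2 (m /
  8)^2; the constants 32 below originate here.\<close>

lemma one_minus_cos_ge:
  fixes m :: real
  assumes "\<bar>m\<bar> \<le> pi"
  shows "m\<^sup>2 / 32 \<le> 1 - cos (m / 2)"
proof -
  have "\<bar>m\<bar> / 4 / 2 \<le> sin (\<bar>m\<bar> / 4)" using assms by (intro sin_ge_half) auto
  then have "(\<bar>m\<bar> / 4 / 2)\<^sup>2 \<le> (sin (\<bar>m\<bar> / 4))\<^sup>2" by (intro power_mono) auto
  moreover have "1 - cos (\<bar>m\<bar> / 2) = 2 * (sin (\<bar>m\<bar> / 4))\<^sup>2"
    using cos_double_sin[of "\<bar>m\<bar> / 4"] by simp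
  moreover have "cos (\<bar>m\<bar> / 2) = cos (m / 2)" using cos_abs_real[of "m / 2"] by (simp add: abs_divide)
  ultimately show ?thesis by (simp add: power_divide)
qed

text \<open>A point of the ball is at most twice m, the larger of the two angles, so its half-angle
  sine is at most m, whereas 1 - cos(\<theta>/2) cos(\<phi>/2) is at least 1 - cos(m / 2). In the
  notation of the main estimate the right side is 32 (D + A).\<close>

lemma sin_square_ball_le:
  assumes \<theta>: "\<theta> \<in> {0<..<pi}" and \<phi>: "\<phi> \<in> {0<..<pi}" and \<psi>: "\<psi> \<in> {0<..<pi}" "\<bar>\<psi> - \<theta>\<bar> < \<bar>\<theta> - \<phi>\<bar>"
  shows "(sin (\<psi> / 2))\<^sup>2 \<le> 32 * (1 - cos (\<theta> / 2) * cos (\<phi> / 2))"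
proof -
  define m where "m = max \<theta> \<phi>"
  have m: "0 < m" "m < pi" using \<theta> \<phi> by (auto simp: m_def)
  have "\<psi> \<le> 2 * m" using \<theta> \<phi> \<psi> by (auto simp: m_def)
  then have "sin (\<psi> / 2) \<le> m" using sin_x_le_x[of "\<psi> / 2"] \<psi> by auto
  then have "(sin (\<psi> / 2))\<^sup>2 \<le> m\<^sup>2" using half_angle_pos[OF \<psi>(1)] by (intro power_mono) auto
  also have "\<dots> \<le> 32 * (1 - cos (m / 2))" using one_minus_cos_ge[of m] m by simp
  also have "cos (\<theta> / 2) * cos (\<phi> / 2) \<le> cos (m / 2)"
  proof (cases "\<theta> \<le> \<phi>")
    case True
    then show ?thesis using half_angle_pos[OF \<phi>] mult_right_mono[of "cos (\<theta> / 2)" 1 "cos (\<phi> / 2)"] by (simp add: m_def)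
  next
    case False
    then show ?thesis using half_angle_pos[OF \<theta>] mult_left_mono[of "cos (\<phi> / 2)" 1 "cos (\<theta> / 2)"] by (simp add: m_def)
  qed
  then have "32 * (1 - cos (m / 2)) \<le> 32 * (1 - cos (\<theta> / 2) * cos (\<phi> / 2))" by simp
  finally show ?thesis .
qed

text \<open>The measure stands in denominators, so an upper bound is what matters, together with
  positivity. On the ball the density is at most its value k computed from the two angles, and the
  ball has length 2r.\<close>

lemma jacobi_ball_measure_bounds:
  fixes \<alpha> \<beta> :: real
  assumes a: "\<alpha> > - 1 / 2" and b: "\<beta> > - 1 / 2" and \<theta>: "\<theta> \<in> {0<..<pi}" and \<phi>: "\<phi> \<in> {0<..<pi}" and ne: "\<theta> \<noteq> \<phi>"
  defines "w1 \<equiv> \<alpha> + 1 / 2" and "w2 \<equiv> \<beta> + 1 / 2"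
  shows "0 < jacobi_ball_measure \<alpha> \<beta> \<theta> \<bar>\<theta> - \<phi>\<bar>"
    and "jacobi_ball_measure \<alpha> \<beta> \<theta> \<bar>\<theta> - \<phi>\<bar> \<le> 2 * 32 powr w1 * 32 powr w2 * \<bar>\<theta> - \<phi>\<bar> *
      ((1 - cos (\<theta> / 2) * cos (\<phi> / 2)) powr w1 * (1 - sin (\<theta> / 2) * sin (\<phi> / 2)) powr w2)"
proof -
  define r where "r = \<bar>\<theta> - \<phi>\<bar>"
  have r: "r > 0" using ne by (simp add: r_def)
  define S where "S = ball \<theta> r \<inter> {0<..<pi}"
  define h where "h x = sin (x / 2) powr (2 * \<alpha> + 1) * cos (x / 2) powr (2 * \<beta> + 1)" for x :: real
  define k where "k = (32 * (1 - cos (\<theta> / 2) * cos (\<phi> / 2))) powr w1 * (32 * (1 - sin (\<theta> / 2) * sin (\<phi> / 2))) powr w2"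
  have k0: "k \<ge> 0" by (simp add: k_def)
  have S_sets [measurable]: "S \<in> sets borel" by (simp add: S_def)
  have h_meas [measurable]: "h \<in> borel_measurable borel" unfolding h_def by measurable
  have hk: "h x \<le> k" and h_pos: "h x > 0" if "x \<in> S" for x
  proof -
    have x: "x \<in> {0<..<pi}" "\<bar>x - \<theta>\<bar> < \<bar>\<theta> - \<phi>\<bar>" using that by (auto simp: S_def r_def dist_real_def)
    show "h x > 0" using half_angle_pos[OF x(1)] by (simp add: h_def)
    have e: "sin (x / 2) powr (2 * \<alpha> + 1) = ((sin (x / 2))\<^sup>2) powr w1" "cos (x / 2) powr (2 * \<beta> + 1) = ((cos (x / 2))\<^sup>2) powr w2"
      using half_angle_pos[OF x(1)] by (simp_all add: w1_def w2_def powr_powr algebra_simps flip: powr_numeral)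
    have 1: "(sin (x / 2))\<^sup>2 \<le> 32 * (1 - cos (\<theta> / 2) * cos (\<phi> / 2))" by (rule sin_square_ball_le[OF \<theta> \<phi> x])
    \<comment> \<open>The reflection of all angles at pi / 2 exchanges sine and cosine, so the
      cosine bound follows from the sine bound.\<close>
    have sc: "sin ((pi - t) / 2) = cos (t / 2)" "cos ((pi - t) / 2) = sin (t / 2)" for t :: real
      by (simp_all add: diff_divide_distrib sin_diff cos_diff)
    have 2: "(cos (x / 2))\<^sup>2 \<le> 32 * (1 - sin (\<theta> / 2) * sin (\<phi> / 2))"
      using sin_square_ball_le[of "pi - \<theta>" "pi - \<phi>" "pi - x"] \<theta> \<phi> x unfolding sc by (auto simp: abs_if split: if_splits)
    show "h x \<le> k" unfolding h_def e k_def
      by (intro mult_mono powr_mono2 1 2) (use a b in \<open>simp_all add: w1_def w2_def\<close>)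
  qed
  have em: "emeasure (jacobi_measure \<alpha> \<beta>) S = (\<integral>\<^sup>+x. ennreal (h x) * indicator S x \<partial>lborel)"
  proof -
    have "S \<in> sets (restrict_space lborel {0<..<pi})"
      using S_sets by (subst sets_restrict_space_iff) (simp_all add: S_def)
    then have "emeasure (jacobi_measure \<alpha> \<beta>) S = (\<integral>\<^sup>+x. ennreal (h x) * indicator S x \<partial>restrict_space lborel {0<..<pi})"
      unfolding jacobi_measure_def h_def[symmetric] by (intro emeasure_density) (auto intro!: measurable_restrict_space1)
    also have "\<dots> = (\<integral>\<^sup>+x. ennreal (h x) * indicator S x * indicator {0<..<pi} x \<partial>lborel)"
      by (intro nn_integral_restrict_space) auto
    also have "\<dots> = (\<integral>\<^sup>+x. ennreal (h x) * indicator S x \<partial>lborel)"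
      by (intro nn_integral_cong) (auto simp: S_def split: split_indicator)
    finally show ?thesis .
  qed
  have "(\<integral>\<^sup>+x. ennreal (h x) * indicator S x \<partial>lborel) \<le> (\<integral>\<^sup>+x. ennreal k * indicator (ball \<theta> r) x \<partial>lborel)"
    using hk by (intro nn_integral_mono) (auto simp: S_def ennreal_leI split: split_indicator)
  also have "\<dots> = ennreal k * emeasure lborel (ball \<theta> r)" by (simp add: nn_integral_cmult_indicator)
  also have "emeasure lborel (ball \<theta> r) = ennreal (2 * r)" using r by (simp add: ball_eq_greaterThanLessThan)
  also have "ennreal k * ennreal (2 * r) = ennreal (k * (2 * r))" using k0 by (rule ennreal_mult'[symmetric])
  finally have up: "emeasure (jacobi_measure \<alpha> \<beta>) S \<le> ennreal (k * (2 * r))" unfolding em .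
  have m: "jacobi_ball_measure \<alpha> \<beta> \<theta> \<bar>\<theta> - \<phi>\<bar> = enn2real (emeasure (jacobi_measure \<alpha> \<beta>) S)"
    by (simp add: jacobi_ball_measure_def measure_def S_def r_def)
  have "jacobi_ball_measure \<alpha> \<beta> \<theta> \<bar>\<theta> - \<phi>\<bar> \<le> k * (2 * r)"
    unfolding m using up k0 r by (intro enn2real_leI) auto
  also have "k * (2 * r) = 2 * 32 powr w1 * 32 powr w2 * r * ((1 - cos (\<theta> / 2) * cos (\<phi> / 2)) powr w1 * (1 - sin (\<theta> / 2) * sin (\<phi> / 2)) powr w2)"
  proof -
    have "cos (\<theta> / 2) * cos (\<phi> / 2) \<le> 1" "sin (\<theta> / 2) * sin (\<phi> / 2) \<le> 1"
      using half_angle_pos[OF \<theta>] half_angle_pos[OF \<phi>] by (auto intro!: mult_le_one)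
    then have "(32 * (1 - cos (\<theta> / 2) * cos (\<phi> / 2))) powr w1 = 32 powr w1 * (1 - cos (\<theta> / 2) * cos (\<phi> / 2)) powr w1"
      "(32 * (1 - sin (\<theta> / 2) * sin (\<phi> / 2))) powr w2 = 32 powr w2 * (1 - sin (\<theta> / 2) * sin (\<phi> / 2)) powr w2"
      by (intro powr_mult)+
    then show ?thesis unfolding k_def by (simp only: mult_ac)
  qed
  finally show "jacobi_ball_measure \<alpha> \<beta> \<theta> \<bar>\<theta> - \<phi>\<bar> \<le> 2 * 32 powr w1 * 32 powr w2 * \<bar>\<theta> - \<phi>\<bar> *
      ((1 - cos (\<theta> / 2) * cos (\<phi> / 2)) powr w1 * (1 - sin (\<theta> / 2) * sin (\<phi> / 2)) powr w2)" unfolding r_def .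
  have "emeasure (jacobi_measure \<alpha> \<beta>) S \<noteq> 0"
  proof
    assume "emeasure (jacobi_measure \<alpha> \<beta>) S = 0"
    then have "AE x in lborel. ennreal (h x) * indicator S x = 0" unfolding em by (subst (asm) nn_integral_0_iff_AE) auto
    then have "AE x in lborel. x \<notin> S"
    proof eventually_elim
      case (elim x)
      show ?case
      proof
        assume "x \<in> S"
        with elim h_pos[OF this] show False by (simp add: ennreal_eq_0_iff)
      qed
    qed
    then have z: "emeasure lborel S = 0" by (subst (asm) AE_iff_measurable[OF _ refl]) auto
    have "S = {max 0 (\<theta> - r)<..<min pi (\<theta> + r)}" by (auto simp: S_def ball_eq_greaterThanLessThan)
    then have "emeasure lborel S = ennreal (min pi (\<theta> + r) - max 0 (\<theta> - r))" using r \<theta> by (simp add: max_def min_def)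
    moreover have "min pi (\<theta> + r) - max 0 (\<theta> - r) > 0" using r \<theta> by (auto simp: max_def min_def)
    ultimately show False using z by (simp add: ennreal_eq_0_iff)
  qed
  then show "0 < jacobi_ball_measure \<alpha> \<beta> \<theta> \<bar>\<theta> - \<phi>\<bar>"
    unfolding m using up by (auto simp: enn2real_positive_iff zero_less_iff_neq_zero top_unique less_top[symmetric])
qed

text \<open>Written with the logarithmic derivative, since the weight itself is to be absorbed by
  the scale while the bracket carries the factors p and q that have to be compensated.\<close>

lemma jacobi_u_deriv:
  assumes x: "x \<in> {0<..<pi}"
  shows "(jacobi_u a b j has_real_derivative
     jacobi_u a b j x * (a * real j / 2 * (cos (x / 2) / sin (x / 2)) - b * real j / 2 * (sin (x / 2) / cos (x / 2)))) (at x)"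
proof -
  define p where "p = a * real j"
  define q where "q = b * real j"
  note sc = half_angle_pos[OF x]
  have 1: "((\<lambda>x. sin (x / 2) powr p) has_real_derivative p * sin (x / 2) powr (p - 1) * (cos (x / 2) / 2)) (at x)"
    by (rule derivative_eq_intros refl | use sc in simp)+
  have 2: "((\<lambda>x. cos (x / 2) powr q) has_real_derivative q * cos (x / 2) powr (q - 1) * (- sin (x / 2) / 2)) (at x)"
    by (rule derivative_eq_intros refl | use sc in simp)+
  have 3: "sin (x / 2) powr (p - 1) = sin (x / 2) powr p / sin (x / 2)" "cos (x / 2) powr (q - 1) = cos (x / 2) powr q / cos (x / 2)"
    using sc by (simp_all add: powr_diff)
  show ?thesis
    unfolding jacobi_u_def[abs_def] p_def[symmetric] q_def[symmetric]
    by (rule DERIV_cong[OF DERIV_mult[OF 1 2]]) (simp add: 3 field_simps)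
qed

lemma weighted_riesz_eq:
  fixes \<alpha> \<beta> a b :: real and j :: nat
  assumes \<alpha>: "\<alpha> > - 1 / 2" and \<beta>: "\<beta> > - 1 / 2" and ab: "a \<ge> 0" "b \<ge> 0"
    and v: "fst v \<in> {0<..<pi}" "snd v \<in> {0<..<pi}" "fst v \<noteq> snd v"
  defines "p \<equiv> a * real j" and "q \<equiv> b * real j" and "w1 \<equiv> \<alpha> + 1 / 2" and "w2 \<equiv> \<beta> + 1 / 2"
  defines "N \<equiv> p + q + w1 + w2 + 1"
  shows "weighted_riesz \<alpha> \<beta> a b j (fst v) (snd v) =
     2 powr (2 - N) * Gamma N / (pi * Gamma (p + w1) * Gamma (q + w2)) *
     (jacobi_u a b j (fst v) * jacobi_u a b j (snd v) * (\<integral>w. riesz_integrand N v w \<partial>jacobi_square (p + w1) (q + w2)))"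
proof -
  have pq: "p \<ge> 0" "q \<ge> 0" using ab by (auto simp: p_def q_def)
  have e: "\<alpha> + a * real j + 1 / 2 = p + w1" "\<beta> + b * real j + 1 / 2 = q + w2" "\<alpha> + a * real j + (\<beta> + b * real j) + 2 = N"
    by (simp_all add: p_def q_def w1_def w2_def N_def)
  have gt: "\<alpha> + a * real j > - 1 / 2" "\<beta> + b * real j > - 1 / 2" using \<alpha> \<beta> pq by (auto simp: p_def q_def)
  show ?thesis unfolding weighted_riesz_def jacobi_riesz_integral[OF gt v] e riesz_integrand_def by simp
qed

theorem theorem3p4:
  fixes \<alpha> \<beta> a b :: real
  assumes "\<alpha> > - 1 / 2" and "\<beta> > - 1 / 2"
    and "a \<ge> 1" and "b = 0 \<or> b \<ge> 1"
  shows "\<exists>C1 C2 :: real. \<forall>(j::nat) \<theta> \<phi>.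
           \<theta> \<in> {0<..<pi} \<longrightarrow> \<phi> \<in> {0<..<pi} \<longrightarrow> \<theta> \<noteq> \<phi> \<longrightarrow>
             \<bar>weighted_riesz \<alpha> \<beta> a b j \<theta> \<phi>\<bar>
               \<le> C1 / jacobi_ball_measure \<alpha> \<beta> \<theta> \<bar>\<theta> - \<phi>\<bar>
             \<and> (\<exists>D. GDERIV (\<lambda>(x, y). weighted_riesz \<alpha> \<beta> a b j x y) (\<theta>, \<phi>) :> D
                  \<and> norm D \<le> C2 / (\<bar>\<theta> - \<phi>\<bar> * jacobi_ball_measure \<alpha> \<beta> \<theta> \<bar>\<theta> - \<phi>\<bar>))"
proof -
  define w1 where "w1 = \<alpha> + 1 / 2"
  define w2 where "w2 = \<beta> + 1 / 2"
  have w: "w1 > 0" "w2 > 0" using assms by (auto simp: w1_def w2_def)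
  have b0: "b \<ge> 0" using assms(4) by auto
  \<comment> \<open>Exponents for, in order: the size of the kernel, the derivatives of the
    integral, and the terms from the logarithmic derivatives with the factors p and q. The exponent
    -1 of x occurs only in \<open>T3\<close> and that of y only in \<open>T4\<close>, which are used
    for p \<ge> 1 and q \<ge> 1 respectively.\<close>
  define T1 T2 T3 T4 :: "(real \<times> real \<times> nat) list" where
    "T1 = [(0, 0, 0), (1 / 2, 0, 0), (0, 1 / 2, 0)]" and "T2 = [(0, 0, 1), (1, 0, 1), (0, 1, 1), (0, 0, 0)]"
    and "T3 = [(0, 0, 0), (- 1, 0, 0), (- 1, 1, 0)]" and "T4 = [(0, 0, 0), (0, - 1, 0), (1, - 1, 0)]"
  define bnd where "bnd T C \<longleftrightarrow> C > 0 \<and> (\<forall>p q A B D N Q k. (p = 0 \<and> (\<forall>(e, f, m)\<in>set T. e \<ge> 0) \<or> p \<ge> 1) \<longrightarrow> (q = 0 \<and> (\<forall>(e, f, m)\<in>set T. f \<ge> 0) \<or> q \<ge> 1) \<longrightarrow> q \<le> b * (1 + p) \<longrightarrow>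
    A > 0 \<longrightarrow> B > 0 \<longrightarrow> D > 0 \<longrightarrow> N = p + q + w1 + w2 + 1 \<longrightarrow> k \<ge> 0 \<longrightarrow>
    (\<forall>w\<in>{0<..<2} \<times> {0<..<2}. \<bar>Q w\<bar> \<le> k * (\<Sum>(e, f, m)\<leftarrow>T. jacobi_majorant e f m p q A B D N w)) \<longrightarrow>
    \<bar>\<integral>w. Q w \<partial>jacobi_square (p + w1) (q + w2)\<bar> \<le> k * (C * jacobi_scale w1 w2 p q A B D N))" for T C
  have ex: "\<exists>C. bnd T C" if "\<And>e f m. (e, f, m) \<in> set T \<Longrightarrow> \<bar>e\<bar> \<le> 1 \<and> \<bar>f\<bar> \<le> 1 \<and> m \<le> 1 \<and> 1 + real m - e - f > 0" for T
    using jacobi_majorant_sum_bound[OF w b0 that] unfolding bnd_def by blast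
  have "\<exists>C. bnd T1 C" by (rule ex) (auto simp: T1_def)
  then obtain C1 where C1: "bnd T1 C1" by blast
  have "\<exists>C. bnd T2 C" by (rule ex) (auto simp: T2_def)
  then obtain C2 where C2: "bnd T2 C2" by blast
  have "\<exists>C. bnd T3 C" by (rule ex) (auto simp: T3_def)
  then obtain C3 where C3: "bnd T3 C3" by blast
  have "\<exists>C. bnd T4 C" by (rule ex) (auto simp: T4_def)
  then obtain C4 where C4: "bnd T4 C4" by blast
  have Cpos: "C1 > 0" "C2 > 0" "C3 > 0" "C4 > 0" using C1 C2 C3 C4 by (auto simp: bnd_def)
  \<comment> \<open>What remains of the powers of 2: the exponent 2 - N + p + q equals 1 - w1 - w2,
    which is free of j.\<close>
  define c0 where "c0 = 2 powr (1 - w1 - w2) / pi"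
  define C\<mu> where "C\<mu> = 2 * 32 powr w1 * 32 powr w2"
  have c0: "c0 > 0" "C\<mu> > 0" by (auto simp: c0_def C\<mu>_def)
  \<comment> \<open>The pointwise estimates with k = 5 contribute 20 = 4 * 5 and 75 = 3 * 5^2; the
    outer factor 2 counts the components of the gradient.\<close>
  define K where "K = 2 * (20 * C3 + 20 * C4 + 75 * C2)"
  have K: "K > 0" using Cpos by (simp add: K_def)
  show ?thesis
  \<comment> \<open>The factor 30 is 5 from the pointwise estimate times 6 from |\<theta> - \<phi>|
    \<le> 6 sqrt D; the factor 32 comes from |\<theta> - \<phi>|^2 \<le> 32 D.\<close>
  proof (rule exI[of _ "30 * c0 * C1 * C\<mu>"], rule exI[of _ "32 * c0 * K * C\<mu>"], intro allI impI)
    fix j :: nat and \<theta> \<phi> :: real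
    assume \<theta>: "\<theta> \<in> {0<..<pi}" and \<phi>: "\<phi> \<in> {0<..<pi}" and ne: "\<theta> \<noteq> \<phi>"
    define p where "p = a * real j"
    define q where "q = b * real j"
    define N where "N = p + q + w1 + w2 + 1"
    define A where "A = sin (\<theta> / 2) * sin (\<phi> / 2)"
    define B where "B = cos (\<theta> / 2) * cos (\<phi> / 2)"
    define D where "D = 1 - cos ((\<theta> - \<phi>) / 2)"
    define r where "r = \<bar>\<theta> - \<phi>\<bar>"
    define \<mu> where "\<mu> = jacobi_ball_measure \<alpha> \<beta> \<theta> r"
    note pos = half_angle_pos[OF \<theta>] half_angle_pos[OF \<phi>]
    have AB: "A > 0" "B > 0" using pos by (auto simp: A_def B_def)
    have D: "D > 0" using cos_half_diff_less_1[OF \<theta> \<phi> ne] by (simp add: D_def)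
    have DAB: "D = 1 - A - B" by (simp add: D_def A_def B_def diff_divide_distrib cos_diff)
    have r: "r > 0" using ne by (simp add: r_def)
    have p: "p = 0 \<and> j = 0 \<or> p \<ge> 1"
    proof (cases "j = 0")
      case False
      then have "1 * 1 \<le> a * real j" using assms(3) by (intro mult_mono) auto
      then show ?thesis by (simp add: p_def)
    qed (simp add: p_def)
    have q: "q = 0 \<or> q \<ge> 1"
    proof (cases "j = 0 \<or> b = 0")
      case False
      then have "1 * 1 \<le> b * real j" using assms(4) by (intro mult_mono) auto
      then show ?thesis by (simp add: q_def)
    qed (auto simp: q_def)
    have pq0: "p \<ge> 0" "q \<ge> 0" using p q by auto
    have qp: "q \<le> b * (1 + p)"
    proof -
      have "real j \<le> 1 + p" using assms(3) mult_right_mono[of 1 a "real j"] by (simp add: p_def)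
      then show ?thesis using b0 by (simp add: q_def mult_left_mono)
    qed
    have N: "N > 0" using pq0 w by (simp add: N_def)
    let ?M = "jacobi_square (p + w1) (q + w2)"
    let ?X = "jacobi_scale w1 w2 p q A B D N"
    let ?\<Psi> = "\<lambda>e f m w. jacobi_majorant e f m p q A B D N w"
    have use: "\<bar>\<integral>w. Q w \<partial>?M\<bar> \<le> k * (C * ?X)"
      if "bnd T C" "p = 0 \<and> (\<forall>(e, f, m)\<in>set T. e \<ge> 0) \<or> p \<ge> 1" "q = 0 \<and> (\<forall>(e, f, m)\<in>set T. f \<ge> 0) \<or> q \<ge> 1" "k \<ge> 0"
        "\<And>w. w \<in> {0<..<2} \<times> {0<..<2} \<Longrightarrow> \<bar>Q w\<bar> \<le> k * (\<Sum>(e, f, m)\<leftarrow>T. ?\<Psi> e f m w)" for T C k Q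
    proof -
      have *: "\<forall>w\<in>{0<..<2} \<times> {0<..<2}. \<bar>Q w\<bar> \<le> k * (\<Sum>(e, f, m)\<leftarrow>T. ?\<Psi> e f m w)" by (intro ballI that(5))
      note h = that(1)[unfolded bnd_def, THEN conjunct2, THEN spec[of _ p], THEN spec[of _ q], THEN spec[of _ A], THEN spec[of _ B],
          THEN spec[of _ D], THEN spec[of _ N], THEN spec[of _ Q], THEN spec[of _ k]]
      show ?thesis
        by (rule h[THEN mp, OF that(2), THEN mp, OF that(3), THEN mp, OF qp, THEN mp, OF AB(1), THEN mp, OF AB(2),
              THEN mp, OF D, THEN mp, OF N_def, THEN mp, OF that(4), THEN mp, OF *])
    qed
    define I where "I v = (\<integral>w. riesz_integrand N v w \<partial>?M)" for v
    define I1 where "I1 = (\<integral>w. riesz_integrand_fst N (\<theta>, \<phi>) w \<partial>?M)"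
    define I2 where "I2 = (\<integral>w. riesz_integrand_snd N (\<theta>, \<phi>) w \<partial>?M)"
    \<comment> \<open>One bound for both first derivatives of z, so that the squared and the mixed
      products in the gradient are treated alike.\<close>
    define \<Xi> where "\<Xi> w = max \<bar>jz_d \<theta> \<phi> w\<bar> \<bar>jz_d \<phi> \<theta> w\<bar>" for w
    have \<Xi>_ge: "\<bar>jz_d \<theta> \<phi> w\<bar> \<le> \<Xi> w" "\<bar>jz_d \<phi> \<theta> w\<bar> \<le> \<Xi> w" "0 \<le> \<Xi> w" for w by (auto simp: \<Xi>_def)
    have pt: "sqrt D * ((1 - jz \<theta> \<phi> w) powr (- N) * \<Xi> w) \<le> 5 * (?\<Psi> 0 0 0 w + ?\<Psi> (1/2) 0 0 w + ?\<Psi> 0 (1/2) 0 w)"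
        "D * (N * (1 - jz \<theta> \<phi> w) powr (- N - 1) * (\<Xi> w)\<^sup>2) \<le> 75 * (?\<Psi> 0 0 1 w + ?\<Psi> 1 0 1 w + ?\<Psi> 0 1 1 w)"
        "D * (1 - jz \<theta> \<phi> w) powr (- N) \<le> ?\<Psi> 0 0 0 w"
        "p * ((sqrt A + sqrt D) / A) * (D * ((1 - jz \<theta> \<phi> w) powr (- N) * \<Xi> w)) \<le> 20 * (?\<Psi> 0 0 0 w + ?\<Psi> (- 1) 0 0 w + ?\<Psi> (- 1) 1 0 w)"
        "q * ((sqrt B + sqrt D) / B) * (D * ((1 - jz \<theta> \<phi> w) powr (- N) * \<Xi> w)) \<le> 20 * (?\<Psi> 0 0 0 w + ?\<Psi> 0 (- 1) 0 w + ?\<Psi> 1 (- 1) 0 w)"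
      if w': "w \<in> {0<..<2} \<times> {0<..<2}" for w
    proof -
      obtain x y where xy: "w = (x, y)" "0 < x" "x < 2" "0 < y" "y < 2" using w' by auto
      have E: "1 - jz \<theta> \<phi> w = D + B * y + A * x" unfolding xy(1) jz_eq DAB by (simp add: A_def B_def algebra_simps)
      have "cos ((\<phi> - \<theta>) / 2) = cos ((\<theta> - \<phi>) / 2)" by (metis cos_minus minus_diff_eq minus_divide_left)
      then have \<Xi>: "\<Xi> w \<le> 5 * (sqrt D + x * sqrt A + y * sqrt B)"
        using jz_d_le(1)[OF \<theta> \<phi> xy(2-5)] jz_d_le(1)[OF \<phi> \<theta> xy(2-5)]
        unfolding \<Xi>_def A_def B_def D_def xy(1) by (simp add: mult.commute)
      note P = jacobi_majorant_pointwise[OF pq0 AB D less_imp_le[OF N] xy(2) xy(4) \<Xi>_ge(3) \<Xi>, folded xy(1) E]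
      show "sqrt D * ((1 - jz \<theta> \<phi> w) powr (- N) * \<Xi> w) \<le> 5 * (?\<Psi> 0 0 0 w + ?\<Psi> (1/2) 0 0 w + ?\<Psi> 0 (1/2) 0 w)"
        by (rule P(1)) simp
      show "D * (N * (1 - jz \<theta> \<phi> w) powr (- N - 1) * (\<Xi> w)\<^sup>2) \<le> 75 * (?\<Psi> 0 0 1 w + ?\<Psi> 1 0 1 w + ?\<Psi> 0 1 1 w)"
        using P(2) by simp
      show "D * (1 - jz \<theta> \<phi> w) powr (- N) \<le> ?\<Psi> 0 0 0 w"
        by (rule P(3)) simp
      show "p * ((sqrt A + sqrt D) / A) * (D * ((1 - jz \<theta> \<phi> w) powr (- N) * \<Xi> w)) \<le> 20 * (?\<Psi> 0 0 0 w + ?\<Psi> (- 1) 0 0 w + ?\<Psi> (- 1) 1 0 w)"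
        using P(4) by simp
      show "q * ((sqrt B + sqrt D) / B) * (D * ((1 - jz \<theta> \<phi> w) powr (- N) * \<Xi> w)) \<le> 20 * (?\<Psi> 0 0 0 w + ?\<Psi> 0 (- 1) 0 w + ?\<Psi> 1 (- 1) 0 w)"
        using P(5) by simp
    qed
    have absF: "\<bar>riesz_integrand N (\<theta>, \<phi>) w\<bar> \<le> (1 - jz \<theta> \<phi> w) powr (- N) * \<Xi> w" for w
      unfolding riesz_integrand_def using \<Xi>_ge(1)[of w] by (simp add: abs_mult mult_left_mono)
    have bI: "sqrt D * \<bar>I (\<theta>, \<phi>)\<bar> \<le> 5 * (C1 * ?X)"
    proof -
      have "\<bar>\<integral>w. sqrt D * riesz_integrand N (\<theta>, \<phi>) w \<partial>?M\<bar> \<le> 5 * (C1 * ?X)"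
      proof (rule use[OF C1])
        fix w :: "real \<times> real" assume w': "w \<in> {0<..<2} \<times> {0<..<2}"
        have "\<bar>sqrt D * riesz_integrand N (\<theta>, \<phi>) w\<bar> \<le> sqrt D * ((1 - jz \<theta> \<phi> w) powr (- N) * \<Xi> w)"
          unfolding abs_mult using absF D by (intro mult_mono) auto
        also note pt(1)[OF w']
        finally show "\<bar>sqrt D * riesz_integrand N (\<theta>, \<phi>) w\<bar> \<le> 5 * (\<Sum>(e, f, m)\<leftarrow>T1. ?\<Psi> e f m w)" by (simp add: T1_def add.assoc)
      qed (use p q in \<open>auto simp: T1_def\<close>)
      then show ?thesis using D by (simp add: I_def abs_mult)
    qed
    have bp: "p * ((sqrt A + sqrt D) / A) * (D * \<bar>I (\<theta>, \<phi>)\<bar>) \<le> 20 * (C3 * ?X)"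
    proof (cases "p \<ge> 1")
      case True
      let ?k = "p * ((sqrt A + sqrt D) / A) * D"
      have k: "?k \<ge> 0" using pq0 AB D by simp
      have "\<bar>\<integral>w. ?k * riesz_integrand N (\<theta>, \<phi>) w \<partial>?M\<bar> \<le> 20 * (C3 * ?X)"
      proof (rule use[OF C3])
        fix w :: "real \<times> real" assume w': "w \<in> {0<..<2} \<times> {0<..<2}"
        have "\<bar>?k * riesz_integrand N (\<theta>, \<phi>) w\<bar> \<le> ?k * ((1 - jz \<theta> \<phi> w) powr (- N) * \<Xi> w)"
          unfolding abs_mult[of ?k] abs_of_nonneg[OF k] using absF k by (intro mult_left_mono) auto
        also have "\<dots> = p * ((sqrt A + sqrt D) / A) * (D * ((1 - jz \<theta> \<phi> w) powr (- N) * \<Xi> w))" by (simp only: mult.assoc)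
        also note pt(4)[OF w']
        finally show "\<bar>?k * riesz_integrand N (\<theta>, \<phi>) w\<bar> \<le> 20 * (\<Sum>(e, f, m)\<leftarrow>T3. ?\<Psi> e f m w)" by (simp add: T3_def add.assoc)
      qed (use True q in \<open>auto simp: T3_def\<close>)
      moreover have "\<bar>\<integral>w. ?k * riesz_integrand N (\<theta>, \<phi>) w \<partial>?M\<bar> = ?k * \<bar>I (\<theta>, \<phi>)\<bar>"
        unfolding integral_mult_right_zero I_def abs_mult[of ?k] abs_of_nonneg[OF k] ..
      ultimately show ?thesis by (simp only: mult.assoc)
    next
      \<comment> \<open>Here p = 0 and the left side vanishes; no majorant with exponent -1 is
        called upon.\<close>
      case False
      have "Gamma (p + w1) > 0" "Gamma (q + w2) > 0" "Gamma N > 0" using pq0 w N by (auto intro!: Gamma_real_pos)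
      then have "?X \<ge> 0" by (simp add: jacobi_scale_def)
      then show ?thesis using False p Cpos by auto
    qed
    have bq: "q * ((sqrt B + sqrt D) / B) * (D * \<bar>I (\<theta>, \<phi>)\<bar>) \<le> 20 * (C4 * ?X)"
    proof (cases "q \<ge> 1")
      case True
      let ?k = "q * ((sqrt B + sqrt D) / B) * D"
      have k: "?k \<ge> 0" using pq0 AB D by simp
      have "\<bar>\<integral>w. ?k * riesz_integrand N (\<theta>, \<phi>) w \<partial>?M\<bar> \<le> 20 * (C4 * ?X)"
      proof (rule use[OF C4])
        fix w :: "real \<times> real" assume w': "w \<in> {0<..<2} \<times> {0<..<2}"
        have "\<bar>?k * riesz_integrand N (\<theta>, \<phi>) w\<bar> \<le> ?k * ((1 - jz \<theta> \<phi> w) powr (- N) * \<Xi> w)"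
          unfolding abs_mult[of ?k] abs_of_nonneg[OF k] using absF k by (intro mult_left_mono) auto
        also have "\<dots> = q * ((sqrt B + sqrt D) / B) * (D * ((1 - jz \<theta> \<phi> w) powr (- N) * \<Xi> w))" by (simp only: mult.assoc)
        also note pt(5)[OF w']
        finally show "\<bar>?k * riesz_integrand N (\<theta>, \<phi>) w\<bar> \<le> 20 * (\<Sum>(e, f, m)\<leftarrow>T4. ?\<Psi> e f m w)" by (simp add: T4_def add.assoc)
      qed (use True p in \<open>auto simp: T4_def\<close>)
      moreover have "\<bar>\<integral>w. ?k * riesz_integrand N (\<theta>, \<phi>) w \<partial>?M\<bar> = ?k * \<bar>I (\<theta>, \<phi>)\<bar>"
        unfolding integral_mult_right_zero I_def abs_mult[of ?k] abs_of_nonneg[OF k] ..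
      ultimately show ?thesis by (simp only: mult.assoc)
    next
      case False
      have "Gamma (p + w1) > 0" "Gamma (q + w2) > 0" "Gamma N > 0" using pq0 w N by (auto intro!: Gamma_real_pos)
      then have "?X \<ge> 0" by (simp add: jacobi_scale_def)
      then show ?thesis using False q Cpos by auto
    qed
    \<comment> \<open>Both components of the gradient of the integrand have this shape, with
      \<open>S\<close> quadratic in first derivatives of z and \<open>Z\<close> a bounded second
      derivative.\<close>
    have grad: "D * \<bar>\<integral>w. N * (1 - jz \<theta> \<phi> w) powr (- N - 1) * S w + (1 - jz \<theta> \<phi> w) powr (- N) * Z w \<partial>?M\<bar> \<le> 75 * (C2 * ?X)"
      if S: "\<And>w. \<bar>S w\<bar> \<le> (\<Xi> w)\<^sup>2" and Z: "\<And>w. w \<in> {0<..<2} \<times> {0<..<2} \<Longrightarrow> \<bar>Z w\<bar> \<le> 1" for S Z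
    proof -
      let ?Q = "\<lambda>w. N * (1 - jz \<theta> \<phi> w) powr (- N - 1) * S w + (1 - jz \<theta> \<phi> w) powr (- N) * Z w"
      have "\<bar>\<integral>w. D * ?Q w \<partial>?M\<bar> \<le> 75 * (C2 * ?X)"
      proof (rule use[OF C2])
        fix w :: "real \<times> real" assume w': "w \<in> {0<..<2} \<times> {0<..<2}"
        let ?E = "1 - jz \<theta> \<phi> w"
        have "\<bar>?Q w\<bar> \<le> \<bar>N * ?E powr (- N - 1) * S w\<bar> + \<bar>?E powr (- N) * Z w\<bar>" by (rule abs_triangle_ineq)
        also have "\<dots> \<le> N * ?E powr (- N - 1) * (\<Xi> w)\<^sup>2 + ?E powr (- N) * 1"
        proof (rule add_mono)
          show "\<bar>N * ?E powr (- N - 1) * S w\<bar> \<le> N * ?E powr (- N - 1) * (\<Xi> w)\<^sup>2"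
            using N S[of w] by (simp add: abs_mult mult_left_mono)
          show "\<bar>?E powr (- N) * Z w\<bar> \<le> ?E powr (- N) * 1"
            unfolding abs_mult using Z[OF w'] by (intro mult_mono) auto
        qed
        finally have "D * \<bar>?Q w\<bar> \<le> D * (N * ?E powr (- N - 1) * (\<Xi> w)\<^sup>2 + ?E powr (- N) * 1)" using D by (intro mult_left_mono) auto
        also have "\<dots> = D * (N * ?E powr (- N - 1) * (\<Xi> w)\<^sup>2) + D * ?E powr (- N)" by (simp add: algebra_simps)
        also have "\<dots> \<le> 75 * (?\<Psi> 0 0 1 w + ?\<Psi> 1 0 1 w + ?\<Psi> 0 1 1 w) + 75 * ?\<Psi> 0 0 0 w"
        proof (rule add_mono[OF pt(2)[OF w']])
          have "0 \<le> D * ?E powr (- N)" using D by simp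
          then show "D * ?E powr (- N) \<le> 75 * ?\<Psi> 0 0 0 w" using pt(3)[OF w'] by linarith
        qed
        also have "\<dots> = 75 * (\<Sum>(e, f, m)\<leftarrow>T2. ?\<Psi> e f m w)" by (simp add: T2_def algebra_simps)
        finally show "\<bar>D * ?Q w\<bar> \<le> 75 * (\<Sum>(e, f, m)\<leftarrow>T2. ?\<Psi> e f m w)" unfolding abs_mult[of D] abs_of_pos[OF D] .
      qed (use p q in \<open>auto simp: T2_def\<close>)
      moreover have "\<bar>\<integral>w. D * ?Q w \<partial>?M\<bar> = D * \<bar>\<integral>w. ?Q w \<partial>?M\<bar>" using D by (simp only: integral_mult_right_zero abs_mult abs_of_pos)
      ultimately show ?thesis by simp
    qed
    have bI1: "D * \<bar>I1\<bar> \<le> 75 * (C2 * ?X)"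
    proof -
      have "D * \<bar>\<integral>w. N * (1 - jz \<theta> \<phi> w) powr (- N - 1) * (jz_d \<theta> \<phi> w)\<^sup>2 + (1 - jz \<theta> \<phi> w) powr (- N) * (- (jz \<theta> \<phi> w / 4)) \<partial>?M\<bar> \<le> 75 * (C2 * ?X)"
      proof (rule grad)
        show "\<bar>(jz_d \<theta> \<phi> w)\<^sup>2\<bar> \<le> (\<Xi> w)\<^sup>2" for w using power_mono[OF \<Xi>_ge(1)[of w] abs_ge_zero, of 2] by simp
        show "\<bar>- (jz \<theta> \<phi> w / 4)\<bar> \<le> 1" if "w \<in> {0<..<2} \<times> {0<..<2}" for w using abs_jz_le_1[OF that, of \<theta> \<phi>] by simp
      qed
      then show ?thesis unfolding I1_def riesz_integrand_fst_def by simp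
    qed
    have bI2: "D * \<bar>I2\<bar> \<le> 75 * (C2 * ?X)"
    proof -
      have "D * \<bar>\<integral>w. N * (1 - jz \<theta> \<phi> w) powr (- N - 1) * (jz_d \<theta> \<phi> w * jz_d \<phi> \<theta> w) + (1 - jz \<theta> \<phi> w) powr (- N) * jz_m \<theta> \<phi> w \<partial>?M\<bar> \<le> 75 * (C2 * ?X)"
      proof (rule grad)
        show "\<bar>jz_d \<theta> \<phi> w * jz_d \<phi> \<theta> w\<bar> \<le> (\<Xi> w)\<^sup>2" for w
          unfolding abs_mult power2_eq_square using \<Xi>_ge[of w] by (intro mult_mono) auto
      qed (rule abs_jz_m_le)
      then show ?thesis unfolding I2_def riesz_integrand_snd_def by simp
    qed
    let ?u = "jacobi_u a b j"
    define L where "L x = a * real j / 2 * (cos (x / 2) / sin (x / 2)) - b * real j / 2 * (sin (x / 2) / cos (x / 2))" for x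
    define cK where "cK = 2 powr (2 - N) * Gamma N / (pi * Gamma (p + w1) * Gamma (q + w2))"
    define H where "H = (D + A) powr (- w1) * (D + B) powr (- w2)"
    define \<Lambda> where "\<Lambda> = cK * (?u \<theta> * ?u \<phi>)"
    have Gpos: "Gamma (p + w1) > 0" "Gamma (q + w2) > 0" "Gamma N > 0" using pq0 w N by (auto intro!: Gamma_real_pos)
    have u: "?u \<theta> * ?u \<phi> = A powr p * B powr q"
      unfolding jacobi_u_def A_def B_def p_def[symmetric] q_def[symmetric] powr_mult by (simp only: mult_ac)
    have \<Lambda>0: "\<Lambda> \<ge> 0" unfolding \<Lambda>_def u cK_def using Gpos by simp
    \<comment> \<open>The cancellation that makes the estimate uniform in j: Gamma quotients, powers
      of A and B, and the growing power of 2 all drop out.\<close>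
    have \<Lambda>X: "\<Lambda> * ?X = c0 * H"
    proof -
      have g: "A powr p * A powr (- p) = 1" "B powr q * B powr (- q) = 1" using AB by (simp_all flip: powr_add)
      have "2 powr (2 - N) * 2 powr (p + q) = 2 powr (1 - w1 - w2)" by (simp add: N_def algebra_simps flip: powr_add)
      moreover have "\<Lambda> * ?X = (2 powr (2 - N) * 2 powr (p + q)) / pi * (Gamma N / (Gamma (p + w1) * Gamma (q + w2)) * (Gamma (p + w1) * Gamma (q + w2) / Gamma N))
          * (A powr p * A powr (- p)) * (B powr q * B powr (- q)) * H"
        unfolding \<Lambda>_def u cK_def jacobi_scale_def H_def by (simp only: divide_inverse inverse_mult_distrib mult_ac)
      ultimately show ?thesis unfolding g c0_def using Gpos by simp
    qed
    have H0: "H \<ge> 0" by (simp add: H_def)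
    have wr: "weighted_riesz \<alpha> \<beta> a b j (fst v) (snd v) = cK * (?u (fst v) * ?u (snd v) * I v)"
      if "fst v \<in> {0<..<pi}" "snd v \<in> {0<..<pi}" "fst v \<noteq> snd v" for v
      using weighted_riesz_eq[OF assms(1,2) _ b0 that, of a j] assms(3)
      unfolding cK_def I_def N_def p_def q_def w1_def w2_def by simp
    have m: "0 < \<mu>" "\<mu> \<le> C\<mu> * r * ((1 - B) powr w1 * (1 - A) powr w2)"
      using jacobi_ball_measure_bounds[OF assms(1,2) \<theta> \<phi> ne] unfolding \<mu>_def r_def C\<mu>_def w1_def w2_def A_def B_def by auto
    \<comment> \<open>Since D + A = 1 - B and D + B = 1 - A, H is exactly the reciprocal of the
      product in the bound for the ball measure.\<close>
    have \<mu>H: "H * \<mu> \<le> C\<mu> * r"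
    proof -
      have DA: "D + A = 1 - B" "D + B = 1 - A" by (auto simp: DAB)
      have pos': "1 - B > 0" "1 - A > 0" using D AB DA by linarith+
      have "H * \<mu> \<le> H * (C\<mu> * r * ((1 - B) powr w1 * (1 - A) powr w2))" using m H0 by (intro mult_left_mono)
      also have "\<dots> = C\<mu> * r * ((1 - B) powr (- w1) * (1 - B) powr w1) * ((1 - A) powr (- w2) * (1 - A) powr w2)"
        unfolding H_def DA by (simp only: mult_ac)
      also have "\<dots> = C\<mu> * r" using pos' by (simp flip: powr_add)
      finally show ?thesis .
    qed
    have Dr: "r\<^sup>2 \<le> 32 * D"
      using one_minus_cos_ge[of "\<theta> - \<phi>"] \<theta> \<phi> by (auto simp: D_def r_def abs_le_iff)
    have size: "\<bar>weighted_riesz \<alpha> \<beta> a b j \<theta> \<phi>\<bar> \<le> 30 * c0 * C1 * C\<mu> / \<mu>"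
    proof -
      have "r \<le> 6 * sqrt D"
      proof (rule power2_le_imp_le)
        show "r\<^sup>2 \<le> (6 * sqrt D)\<^sup>2" using Dr D by (simp add: power_mult_distrib)
      qed (use D in simp)
      have wI: "\<bar>weighted_riesz \<alpha> \<beta> a b j \<theta> \<phi>\<bar> = \<Lambda> * \<bar>I (\<theta>, \<phi>)\<bar>"
      proof -
        have "weighted_riesz \<alpha> \<beta> a b j \<theta> \<phi> = \<Lambda> * I (\<theta>, \<phi>)"
          using wr[of "(\<theta>, \<phi>)"] \<theta> \<phi> ne unfolding \<Lambda>_def by (simp add: mult.assoc)
        then show ?thesis using \<Lambda>0 by (simp add: abs_mult)
      qed
      have "r * \<bar>weighted_riesz \<alpha> \<beta> a b j \<theta> \<phi>\<bar> \<le> 6 * sqrt D * (\<Lambda> * \<bar>I (\<theta>, \<phi>)\<bar>)" unfolding wI using \<open>r \<le> 6 * sqrt D\<close> \<Lambda>0 by (intro mult_right_mono) auto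
      also have "\<dots> = 6 * \<Lambda> * (sqrt D * \<bar>I (\<theta>, \<phi>)\<bar>)" by simp
      also have "\<dots> \<le> 6 * \<Lambda> * (5 * (C1 * ?X))" using bI \<Lambda>0 by (intro mult_left_mono) auto
      also have "\<dots> = 30 * C1 * (\<Lambda> * ?X)" by simp
      also have "\<dots> = 30 * c0 * C1 * H" unfolding \<Lambda>X by simp
      finally have "r * \<bar>weighted_riesz \<alpha> \<beta> a b j \<theta> \<phi>\<bar> * \<mu> \<le> 30 * c0 * C1 * H * \<mu>" using m by (intro mult_right_mono) auto
      also have "\<dots> = 30 * c0 * C1 * (H * \<mu>)" by simp
      also have "\<dots> \<le> 30 * c0 * C1 * (C\<mu> * r)" using \<mu>H c0 Cpos by (intro mult_left_mono) auto
      finally have "r * (\<bar>weighted_riesz \<alpha> \<beta> a b j \<theta> \<phi>\<bar> * \<mu>) \<le> r * (30 * c0 * C1 * C\<mu>)" by (simp add: mult_ac)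
      then have "\<bar>weighted_riesz \<alpha> \<beta> a b j \<theta> \<phi>\<bar> * \<mu> \<le> 30 * c0 * C1 * C\<mu>" using r by simp
      then show ?thesis using m by (simp add: pos_le_divide_eq)
    qed
    define G where "G = (\<Lambda> * (L \<theta> * I (\<theta>, \<phi>) + I1), \<Lambda> * (L \<phi> * I (\<theta>, \<phi>) + I2))"
    have gd: "GDERIV (\<lambda>(x, y). weighted_riesz \<alpha> \<beta> a b j x y) (\<theta>, \<phi>) :> G"
    proof -
      have dI: "(I has_derivative (\<lambda>h. inner h (I1, I2))) (at (\<theta>, \<phi>))"
        using gderiv_riesz_integral[of "p + w1" "q + w2" N "(\<theta>, \<phi>)"] pq0 w N \<theta> \<phi> ne
        unfolding gderiv_def I_def[abs_def] I1_def I2_def by simp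
      have d1: "((\<lambda>v. ?u (fst v)) has_derivative (\<lambda>h. fst h * (?u \<theta> * L \<theta>))) (at (\<theta>, \<phi>))"
        by (rule DERIV_compose_FDERIV[where g = fst and f = ?u, OF _ has_derivative_fst[OF has_derivative_ident]])
          (use jacobi_u_deriv[OF \<theta>] in \<open>simp add: L_def\<close>)
      have d2: "((\<lambda>v. ?u (snd v)) has_derivative (\<lambda>h. snd h * (?u \<phi> * L \<phi>))) (at (\<theta>, \<phi>))"
        by (rule DERIV_compose_FDERIV[where g = snd and f = ?u, OF _ has_derivative_snd[OF has_derivative_ident]])
          (use jacobi_u_deriv[OF \<phi>] in \<open>simp add: L_def\<close>)
      have d: "((\<lambda>v. cK * (?u (fst v) * ?u (snd v) * I v)) has_derivative (\<lambda>h. inner h G)) (at (\<theta>, \<phi>))"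
        by (rule has_derivative_eq_rhs[OF has_derivative_mult_right[OF has_derivative_mult[OF has_derivative_mult[OF d1 d2] dI]]])
          (auto simp: fun_eq_iff G_def \<Lambda>_def algebra_simps)
      \<comment> \<open>The integral formula for the kernel is known only off the diagonal and
        inside the square, so the derivative is transferred within this open set.\<close>
      define U where "U = {v :: real \<times> real. 0 < fst v \<and> fst v < pi \<and> 0 < snd v \<and> snd v < pi \<and> fst v \<noteq> snd v}"
      have U: "open U" unfolding U_def by (intro open_Collect_conj open_Collect_less open_Collect_neq continuous_intros)
      show ?thesis unfolding gderiv_def
      proof (rule has_derivative_transform_within_open[OF d U])
        show "(\<theta>, \<phi>) \<in> U" using \<theta> \<phi> ne by (simp add: U_def)
        show "cK * (?u (fst v) * ?u (snd v) * I v) = (\<lambda>(x, y). weighted_riesz \<alpha> \<beta> a b j x y) v" if "v \<in> U" for v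
          using wr[of v] that by (simp add: U_def split_beta)
      qed
    qed
    have Lb: "D * \<bar>L x * I (\<theta>, \<phi>)\<bar> \<le> 20 * (C3 * ?X) + 20 * (C4 * ?X)"
      if x: "x \<in> {0<..<pi}" "1 / sin (x / 2) \<le> 2 * ((sqrt A + sqrt D) / A)" "1 / cos (x / 2) \<le> 2 * ((sqrt B + sqrt D) / B)" for x
    proof -
      note sc = half_angle_pos[OF x(1)]
      have "cos (x / 2) / sin (x / 2) \<le> 1 / sin (x / 2)" "sin (x / 2) / cos (x / 2) \<le> 1 / cos (x / 2)"
        using sc by (auto intro!: divide_right_mono)
      then have "cos (x / 2) / sin (x / 2) \<le> 2 * ((sqrt A + sqrt D) / A)" "sin (x / 2) / cos (x / 2) \<le> 2 * ((sqrt B + sqrt D) / B)"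
        using x by linarith+
      then have u: "p / 2 * (cos (x / 2) / sin (x / 2)) \<le> p / 2 * (2 * ((sqrt A + sqrt D) / A))"
        "q / 2 * (sin (x / 2) / cos (x / 2)) \<le> q / 2 * (2 * ((sqrt B + sqrt D) / B))"
        using pq0 by (intro mult_left_mono; simp)+
      have u0: "0 \<le> p / 2 * (cos (x / 2) / sin (x / 2))" "0 \<le> q / 2 * (sin (x / 2) / cos (x / 2))" using pq0 sc by auto
      have tri: "\<bar>s - t\<bar> \<le> s' + t'" if "0 \<le> s" "0 \<le> t" "s \<le> s'" "t \<le> t'" for s t s' t' :: real using that by linarith
      have "\<bar>L x\<bar> \<le> p / 2 * (2 * ((sqrt A + sqrt D) / A)) + q / 2 * (2 * ((sqrt B + sqrt D) / B))"
        unfolding L_def p_def[symmetric] q_def[symmetric] by (rule tri[OF u0 u])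
      also have "\<dots> = p * ((sqrt A + sqrt D) / A) + q * ((sqrt B + sqrt D) / B)"
      proof -
        have "s / 2 * (2 * t) = s * t" for s t :: real by simp
        then show ?thesis by (simp only:)
      qed
      finally have "\<bar>L x\<bar> \<le> p * ((sqrt A + sqrt D) / A) + q * ((sqrt B + sqrt D) / B)" .
      then have "\<bar>L x\<bar> * (D * \<bar>I (\<theta>, \<phi>)\<bar>) \<le> (p * ((sqrt A + sqrt D) / A) + q * ((sqrt B + sqrt D) / B)) * (D * \<bar>I (\<theta>, \<phi>)\<bar>)"
        using D by (intro mult_right_mono) auto
      also have "\<dots> \<le> 20 * (C3 * ?X) + 20 * (C4 * ?X)" unfolding distrib_right using bp bq by (rule add_mono)
      finally show ?thesis by (simp add: abs_mult mult_ac)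
    qed
    \<comment> \<open>The bounds for 1 / sin and 1 / cos do not involve x and y; the value 1 merely
      lies in the admissible range.\<close>
    have L1: "D * \<bar>L \<theta> * I (\<theta>, \<phi>)\<bar> \<le> 20 * (C3 * ?X) + 20 * (C4 * ?X)"
      using jz_d_le(2,3)[OF \<theta> \<phi>, of 1 1] by (intro Lb[OF \<theta>]) (simp_all add: A_def B_def D_def)
    have L2: "D * \<bar>L \<phi> * I (\<theta>, \<phi>)\<bar> \<le> 20 * (C3 * ?X) + 20 * (C4 * ?X)"
    proof -
      have "cos ((\<phi> - \<theta>) / 2) = cos ((\<theta> - \<phi>) / 2)" by (metis cos_minus minus_diff_eq minus_divide_left)
      then show ?thesis
        using jz_d_le(2,3)[OF \<phi> \<theta>, of 1 1] by (intro Lb[OF \<phi>]) (simp_all add: A_def B_def D_def mult.commute)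
    qed
    have "D * norm G \<le> c0 * K * H"
    proof -
      have "norm G \<le> \<Lambda> * \<bar>L \<theta> * I (\<theta>, \<phi>) + I1\<bar> + \<Lambda> * \<bar>L \<phi> * I (\<theta>, \<phi>) + I2\<bar>"
        unfolding G_def using norm_Pair_le[of "\<Lambda> * (L \<theta> * I (\<theta>, \<phi>) + I1)" "\<Lambda> * (L \<phi> * I (\<theta>, \<phi>) + I2)"] \<Lambda>0 by (simp add: abs_mult)
      also have "\<dots> \<le> \<Lambda> * (\<bar>L \<theta> * I (\<theta>, \<phi>)\<bar> + \<bar>I1\<bar>) + \<Lambda> * (\<bar>L \<phi> * I (\<theta>, \<phi>)\<bar> + \<bar>I2\<bar>)"
        using \<Lambda>0 by (intro add_mono mult_left_mono abs_triangle_ineq)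
      finally have "D * norm G \<le> D * (\<Lambda> * (\<bar>L \<theta> * I (\<theta>, \<phi>)\<bar> + \<bar>I1\<bar>) + \<Lambda> * (\<bar>L \<phi> * I (\<theta>, \<phi>)\<bar> + \<bar>I2\<bar>))"
        using D by (intro mult_left_mono) auto
      also have "\<dots> = \<Lambda> * ((D * \<bar>L \<theta> * I (\<theta>, \<phi>)\<bar> + D * \<bar>I1\<bar>) + (D * \<bar>L \<phi> * I (\<theta>, \<phi>)\<bar> + D * \<bar>I2\<bar>))"
        by (simp only: distrib_left mult_ac)
      also have "\<dots> \<le> \<Lambda> * ((20 * (C3 * ?X) + 20 * (C4 * ?X) + 75 * (C2 * ?X)) + (20 * (C3 * ?X) + 20 * (C4 * ?X) + 75 * (C2 * ?X)))"
        using \<Lambda>0 L1 L2 bI1 bI2 by (intro mult_left_mono add_mono) auto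
      also have "\<dots> = K * (\<Lambda> * ?X)" by (simp add: K_def algebra_simps)
      finally show ?thesis unfolding \<Lambda>X by (simp add: mult_ac)
    qed
    then have "32 * D * norm G \<le> 32 * c0 * K * H" by simp
    moreover have "r\<^sup>2 * norm G \<le> 32 * D * norm G" using Dr by (intro mult_right_mono) auto
    ultimately have "r\<^sup>2 * norm G * \<mu> \<le> 32 * c0 * K * H * \<mu>" using m by (intro mult_right_mono) auto
    also have "\<dots> = 32 * c0 * K * (H * \<mu>)" by simp
    also have "\<dots> \<le> 32 * c0 * K * (C\<mu> * r)" using \<mu>H c0 K by (intro mult_left_mono) auto
    finally have "r * (norm G * (r * \<mu>)) \<le> r * (32 * c0 * K * C\<mu>)" by (simp add: power2_eq_square mult_ac)
    then have "norm G * (r * \<mu>) \<le> 32 * c0 * K * C\<mu>" using r by simp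
    then have "norm G \<le> 32 * c0 * K * C\<mu> / (r * \<mu>)" using r m by (simp add: pos_le_divide_eq)
    with size gd show "\<bar>weighted_riesz \<alpha> \<beta> a b j \<theta> \<phi>\<bar> \<le> 30 * c0 * C1 * C\<mu> / jacobi_ball_measure \<alpha> \<beta> \<theta> \<bar>\<theta> - \<phi>\<bar>
             \<and> (\<exists>D. GDERIV (\<lambda>(x, y). weighted_riesz \<alpha> \<beta> a b j x y) (\<theta>, \<phi>) :> D
                  \<and> norm D \<le> 32 * c0 * K * C\<mu> / (\<bar>\<theta> - \<phi>\<bar> * jacobi_ball_measure \<alpha> \<beta> \<theta> \<bar>\<theta> - \<phi>\<bar>))"
      unfolding \<mu>_def r_def by blast
  qed
qed

end
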